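(* Let $n,d\in\mathbb N$, $q\in(-\infty,1)$, and let $\mathcal X=\{x\in\mathbb R^n: g_j(x)\geq 0,\ j=1,\dots,m\}$ be a compact basic semi-algebraic set with nonempty interior, where $g_1,\dots,g_m\in\mathbb R[x]$ and one of the $g_j$ is of the form $R^2-\sum_{i=1}^n x_i^2$. Let $\rho$ be the optimal value and $\mathbf y^\star=(y^\star_\alpha)_{|\alpha|\le 2d}$ the unique optimal solution of the ideal problem $\max\{\phi_q(M_d(\mathbf y)) : \mathbf y\in\mathcal M_{2d}(\mathcal X),\ y_0=1\}$, and let $p^\star_d(x):=\mathbf v_d(x)^\top M_d(\mathbf y^\star)^{q-1}\mathbf v_d(x)$. For every $\delta=0,1,2,\dots$ let $\mathbf y^\star_{d,\delta}$ be an optimal solution, with optimal value $\rho_\delta$, of the relaxation $\max\{\phi_q(M_d(\mathbf y)) : \mathbf y\in\mathcal M^{\mathsf{SDP}}_{2(d+\delta)}(\mathcal X),\ y_0=1\}$, and let $p^\star_{d,\delta}(x):=\mathbf v_d(x)^\top M_d(\mathbf y^\star_{d,\delta})^{q-1}\mathbf v_d(x)$. Then: (a) $\rho_\delta\to\rho$ as $\delta\to\infty$; (b) for every $\alpha\in\mathbb N^n$ with $|\alpha|\le 2d$, $\lim_{\delta\to\infty}y^\star_{d,\delta,\alpha}=y^\star_\alpha$; (c) $p^\star_{d,\delta}\to p^\star_d$ (coefficientwise) as $\delta\to\infty$; (d) if the polynomial $p^\star:=\mathrm{trace}(M_d(\mathbf y^\star)^q)-p^\star_d$ belongs to $\mathcal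 P^{\mathsf{SOS}}_{2(d+\delta)}(\mathcal X)$ for some $\delta$, then finite convergence takes place: $\mathbf y^\star_{d,\delta}$ is the unique optimal solution of the ideal problem (i.e. equals $\mathbf y^\star$) and it has a representing measure, namely the optimal design measure whose moments up to order $2d$ are $\mathbf y^\star$.
   Context: $s(k):=\binom{n+k}{n}$. $\mathbf v_k(x)$ is the vector of monomials $x^\alpha$, $|\alpha|\le k$. The moment matrix $M_k(\mathbf y)$ has entries $y_{\alpha+\beta}$, $|\alpha|,|\beta|\le k$; the localizing matrix of $f=\sum_\gamma f_\gamma x^\gamma$ is $M_k(f\mathbf y)(\alpha,\beta)=\sum_\gamma f_\gamma y_{\gamma+\alpha+\beta}$. $\mathcal M_{2d}(\mathcal X)$ is the set of $\mathbf y\in\mathbb R^{s(2d)}$ such that $y_\alpha=\int_{\mathcal X}x^\alpha d\mu$ for all $|\alpha|\le 2d$ for some nonnegative Borel measure $\mu$ on $\mathcal X$ (a representing measure). Let $v_j:=\lceil\deg(g_j)/2\rceil$. $\mathcal M^{\mathsf{SDP}}_{2(d+\delta)}(\mathcal X)$ is the set of $\mathbf y\in\mathbb R^{s(2d)}$ for which there is $\mathbf y_\delta\in\mathbb R^{s(2(d+\delta))}$ with truncation $(y_{\delta,\alpha})_{|\alpha|\le 2d}=\mathbf y$, $M_{d+\delta}(\mathbf y_\delta)\succeq 0$ and $M_{d+\delta-v_j}(g_j\mathbf y_\delta)\succeq0$, $j=1,\dots,m$. $\mathcal P^{\mathsf{SOS}}_{2(d+\delta)}(\mathcal X)$ is the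 set of polynomials $h$ of degree at most $2d$ with $h=\sigma_0+\sum_j g_j\sigma_j$, $\sigma_0$ a sum of squares of polynomials of degree $\le d+\delta$, $\sigma_j$ a sum of squares of polynomials of degree $\le d+\delta-v_j$. Kiefer's criterion on $p\times p$ positive semidefinite matrices ($p=s(d)$): for positive definite $M$, $\phi_q(M)=(\frac1p\mathrm{trace}(M^q))^{1/q}$ ($q\ne 0$), $\phi_0(M)=\det(M)^{1/p}$; for singular $M$, $\phi_q(M)=(\frac1p\mathrm{trace}M^q)^{1/q}$ if $q\in(0,1]$ and $0$ if $q\le 0$. It is known that the ideal problem has a unique optimal solution $\mathbf y^\star$ and that $M_d(\mathbf y^\star)$ and each $M_d(\mathbf y^\star_{d,\delta})$ are positive definite. *)

theory Defs
  imports "HOL-Analysis.Analysis" "HOL-Probability.Probability"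
begin

(* Multi-indices alpha in N^n are functions 'n => nat for a finite type 'n (n = CARD('n)).
   Points of R^n are real^'n. Polynomials in R[x] are coefficient functions with finite support.
   Moment vectors y are functions on multi-indices (entries outside the truncation are 0). *)

type_synonym 'n mexp = "'n \<Rightarrow> nat"
type_synonym 'n mpoly = "'n mexp \<Rightarrow> real"

definition mdeg :: "'n::finite mexp \<Rightarrow> nat" where
  "mdeg \<alpha> = (\<Sum>i\<in>UNIV. \<alpha> i)"

definition madd :: "'n mexp \<Rightarrow> 'n mexp \<Rightarrow> 'n mexp" where
  "madd \<alpha> \<beta> = (\<lambda>i. \<alpha> i + \<beta> i)"

definition mzero :: "'n mexp" where
  "mzero = (\<lambda>i. 0)"

definition Mon :: "nat \<Rightarrow> 'n::finite mexp set" where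
  "Mon k = {\<alpha>. mdeg \<alpha> \<le> k}"

definition is_poly :: "'n mpoly \<Rightarrow> bool" where
  "is_poly p \<longleftrightarrow> finite {\<alpha>. p \<alpha> \<noteq> 0}"

definition poly_deg :: "'n::finite mpoly \<Rightarrow> nat" where
  "poly_deg p = Max ({mdeg \<alpha> | \<alpha>. p \<alpha> \<noteq> 0} \<union> {0})"

definition monom :: "'n::finite mexp \<Rightarrow> real^'n \<Rightarrow> real" where
  "monom \<alpha> x = (\<Prod>i\<in>UNIV. (x $ i) ^ \<alpha> i)"

definition peval :: "'n::finite mpoly \<Rightarrow> real^'n \<Rightarrow> real" where
  "peval p x = (\<Sum>\<alpha>\<in>{\<alpha>. p \<alpha> \<noteq> 0}. p \<alpha> * monom \<alpha> x)"

definition padd :: "'n mpoly \<Rightarrow> 'n mpoly \<Rightarrow> 'n mpoly" where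
  "padd p r = (\<lambda>\<gamma>. p \<gamma> + r \<gamma>)"

definition pmult :: "'n::finite mpoly \<Rightarrow> 'n mpoly \<Rightarrow> 'n mpoly" where
  "pmult p r = (\<lambda>\<gamma>. \<Sum>\<alpha>\<in>{\<alpha>. \<forall>i. \<alpha> i \<le> \<gamma> i}. p \<alpha> * r (\<lambda>i. \<gamma> i - \<alpha> i))"

definition pconst :: "real \<Rightarrow> 'n mpoly" where
  "pconst c = (\<lambda>\<gamma>. if \<gamma> = mzero then c else 0)"

definition ball_poly :: "real \<Rightarrow> 'n mpoly" where
  "ball_poly R = (\<lambda>\<gamma>. if \<gamma> = mzero then R^2
                      else if (\<exists>i. \<gamma> = (\<lambda>k. if k = i then 2 else 0)) then -1 else 0)"

definition sos_deg :: "nat \<Rightarrow> 'n::finite mpoly \<Rightarrow> bool" where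
  "sos_deg k \<sigma> \<longleftrightarrow> (\<exists>L::nat set. \<exists>h::nat \<Rightarrow> 'n mpoly. finite L \<and>
      (\<forall>l\<in>L. is_poly (h l) \<and> poly_deg (h l) \<le> k) \<and>
      \<sigma> = (\<lambda>\<gamma>. \<Sum>l\<in>L. pmult (h l) (h l) \<gamma>))"

definition semialg :: "nat \<Rightarrow> (nat \<Rightarrow> 'n::finite mpoly) \<Rightarrow> (real^'n) set" where
  "semialg m g = {x. \<forall>j<m. peval (g j) x \<ge> 0}"

definition vj :: "'n::finite mpoly \<Rightarrow> nat" where
  "vj p = (poly_deg p + 1) div 2"

definition sym_on :: "'i set \<Rightarrow> ('i \<Rightarrow> 'i \<Rightarrow> real) \<Rightarrow> bool" where
  "sym_on I A \<longleftrightarrow> (\<forall>i\<in>I. \<forall>j\<in>I. A i j = A j i)"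

definition psd_on :: "'i set \<Rightarrow> ('i \<Rightarrow> 'i \<Rightarrow> real) \<Rightarrow> bool" where
  "psd_on I A \<longleftrightarrow> sym_on I A \<and> (\<forall>v. (\<Sum>i\<in>I. \<Sum>j\<in>I. v i * A i j * v j) \<ge> 0)"

definition pd_on :: "'i set \<Rightarrow> ('i \<Rightarrow> 'i \<Rightarrow> real) \<Rightarrow> bool" where
  "pd_on I A \<longleftrightarrow> sym_on I A \<and>
     (\<forall>v. (\<exists>i\<in>I. v i \<noteq> 0) \<longrightarrow> (\<Sum>i\<in>I. \<Sum>j\<in>I. v i * A i j * v j) > 0)"

definition trace_on :: "'i set \<Rightarrow> ('i \<Rightarrow> 'i \<Rightarrow> real) \<Rightarrow> real" where
  "trace_on I A = (\<Sum>i\<in>I. A i i)"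

definition det_on :: "'i set \<Rightarrow> ('i \<Rightarrow> 'i \<Rightarrow> real) \<Rightarrow> real" where
  "det_on I A = (\<Sum>p\<in>{p. p permutes I}. of_int (sign p) * (\<Prod>i\<in>I. A i (p i)))"

definition spectral_on :: "'i set \<Rightarrow> ('i \<Rightarrow> 'i \<Rightarrow> real) \<Rightarrow> ('i \<Rightarrow> 'i \<Rightarrow> real) \<Rightarrow> ('i \<Rightarrow> real) \<Rightarrow> bool" where
  "spectral_on I A U lam \<longleftrightarrow>
     (\<forall>k\<in>I. \<forall>l\<in>I. (\<Sum>i\<in>I. U k i * U l i) = (if k = l then 1 else 0)) \<and>
     (\<forall>i\<in>I. \<forall>j\<in>I. A i j = (\<Sum>k\<in>I. lam k * U k i * U k j))"

definition mfun_on :: "'i set \<Rightarrow> (real \<Rightarrow> real) \<Rightarrow> ('i \<Rightarrow> 'i \<Rightarrow> real) \<Rightarrow> ('i \<Rightarrow> 'i \<Rightarrow> real)" where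
  "mfun_on I f A = (THE B. \<exists>U lam. spectral_on I A U lam \<and>
       B = (\<lambda>i j. if i \<in> I \<and> j \<in> I then (\<Sum>k\<in>I. f (lam k) * U k i * U k j) else 0))"

definition mpow_on :: "'i set \<Rightarrow> ('i \<Rightarrow> 'i \<Rightarrow> real) \<Rightarrow> real \<Rightarrow> ('i \<Rightarrow> 'i \<Rightarrow> real)" where
  "mpow_on I A r = mfun_on I (\<lambda>t. t powr r) A"

definition kiefer :: "real \<Rightarrow> 'i set \<Rightarrow> ('i \<Rightarrow> 'i \<Rightarrow> real) \<Rightarrow> real" where
  "kiefer q I M =
     (if pd_on I M then
        (if q = 0 then det_on I M powr (1 / real (card I))
         else (trace_on I (mpow_on I M q) / real (card I)) powr (1 / q))
      else if 0 < q \<and> q \<le> 1 then (trace_on I (mpow_on I M q) / real (card I)) powr (1 / q)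
      else 0)"

definition mom_mat :: "nat \<Rightarrow> 'n::finite mpoly \<Rightarrow> 'n mexp \<Rightarrow> 'n mexp \<Rightarrow> real" where
  "mom_mat k y = (\<lambda>\<alpha> \<beta>. y (madd \<alpha> \<beta>))"

definition loc_mat :: "nat \<Rightarrow> 'n::finite mpoly \<Rightarrow> 'n mpoly \<Rightarrow> 'n mexp \<Rightarrow> 'n mexp \<Rightarrow> real" where
  "loc_mat k f y = (\<lambda>\<alpha> \<beta>. \<Sum>\<gamma>\<in>{\<gamma>. f \<gamma> \<noteq> 0}. f \<gamma> * y (madd \<gamma> (madd \<alpha> \<beta>)))"

definition trunc_seq :: "nat \<Rightarrow> 'n::finite mpoly \<Rightarrow> bool" where
  "trunc_seq k y \<longleftrightarrow> (\<forall>\<alpha>. mdeg \<alpha> > k \<longrightarrow> y \<alpha> = 0)"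

definition moments_on :: "nat \<Rightarrow> (real^'n::finite) set \<Rightarrow> 'n mpoly set" where
  "moments_on k X = {y. trunc_seq k y \<and>
     (\<exists>\<mu>::(real^'n) measure. sets \<mu> = sets borel \<and> emeasure \<mu> (UNIV - X) = 0 \<and>
        (\<forall>\<alpha>. mdeg \<alpha> \<le> k \<longrightarrow> integrable \<mu> (monom \<alpha>) \<and> y \<alpha> = integral\<^sup>L \<mu> (monom \<alpha>)))}"

definition moments_sdp :: "nat \<Rightarrow> nat \<Rightarrow> nat \<Rightarrow> (nat \<Rightarrow> 'n::finite mpoly) \<Rightarrow> 'n mpoly set" where
  "moments_sdp d \<delta> m g = {y. trunc_seq (2*d) y \<and>
     (\<exists>y\<delta>. trunc_seq (2*(d+\<delta>)) y\<delta> \<and> (\<forall>\<alpha>. mdeg \<alpha> \<le> 2*d \<longrightarrow> y\<delta> \<alpha> = y \<alpha>) \<and>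
        psd_on (Mon (d+\<delta>)) (mom_mat (d+\<delta>) y\<delta>) \<and>
        (\<forall>j<m. vj (g j) \<le> d+\<delta> \<longrightarrow>
           psd_on (Mon (d+\<delta>-vj (g j))) (loc_mat (d+\<delta>-vj (g j)) (g j) y\<delta>)))}"

definition sos_cone :: "nat \<Rightarrow> nat \<Rightarrow> nat \<Rightarrow> (nat \<Rightarrow> 'n::finite mpoly) \<Rightarrow> 'n mpoly set" where
  "sos_cone d \<delta> m g = {h. is_poly h \<and> poly_deg h \<le> 2*d \<and>
     (\<exists>\<sigma>0 \<sigma>. sos_deg (d+\<delta>) \<sigma>0 \<and>
        (\<forall>j<m. if vj (g j) \<le> d+\<delta> then sos_deg (d+\<delta>-vj (g j)) (\<sigma> j) else \<sigma> j = (\<lambda>_. 0)) \<and>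
        h = (\<lambda>\<gamma>. \<sigma>0 \<gamma> + (\<Sum>j<m. pmult (g j) (\<sigma> j) \<gamma>)))}"

definition quad_poly :: "nat \<Rightarrow> ('n::finite mexp \<Rightarrow> 'n mexp \<Rightarrow> real) \<Rightarrow> 'n mpoly" where
  "quad_poly d A = (\<lambda>\<gamma>. \<Sum>(\<alpha>,\<beta>)\<in>{(\<alpha>,\<beta>). \<alpha> \<in> Mon d \<and> \<beta> \<in> Mon d \<and> madd \<alpha> \<beta> = \<gamma>}. A \<alpha> \<beta>)"

definition pd_poly :: "real \<Rightarrow> nat \<Rightarrow> 'n::finite mpoly \<Rightarrow> 'n mpoly" where
  "pd_poly q d y = quad_poly d (mpow_on (Mon d) (mom_mat d y) (q - 1))"

definition obj :: "real \<Rightarrow> nat \<Rightarrow> 'n::finite mpoly \<Rightarrow> real" where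
  "obj q d y = kiefer q (Mon d) (mom_mat d y)"

end

theory Submission
  imports Defs
begin

text \<open>The feasible pseudo-moment sequences are bounded entrywise because of the ball constraint, so along
  a subsequence they converge to a sequence \<open>z\<close> all of whose moment and localizing matrices are positive
  semidefinite. Such a \<open>z\<close> is nonnegative on polynomials that are nonnegative on the set: minimise the
  polynomial and then one coordinate after another over the compact convex set of these sequences. At a
  minimiser of \<open>a\<close> with value \<open>c\<close>, perturbation by squares shows that \<open>a - c\<close> annihilates everything, so
  after all minimisations only evaluation at a point of the set is left. By convex separation and
  Caratheodory's theorem the truncation of \<open>z\<close> therefore comes from an atomic measure. Since Kiefer's
  criterion is continuous along sequences of positive definite matrices and the optimum is unique, the
  limit is the optimum. For finite convergence, membership in the SOS cone says that the relaxed
  optimum satisfies the first-order inequality at the ideal one, and strict concavity, in the form of a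
  scalar tangent inequality between the two spectra, forces equality.\<close>

section \<open>Linear algebra over finite index sets\<close>

text \<open>The relaxed sequences of different levels live in spaces of different size, and so do
  their moment matrices. Sequences are therefore functions on all exponents, compactness is that of
  a countable product, and spectral theory is set up over arbitrary finite index sets. The ball
  polynomial enters only through the bounds |y_\<alpha>| \<le> |R|^|\<alpha>|. At level \<delta>
  they reach the degree d + \<delta>, which suffices because each fixed entry is covered from some
  level on. A limit of positive definite moment matrices may be singular before it has been
  identified, so the continuity statement for Kiefer's criterion has to include its separately
  defined singular cases. The powers M^(q-1) are continuous only at positive definite limits and are
  treated after the limit is known to be the ideal optimum. Concavity of the criterion on matrices
  is never differentiated: the squared overlaps of two eigenbases form a doubly stochastic array,
  which reduces it to concavity of one scalar function.\<close>

lemma quadratic_nonneg_imp_linear_zero: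
  fixes b c :: real
  assumes "\<And>t. 0 \<le> 2 * t * b + t\<^sup>2 * c"
  shows "b = 0"
proof (rule ccontr)
  assume b: "b \<noteq> 0"
  \<comment> \<open>The summand 1 keeps \<open>C\<close> positive. The point t = - b / C minimises 2
    t b + t^2 C, with the negative value - b^2 / C.\<close>
  define C where "C = \<bar>c\<bar> + 1"
  have C: "C > 0" "c \<le> C" by (auto simp: C_def)
  have "0 \<le> 2 * (- b / C) * b + (- b / C)\<^sup>2 * c" by (rule assms)
  also have "\<dots> \<le> 2 * (- b / C) * b + (- b / C)\<^sup>2 * C"
    using C by (intro add_left_mono mult_left_mono) auto
  also have "\<dots> = - (b\<^sup>2 / C)" using C by (simp add: power2_eq_square field_simps)
  also have "\<dots> < 0" using b C by simp
  finally show False by simp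
qed

lemma compact_Pi_UNIV:
  fixes B :: "'a \<Rightarrow> ('b::topological_space) set"
  assumes "\<And>i. compact (B i)"
  shows "compact (PiE UNIV B)"
proof -
  have "compactin (product_topology (\<lambda>i. euclidean) UNIV) (PiE UNIV B)"
    using assms by (auto simp: compactin_PiE compactin_euclidean_iff)
  then show ?thesis
    by (simp add: euclidean_product_topology compactin_euclidean_iff)
qed

text \<open>Tychonoff gives a compact box; countability of the index type makes the product first
  countable, and this turns compactness into convergent subsequences.\<close>

lemma pointwise_bounded_convergent_subseq:
  fixes w :: "nat \<Rightarrow> 'a::countable \<Rightarrow> real"
  assumes "\<And>n a. \<bar>w n a\<bar> \<le> C a"
  obtains r z where "strict_mono (r::nat \<Rightarrow> nat)" "\<And>a. (\<lambda>n. w (r n) a) \<longlonglongrightarrow> z a"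
proof -
  let ?K = "PiE UNIV (\<lambda>a. {- C a .. C a})"
  have "compact ?K" by (rule compact_Pi_UNIV) simp
  then have "seq_compact ?K" by (rule compact_imp_seq_compact)
  moreover have "\<forall>n. w n \<in> ?K" using assms by (auto simp: PiE_iff abs_le_iff minus_le_iff)
  ultimately obtain z r where "strict_mono r" "(w \<circ> r) \<longlonglongrightarrow> z"
    unfolding seq_compact_def by meson
  moreover from this(2) have "(\<lambda>n. w (r n) a) \<longlonglongrightarrow> z a" for a
    using continuous_on_tendsto_compose[OF continuous_on_product_coordinates[of a], of "w \<circ> r" z]
    by (simp add: o_def)
  ultimately show thesis using that by blast
qed

text \<open>Needed because eigenvectors converge only along subsequences: continuity of functions of
  the spectrum follows once every subsequence has a further one with the right limit.\<close>

lemma tendsto_if_subseq_tendsto: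
  fixes X :: "nat \<Rightarrow> 'a::metric_space"
  assumes "\<And>r. strict_mono (r::nat \<Rightarrow> nat) \<Longrightarrow> \<exists>s. strict_mono (s::nat \<Rightarrow> nat) \<and> (\<lambda>n. X (r (s n))) \<longlonglongrightarrow> L"
  shows "X \<longlonglongrightarrow> L"
proof (rule ccontr)
  assume "\<not> X \<longlonglongrightarrow> L"
  then obtain e where e: "e > 0" "\<not> eventually (\<lambda>n. dist (X n) L < e) sequentially"
    unfolding tendsto_iff by auto
  let ?A = "{n. dist (X n) L \<ge> e}"
  have "\<exists>n\<ge>N. n \<in> ?A" for N
  proof (rule ccontr)
    assume "\<not> ?thesis"
    then have "\<forall>n\<ge>N. dist (X n) L < e" by (meson mem_Collect_eq not_le)
    with e(2) show False unfolding eventually_sequentially by blast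
  qed
  then have "infinite ?A" unfolding infinite_nat_iff_unbounded_le by blast
  then obtain r :: "nat \<Rightarrow> nat" where r: "strict_mono r" "\<forall>n. r n \<in> ?A"
    using infinite_enumerate[of ?A] by auto
  from assms[OF r(1)] obtain s where s: "(\<lambda>n. X (r (s n))) \<longlonglongrightarrow> L" by auto
  then have "eventually (\<lambda>n. dist (X (r (s n))) L < e) sequentially" using e(1) by (rule tendstoD)
  then obtain n where "dist (X (r (s n))) L < e" by (meson eventually_sequentially order_refl)
  moreover have "e \<le> dist (X (r (s n))) L" using r(2) by simp
  ultimately show False by simp
qed

lemma homogeneous_system_nontrivial_solution:
  fixes \<phi> :: "'t \<Rightarrow> 'i \<Rightarrow> real"
  assumes "finite I" "finite T" "card I < card T"
  obtains c where "\<exists>t\<in>T. c t \<noteq> 0" "\<And>i. i \<in> I \<Longrightarrow> (\<Sum>t\<in>T. c t * \<phi> t i) = 0"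
proof -
  have "\<exists>c. (\<exists>t\<in>T. c t \<noteq> 0) \<and> (\<forall>i\<in>I. (\<Sum>t\<in>T. c t * \<phi> t i) = 0)"
    using assms
  proof (induction I arbitrary: T \<phi> rule: finite_induct)
    case empty
    then have "T \<noteq> {}" by auto
    then show ?case by (intro exI[of _ "\<lambda>_. 1"]) auto
  next
    case (insert j I)
    show ?case
    proof (cases "\<forall>t\<in>T. \<phi> t j = 0")
      case True
      have "card I < card T" using insert by simp
      from insert.IH[OF insert.prems(1) this, of \<phi>] True show ?thesis by auto
    next
      case False
      then obtain s where s: "s \<in> T" "\<phi> s j \<noteq> 0" by auto
      define T' where "T' = T - {s}"
      have T': "finite T'" "s \<notin> T'" "T = insert s T'" using s insert.prems by (auto simp: T'_def)
      have "card I < card T'" using insert T' by simp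
      \<comment> \<open>Gaussian elimination: equation \<open>j\<close> is solved for the unknown
        \<open>s\<close> with pivot \<open>\<phi> s j\<close> and substituted into the remaining
        equations. The value \<open>k\<close> below is the back substitution.\<close>
      from insert.IH[OF T'(1) this, of "\<lambda>t i. \<phi> t i - \<phi> t j / \<phi> s j * \<phi> s i"] obtain c where
        c: "\<exists>t\<in>T'. c t \<noteq> 0" "\<And>i. i \<in> I \<Longrightarrow> (\<Sum>t\<in>T'. c t * (\<phi> t i - \<phi> t j / \<phi> s j * \<phi> s i)) = 0"
        by auto
      define k where "k = - (\<Sum>t\<in>T'. c t * \<phi> t j) / \<phi> s j"
      define c' where "c' = c(s := k)"
      have sum: "(\<Sum>t\<in>T. c' t * \<phi> t i) = k * \<phi> s i + (\<Sum>t\<in>T'. c t * \<phi> t i)" for i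
        using T' by (auto simp: c'_def intro!: sum.cong)
      have "(\<Sum>t\<in>T. c' t * \<phi> t i) = 0" if "i \<in> I" for i
      proof -
        have "(\<Sum>t\<in>T'. c t * (\<phi> t i - \<phi> t j / \<phi> s j * \<phi> s i)) =
          (\<Sum>t\<in>T'. c t * \<phi> t i - (c t * \<phi> t j) * (\<phi> s i / \<phi> s j))"
          by (intro sum.cong) (auto simp: field_simps)
        also have "\<dots> = (\<Sum>t\<in>T'. c t * \<phi> t i) + k * \<phi> s i"
          by (simp add: sum_subtractf sum_distrib_right sum_divide_distrib k_def)
        finally show ?thesis using c(2)[OF that] sum by simp
      qed
      moreover have "(\<Sum>t\<in>T. c' t * \<phi> t j) = 0" using s sum by (simp add: k_def)
      moreover have "\<exists>t\<in>T. c' t \<noteq> 0" using c(1) T' by (auto simp: c'_def)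
      ultimately show ?thesis by (intro exI[of _ c']) auto
    qed
  qed
  then show thesis using that by blast
qed

section \<open>Orthonormal families and the spectral theorem\<close>

definition orthonormal_on :: "'i set \<Rightarrow> 'k set \<Rightarrow> ('k \<Rightarrow> 'i \<Rightarrow> real) \<Rightarrow> bool" where
  "orthonormal_on I K U \<longleftrightarrow> (\<forall>k\<in>K. \<forall>l\<in>K. (\<Sum>i\<in>I. U k i * U l i) = (if k = l then 1 else 0))"

text \<open>The residual \<open>r\<close> of the unit vector \<open>j\<close> after projection onto
  the family is orthogonal to every \<open>U l\<close>. If it were nonzero, there would be card I +
  1 independent vectors in card I coordinates.\<close>

lemma orthonormal_on_complete:
  assumes fin: "finite I" and U: "orthonormal_on I I U" and i: "i \<in> I" and j: "j \<in> I"
  shows "(\<Sum>k\<in>I. U k i * U k j) = (if i = j then 1 else 0)"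
proof (rule ccontr)
  assume neq: "\<not> ?thesis"
  define r where "r i = (\<Sum>k\<in>I. U k i * U k j) - (if i = j then 1 else 0)" for i
  have orth: "(\<Sum>i\<in>I. U k i * U l i) = (if k = l then 1 else 0)" if "k \<in> I" "l \<in> I" for k l
    using U that by (auto simp: orthonormal_on_def)
  have r_orth: "(\<Sum>i\<in>I. r i * U l i) = 0" if l: "l \<in> I" for l
  proof -
    have "(\<Sum>i\<in>I. r i * U l i) = (\<Sum>i\<in>I. \<Sum>k\<in>I. U k j * (U k i * U l i)) - (\<Sum>i\<in>I. if i = j then U l i else 0)"
      unfolding r_def sum_subtractf[symmetric]
      by (intro sum.cong) (auto simp: algebra_simps sum_distrib_right sum_distrib_left)
    also have "(\<Sum>i\<in>I. \<Sum>k\<in>I. U k j * (U k i * U l i)) = (\<Sum>k\<in>I. U k j * (\<Sum>i\<in>I. U k i * U l i))"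
      by (subst sum.swap) (simp add: sum_distrib_left)
    also have "\<dots> = (\<Sum>k\<in>I. if k = l then U k j else 0)"
      using l orth by (intro sum.cong) auto
    finally show ?thesis using fin l j by (simp add: sum.delta)
  qed
  have rpos: "(\<Sum>i\<in>I. r i * r i) > 0"
    using neq i fin unfolding r_def by (intro sum_pos2[of _ i]) (auto simp: zero_less_mult_iff neq_iff)
  \<comment> \<open>\<open>None\<close> labels the residual, \<open>Some k\<close> the family, so
    the dimension count applies to all of them at once.\<close>
  define \<phi> where "\<phi> k i = (case k of Some k \<Rightarrow> U k i | None \<Rightarrow> r i)" for k i
  let ?T = "insert None (Some ` I)"
  have "card I < card ?T" using fin by (simp add: card_image)
  with fin obtain c where c: "\<exists>t\<in>?T. c t \<noteq> 0" "\<And>i. i \<in> I \<Longrightarrow> (\<Sum>t\<in>?T. c t * \<phi> t i) = 0"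
    using homogeneous_system_nontrivial_solution[of I ?T \<phi>] by blast
  have eq: "c None * r i + (\<Sum>k\<in>I. c (Some k) * U k i) = 0" if "i \<in> I" for i
    using c(2)[OF that] fin by (simp add: \<phi>_def sum.reindex)
  have pair: "c None * (\<Sum>i\<in>I. r i * v i) + (\<Sum>k\<in>I. c (Some k) * (\<Sum>i\<in>I. U k i * v i)) = 0" for v
  proof -
    have "c None * (\<Sum>i\<in>I. r i * v i) + (\<Sum>k\<in>I. c (Some k) * (\<Sum>i\<in>I. U k i * v i)) =
       (\<Sum>i\<in>I. c None * (r i * v i)) + (\<Sum>i\<in>I. \<Sum>k\<in>I. c (Some k) * (U k i * v i))"
      by (subst sum.swap) (simp add: sum_distrib_left)
    also have "\<dots> = (\<Sum>i\<in>I. (c None * r i + (\<Sum>k\<in>I. c (Some k) * U k i)) * v i)"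
      by (simp add: sum.distrib[symmetric] algebra_simps sum_distrib_left)
    also have "\<dots> = 0" using eq by simp
    finally show ?thesis .
  qed
  have "c None * (\<Sum>i\<in>I. r i * r i) = 0"
    using pair[of r] r_orth by (simp add: mult.commute)
  then have cN: "c None = 0" using rpos by simp
  have "c (Some l) = 0" if l: "l \<in> I" for l
  proof -
    have "(\<Sum>k\<in>I. c (Some k) * (\<Sum>i\<in>I. U k i * U l i)) = (\<Sum>k\<in>I. if k = l then c (Some k) else 0)"
      using l orth by (intro sum.cong) auto
    then show ?thesis using pair[of "U l"] cN l fin by (simp add: sum.delta)
  qed
  with c(1) cN show False by auto
qed

text \<open>Rayleigh's principle. The maximiser \<open>v\<close> of the quadratic form on the unit
  sphere of the complement of the \<open>U k\<close> is an eigenvector: \<open>r = l v - A v\<close>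
  stays in that complement, since A is symmetric and the \<open>U k\<close> are eigenvectors, and
  moving \<open>v\<close> along \<open>r\<close> would improve the quotient unless \<open>r\<close>
  vanishes.\<close>

lemma constrained_max_eigenvector:
  fixes A :: "'i \<Rightarrow> 'i \<Rightarrow> real"
  assumes fin: "finite I" and sym: "sym_on I A" and KI: "card K < card I" "finite K"
    and inv: "\<And>k i. k \<in> K \<Longrightarrow> i \<in> I \<Longrightarrow> (\<Sum>j\<in>I. A i j * U k j) = lam k * U k i"
  shows "\<exists>v l. (\<Sum>i\<in>I. v i * v i) = 1 \<and> (\<forall>k\<in>K. (\<Sum>i\<in>I. v i * U k i) = 0) \<and>
    (\<forall>i\<in>I. (\<Sum>j\<in>I. A i j * v j) = l * v i)"
proof -
  define ip where "ip u v = (\<Sum>i\<in>I. u i * v i)" for u v :: "'i \<Rightarrow> real"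
  define Av where "Av v i = (\<Sum>j\<in>I. A i j * v j)" for v i
  have ip_comm: "ip u v = ip v u" for u v unfolding ip_def by (simp add: mult.commute)
  have ip_lin: "ip (\<lambda>i. a * u i + b * v i) w = a * ip u w + b * ip v w" for a b u v w
    unfolding ip_def by (simp add: algebra_simps sum.distrib sum_distrib_left)
  have Av_lin: "Av (\<lambda>i. a * u i + b * v i) = (\<lambda>i. a * Av u i + b * Av v i)" for a b u v
    unfolding Av_def by (simp add: algebra_simps sum.distrib sum_distrib_left)
  have Av_sym: "ip (Av u) v = ip u (Av v)" for u v
  proof -
    have "ip (Av u) v = (\<Sum>i\<in>I. \<Sum>j\<in>I. A i j * u j * v i)"
      by (simp add: ip_def Av_def sum_distrib_right sum_distrib_left)
    also have "\<dots> = (\<Sum>j\<in>I. \<Sum>i\<in>I. A j i * u j * v i)"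
      using sym by (subst sum.swap) (auto intro!: sum.cong simp: sym_on_def)
    also have "\<dots> = ip u (Av v)"
      by (simp add: ip_def Av_def sum_distrib_right sum_distrib_left mult.assoc mult.left_commute)
    finally show ?thesis .
  qed
  have ip_pos: "ip v v > 0" if "i \<in> I" "v i \<noteq> 0" for v i
    using that fin unfolding ip_def by (intro sum_pos2[of _ i]) (auto simp: zero_less_mult_iff neq_iff)
  \<comment> \<open>Vectors are functions on the whole type; pinning them to 0 outside
    \<open>I\<close> is what makes the sphere compact.\<close>
  define S where "S = {v. (\<forall>i. i \<notin> I \<longrightarrow> v i = 0) \<and> ip v v = 1 \<and> (\<forall>k\<in>K. ip v (U k) = 0)}"
  obtain w where w: "\<exists>i\<in>I. w i \<noteq> 0" "\<And>k. k \<in> K \<Longrightarrow> ip w (U k) = 0"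
    using homogeneous_system_nontrivial_solution[of K I "\<lambda>i k. U k i"] fin KI
    unfolding ip_def by blast
  have norm_in_S: "(\<lambda>i. if i \<in> I then v i / sqrt (ip v v) else 0) \<in> S"
    if "ip v v > 0" "\<And>k. k \<in> K \<Longrightarrow> ip v (U k) = 0" for v
  proof -
    let ?u = "\<lambda>i. if i \<in> I then v i / sqrt (ip v v) else 0"
    have "ip ?u ?u = (\<Sum>i\<in>I. v i * v i / (sqrt (ip v v) * sqrt (ip v v)))"
      unfolding ip_def[of ?u] by (intro sum.cong) auto
    also have "\<dots> = ip v v / (sqrt (ip v v) * sqrt (ip v v))"
      by (simp add: ip_def sum_divide_distrib)
    also have "\<dots> = 1" using that by simp
    finally have "ip ?u ?u = 1" .
    moreover have "ip ?u (U k) = ip v (U k) / sqrt (ip v v)" for k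
      unfolding ip_def[of _ "U k"] by (simp add: sum_divide_distrib)
    ultimately show ?thesis using that by (auto simp: S_def)
  qed
  have "S \<noteq> {}" using norm_in_S[of w] w ip_pos by fastforce
  have ipcont: "continuous_on UNIV (\<lambda>v. ip v (f v))" if "\<And>i. i \<in> I \<Longrightarrow> continuous_on UNIV (\<lambda>v. f v i)" for f
    unfolding ip_def using that by (intro continuous_intros) auto
  have "compact S"
  proof -
    let ?P = "PiE UNIV (\<lambda>i. {-1..1::real})"
    let ?C = "(\<Inter>i\<in>-I. {v. v i = 0}) \<inter> {v. ip v v = 1} \<inter> (\<Inter>k\<in>K. {v. ip v (U k) = 0})"
    have "compact ?P" by (rule compact_Pi_UNIV) simp
    then have "compact (?P \<inter> ?C)"
    proof (rule compact_Int_closed)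
      show "closed ?C"
        by (intro closed_Int closed_INT ballI closed_Collect_eq ipcont continuous_intros) auto
    qed
    moreover have "S = ?P \<inter> ?C"
    proof -
      have "\<bar>v i\<bar> \<le> 1" if "v \<in> S" for v i
      proof (cases "i \<in> I")
        case True
        then have "v i * v i \<le> ip v v" unfolding ip_def using fin by (intro member_le_sum) auto
        then have "(v i)\<^sup>2 \<le> 1" using that by (simp add: S_def power2_eq_square)
        then show ?thesis by (simp add: abs_square_le_1)
      next
        case False
        then show ?thesis using that by (simp add: S_def)
      qed
      then show ?thesis by (auto simp: S_def PiE_iff abs_le_iff minus_le_iff)
    qed
    ultimately show ?thesis by simp
  qed
  moreover have "continuous_on S (\<lambda>v. ip v (Av v))"
    by (rule continuous_on_subset[OF ipcont]) (auto simp: Av_def intro!: continuous_intros)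
  ultimately obtain v where v: "v \<in> S" "\<And>u. u \<in> S \<Longrightarrow> ip u (Av u) \<le> ip v (Av v)"
    using continuous_attains_sup[of S] \<open>S \<noteq> {}\<close> by blast
  define l where "l = ip v (Av v)"
  have Q: "ip u (Av u) \<le> l * ip u u" if "\<And>k. k \<in> K \<Longrightarrow> ip u (U k) = 0" for u
  proof (cases "\<exists>i\<in>I. u i \<noteq> 0")
    case True
    then have pos: "ip u u > 0" using ip_pos by blast
    let ?u = "\<lambda>i. if i \<in> I then u i / sqrt (ip u u) else 0"
    have Avu: "Av ?u i = Av u i / sqrt (ip u u)" for i
      unfolding Av_def sum_divide_distrib by (intro sum.cong) auto
    have "ip ?u (Av ?u) = (\<Sum>i\<in>I. u i * Av u i / (sqrt (ip u u) * sqrt (ip u u)))"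
      unfolding ip_def[of ?u] Avu by (intro sum.cong) auto
    also have "\<dots> = ip u (Av u) / ip u u"
      using pos by (simp add: ip_def[of u "Av u"] sum_divide_distrib)
    finally have "ip u (Av u) / ip u u \<le> l"
      using v(2)[OF norm_in_S[of u]] pos that by (simp add: l_def)
    then show ?thesis using pos by (simp add: field_simps)
  next
    case False
    then show ?thesis by (simp add: ip_def)
  qed
  define r where "r i = l * v i + (-1) * Av v i" for i
  have v1: "ip v v = 1" "\<And>k. k \<in> K \<Longrightarrow> ip v (U k) = 0" using v by (auto simp: S_def)
  have AU: "ip u (Av (U k)) = lam k * ip u (U k)" if "k \<in> K" for u k
    using inv[OF that] by (auto simp: ip_def Av_def sum_distrib_left intro!: sum.cong)
  have rU: "ip r (U k) = 0" if "k \<in> K" for k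
    unfolding r_def ip_lin using v1 that by (simp add: Av_sym AU)
  \<comment> \<open>This is l <u,u> - <u,Au> at u = v + t r. The constant term vanishes by the
    choice of \<open>l\<close>, and the linear coefficient is <r,r>.\<close>
  have "0 \<le> 2 * t * ip r r + t\<^sup>2 * (l * ip r r - ip r (Av r))" for t
  proof -
    define u where "u i = 1 * v i + t * r i" for i
    have uU: "ip u (U k) = 0" if "k \<in> K" for k
      unfolding u_def ip_lin using v1 rU that by simp
    have uu: "ip u x = ip v x + t * ip r x" "ip x u = ip x v + t * ip x r" for x
      unfolding ip_comm[of x] unfolding u_def ip_lin by simp_all
    have Au: "Av u = (\<lambda>i. 1 * Av v i + t * Av r i)" unfolding u_def by (rule Av_lin)
    have Au': "ip x (Av u) = ip x (Av v) + t * ip x (Av r)" for x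
      unfolding ip_comm[of x] unfolding Au ip_lin by simp
    have rr: "ip r r = l * ip v r - ip (Av v) r"
      by (subst (1) r_def[abs_def]) (simp only: ip_lin)
    have "0 \<le> l * ip u u - ip u (Av u)" using Q[of u] uU by simp
    also have "\<dots> = (l * ip v v - ip v (Av v)) + 2 * t * (l * ip v r - ip (Av v) r)
       + t\<^sup>2 * (l * ip r r - ip r (Av r))"
      using Av_sym[of v r] ip_comm[of r v] ip_comm[of r "Av v"]
      by (simp add: uu Au' algebra_simps power2_eq_square)
    finally show ?thesis using v1 rr by (simp add: l_def)
  qed
  then have "ip r r = 0" by (rule quadratic_nonneg_imp_linear_zero)
  then have r0: "r i = 0" if "i \<in> I" for i using ip_pos[of i r] that by force
  have "Av v i = l * v i" if "i \<in> I" for i using r0[OF that] by (simp add: r_def)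
  with v1 show ?thesis
    unfolding ip_def Av_def by (intro exI[of _ v] exI[of _ l] conjI ballI)
qed

lemma spectral_on_iff_orthonormal:
  "spectral_on I A U lam \<longleftrightarrow> orthonormal_on I I U \<and>
     (\<forall>i\<in>I. \<forall>j\<in>I. A i j = (\<Sum>k\<in>I. lam k * U k i * U k j))"
  by (simp add: spectral_on_def orthonormal_on_def)

lemma spectral_on_eigen:
  assumes fin: "finite I" and sp: "spectral_on I A U lam" and "k \<in> I" "i \<in> I"
  shows "(\<Sum>j\<in>I. A i j * U k j) = lam k * U k i"
proof -
  have "(\<Sum>j\<in>I. A i j * U k j) = (\<Sum>j\<in>I. \<Sum>l\<in>I. lam l * U l i * (U l j * U k j))"
    using sp assms(4) by (auto simp: spectral_on_def sum_distrib_right mult.assoc intro!: sum.cong)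
  also have "\<dots> = (\<Sum>l\<in>I. lam l * U l i * (\<Sum>j\<in>I. U l j * U k j))"
    by (subst sum.swap) (simp add: sum_distrib_left)
  also have "\<dots> = (\<Sum>l\<in>I. if l = k then lam l * U l i else 0)"
    using sp assms(3) by (intro sum.cong) (auto simp: spectral_on_def)
  finally show ?thesis using fin assms(3) by (simp add: sum.delta)
qed

text \<open>\<open>spectral_on\<close> labels eigenvectors by the matrix indices, so the induction
  runs over subsets \<open>K\<close> of \<open>I\<close> and finds one eigenvector per label.
  Completeness of the full family then recovers the entries of A.\<close>

theorem spectral_on_exists:
  fixes A :: "'i \<Rightarrow> 'i \<Rightarrow> real"
  assumes fin: "finite I" and sym: "sym_on I A"
  obtains U lam where "spectral_on I A U lam"
proof -
  have "\<exists>U lam. orthonormal_on I K U \<and> (\<forall>k\<in>K. \<forall>i\<in>I. (\<Sum>j\<in>I. A i j * U k j) = lam k * U k i)"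
    if "finite K" "K \<subseteq> I" for K
    using that
  proof (induction K rule: finite_induct)
    case empty
    then show ?case by (simp add: orthonormal_on_def)
  next
    case (insert k K)
    then obtain U lam where U: "orthonormal_on I K U"
      and eig: "\<forall>k\<in>K. \<forall>i\<in>I. (\<Sum>j\<in>I. A i j * U k j) = lam k * U k i" by auto
    have "card K < card I"
      using insert fin by (intro psubset_card_mono) auto
    with constrained_max_eigenvector[OF fin sym _ insert.hyps(1), of U lam] eig
    obtain v l where v: "(\<Sum>i\<in>I. v i * v i) = 1" "\<forall>k\<in>K. (\<Sum>i\<in>I. v i * U k i) = 0"
      and eig_v: "\<forall>i\<in>I. (\<Sum>j\<in>I. A i j * v j) = l * v i"
      by blast
    have "orthonormal_on I (insert k K) (U(k := v))"
      using U v insert.hyps by (auto simp: orthonormal_on_def mult.commute)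
    moreover have "\<forall>k'\<in>insert k K. \<forall>i\<in>I. (\<Sum>j\<in>I. A i j * (U(k := v)) k' j) = (lam(k := l)) k' * (U(k := v)) k' i"
    proof
      fix k' assume "k' \<in> insert k K"
      then consider "k' = k" | "k' \<in> K" "k' \<noteq> k" by blast
      then show "\<forall>i\<in>I. (\<Sum>j\<in>I. A i j * (U(k := v)) k' j) = (lam(k := l)) k' * (U(k := v)) k' i"
        by cases (simp_all add: eig eig_v)
    qed
    ultimately show ?case by blast
  qed
  from this[OF fin] obtain U lam where U: "orthonormal_on I I U"
      "\<And>k i. k \<in> I \<Longrightarrow> i \<in> I \<Longrightarrow> (\<Sum>j\<in>I. A i j * U k j) = lam k * U k i" by auto
  have "A i j = (\<Sum>k\<in>I. lam k * U k i * U k j)" if ij: "i \<in> I" "j \<in> I" for i j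
  proof -
    have "(\<Sum>k\<in>I. lam k * U k i * U k j) = (\<Sum>k\<in>I. \<Sum>l\<in>I. A i l * (U k l * U k j))"
      using U(2) ij by (intro sum.cong refl) (simp add: sum_distrib_right[symmetric] mult.assoc[symmetric])
    also have "\<dots> = (\<Sum>l\<in>I. A i l * (\<Sum>k\<in>I. U k l * U k j))"
      by (subst sum.swap) (simp add: sum_distrib_left)
    also have "\<dots> = (\<Sum>l\<in>I. if l = j then A i l else 0)"
      using orthonormal_on_complete[OF fin U(1)] ij by (intro sum.cong) auto
    finally show ?thesis using fin ij by (simp add: sum.delta)
  qed
  then show thesis using that U(1) by (auto simp: spectral_on_iff_orthonormal)
qed

text \<open>Both sides are <A U_k, W_l>. Eigenvectors of two decompositions thus overlap only for
  equal eigenvalues, which replaces any discussion of eigenspaces.\<close>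

lemma spectral_on_overlap:
  assumes fin: "finite I" and a: "spectral_on I A U a" and b: "spectral_on I A W b"
    and k: "k \<in> I" and l: "l \<in> I"
  shows "a k * (\<Sum>i\<in>I. U k i * W l i) = b l * (\<Sum>i\<in>I. U k i * W l i)"
proof -
  have sym: "A i j = A j i" if "i \<in> I" "j \<in> I" for i j
    using a that by (auto simp: spectral_on_def mult.commute mult.left_commute intro!: sum.cong)
  have "a k * (\<Sum>i\<in>I. U k i * W l i) = (\<Sum>i\<in>I. (\<Sum>j\<in>I. A i j * U k j) * W l i)"
    using spectral_on_eigen[OF fin a k] by (simp add: sum_distrib_left mult.assoc)
  also have "\<dots> = (\<Sum>j\<in>I. \<Sum>i\<in>I. U k j * (A j i * W l i))"
    unfolding sum_distrib_right by (subst sum.swap) (auto intro!: sum.cong simp: sym)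
  also have "\<dots> = (\<Sum>j\<in>I. U k j * (b l * W l j))"
    using spectral_on_eigen[OF fin b l] by (simp add: sum_distrib_left[symmetric])
  finally show ?thesis by (simp add: sum_distrib_left mult.left_commute)
qed

lemma orthonormal_on_expand:
  assumes fin: "finite I" and U: "orthonormal_on I I U" and i: "i \<in> I"
  shows "(\<Sum>k\<in>I. (\<Sum>j\<in>I. v j * U k j) * U k i) = v i"
proof -
  have "(\<Sum>k\<in>I. (\<Sum>j\<in>I. v j * U k j) * U k i) = (\<Sum>j\<in>I. v j * (\<Sum>k\<in>I. U k j * U k i))"
    unfolding sum_distrib_right sum_distrib_left by (subst sum.swap) (simp add: mult.assoc)
  also have "\<dots> = (\<Sum>j\<in>I. if j = i then v j else 0)"
    using orthonormal_on_complete[OF fin U] i by (intro sum.cong) auto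
  finally show ?thesis using fin i by (simp add: sum.delta)
qed

lemma spectral_on_orthonormal: "spectral_on I A U a \<Longrightarrow> orthonormal_on I I U"
  by (simp add: spectral_on_iff_orthonormal)

text \<open>The hypothesis compares the entries <U_k, X W_l> and <U_k, Y W_l> of the two operators,
  and an operator is determined by its entries in a pair of bases. It serves both for
  well-definedness of functions of a matrix and for the equality case of concavity.\<close>

lemma orthonormal_combination_eq:
  assumes fin: "finite I" and U: "orthonormal_on I I U" and W: "orthonormal_on I I W"
    and eq: "\<And>k l. k \<in> I \<Longrightarrow> l \<in> I \<Longrightarrow> x k * (\<Sum>i\<in>I. U k i * W l i) = y l * (\<Sum>i\<in>I. U k i * W l i)"
    and ij: "i \<in> I" "j \<in> I"
  shows "(\<Sum>k\<in>I. x k * U k i * U k j) = (\<Sum>l\<in>I. y l * W l i * W l j)"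
proof -
  define c where "c k l = (\<Sum>i\<in>I. U k i * W l i)" for k l
  have "(\<Sum>k\<in>I. x k * U k i * U k j) = (\<Sum>k\<in>I. x k * U k i * (\<Sum>l\<in>I. c k l * W l j))"
    using orthonormal_on_expand[OF fin W ij(2)]
    by (auto simp: c_def intro!: sum.cong)
  also have "\<dots> = (\<Sum>k\<in>I. \<Sum>l\<in>I. (x k * c k l) * U k i * W l j)"
    by (simp add: sum_distrib_left mult_ac)
  also have "\<dots> = (\<Sum>k\<in>I. \<Sum>l\<in>I. y l * W l j * (c k l * U k i))"
    using eq by (intro sum.cong refl) (simp add: c_def mult_ac)
  also have "\<dots> = (\<Sum>l\<in>I. y l * W l j * (\<Sum>k\<in>I. c k l * U k i))"
    by (subst sum.swap) (simp add: sum_distrib_left)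
  also have "\<dots> = (\<Sum>l\<in>I. y l * W l i * W l j)"
    using orthonormal_on_expand[OF fin U ij(1), of "W l" for l]
    by (auto simp: c_def mult_ac intro!: sum.cong)
  finally show ?thesis .
qed

text \<open>The definite description in \<open>mfun_on\<close> is meaningful because the result is
  independent of the decomposition: two eigenvectors with nonzero overlap have the same eigenvalue,
  hence the same value of \<open>f\<close>.\<close>

lemma mfun_on_eq:
  assumes fin: "finite I" and a: "spectral_on I A U a"
  shows "mfun_on I f A = (\<lambda>i j. if i \<in> I \<and> j \<in> I then \<Sum>k\<in>I. f (a k) * U k i * U k j else 0)"
  unfolding mfun_on_def
proof (rule the_equality, goal_cases)
  case 1
  then show ?case using a by blast
next
  case (2 B)
  then obtain W b where W: "spectral_on I A W b"
    and B: "B = (\<lambda>i j. if i \<in> I \<and> j \<in> I then \<Sum>k\<in>I. f (b k) * W k i * W k j else 0)" by blast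
  define c where "c k l = (\<Sum>i\<in>I. U k i * W l i)" for k l
  have fc: "f (a k) * c k l = f (b l) * c k l" if "k \<in> I" "l \<in> I" for k l
    using spectral_on_overlap[OF fin a W that] unfolding c_def by (cases "c k l = 0") (auto simp: c_def)
  have "(\<Sum>k\<in>I. f (a k) * U k i * U k j) = (\<Sum>l\<in>I. f (b l) * W l i * W l j)" if ij: "i \<in> I" "j \<in> I" for i j
    using fc unfolding c_def
    by (intro orthonormal_combination_eq[OF fin spectral_on_orthonormal[OF a] spectral_on_orthonormal[OF W] _ ij])
  then show ?case unfolding B by (intro ext) auto
qed

lemma trace_mfun_on:
  assumes fin: "finite I" and a: "spectral_on I A U a"
  shows "trace_on I (mfun_on I f A) = (\<Sum>k\<in>I. f (a k))"
proof -
  have "trace_on I (mfun_on I f A) = (\<Sum>i\<in>I. \<Sum>k\<in>I. f (a k) * (U k i * U k i))"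
    unfolding trace_on_def mfun_on_eq[OF assms] by (simp add: mult.assoc)
  also have "\<dots> = (\<Sum>k\<in>I. f (a k) * (\<Sum>i\<in>I. U k i * U k i))"
    by (subst sum.swap) (simp add: sum_distrib_left)
  also have "\<dots> = (\<Sum>k\<in>I. f (a k))"
    using a by (intro sum.cong) (auto simp: spectral_on_def)
  finally show ?thesis .
qed

lemma quadratic_form_eigenvector:
  assumes fin: "finite I" and a: "spectral_on I A U a" and k: "k \<in> I"
  shows "(\<Sum>i\<in>I. \<Sum>j\<in>I. U k i * A i j * U k j) = a k"
proof -
  have "(\<Sum>i\<in>I. \<Sum>j\<in>I. U k i * A i j * U k j) = (\<Sum>i\<in>I. U k i * (\<Sum>j\<in>I. A i j * U k j))"
    by (simp add: sum_distrib_left mult.assoc)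
  also have "\<dots> = a k * (\<Sum>i\<in>I. U k i * U k i)"
    using spectral_on_eigen[OF fin a k] by (simp add: sum_distrib_left mult_ac)
  finally show ?thesis using a k by (simp add: spectral_on_def)
qed

lemma pd_on_iff_eigenvalues_pos:
  assumes fin: "finite I" and a: "spectral_on I A U a"
  shows "pd_on I A \<longleftrightarrow> (\<forall>k\<in>I. 0 < a k)"
proof
  assume pd: "pd_on I A"
  show "\<forall>k\<in>I. 0 < a k"
  proof
    fix k assume k: "k \<in> I"
    have "(\<Sum>i\<in>I. U k i * U k i) = 1" using a k by (simp add: spectral_on_def)
    then have "\<exists>i\<in>I. U k i \<noteq> 0" by (intro ccontr[of "\<exists>i\<in>I. U k i \<noteq> 0"]) simp
    then have "0 < (\<Sum>i\<in>I. \<Sum>j\<in>I. U k i * A i j * U k j)" using pd by (auto simp: pd_on_def)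
    then show "0 < a k" by (simp only: quadratic_form_eigenvector[OF fin a k])
  qed
next
  assume pos: "\<forall>k\<in>I. 0 < a k"
  have A: "A i j = (\<Sum>k\<in>I. a k * U k i * U k j)" if "i \<in> I" "j \<in> I" for i j
    using a that by (simp add: spectral_on_def)
  have "sym_on I A" unfolding sym_on_def by (auto simp: A mult_ac)
  moreover have "(\<Sum>i\<in>I. \<Sum>j\<in>I. v i * A i j * v j) > 0" if v: "\<exists>i\<in>I. v i \<noteq> 0" for v
  proof -
    have "(\<Sum>i\<in>I. \<Sum>j\<in>I. v i * A i j * v j) = (\<Sum>i\<in>I. \<Sum>j\<in>I. \<Sum>k\<in>I. a k * ((v i * U k i) * (v j * U k j)))"
      by (intro sum.cong refl) (simp add: A sum_distrib_left sum_distrib_right mult_ac)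
    also have "\<dots> = (\<Sum>i\<in>I. \<Sum>k\<in>I. \<Sum>j\<in>I. a k * ((v i * U k i) * (v j * U k j)))"
      by (intro sum.cong refl sum.swap)
    also have "\<dots> = (\<Sum>k\<in>I. \<Sum>i\<in>I. \<Sum>j\<in>I. a k * ((v i * U k i) * (v j * U k j)))"
      by (rule sum.swap)
    also have "\<dots> = (\<Sum>k\<in>I. a k * (\<Sum>i\<in>I. v i * U k i)\<^sup>2)"
      unfolding power2_eq_square sum_product by (simp only: sum_distrib_left)
    also have "\<dots> > 0"
    proof -
      obtain i where i: "i \<in> I" "v i \<noteq> 0" using v by blast
      have "(\<Sum>k\<in>I. (\<Sum>j\<in>I. v j * U k j) * U k i) \<noteq> 0"
        using orthonormal_on_expand[OF fin spectral_on_orthonormal[OF a] i(1)] i by simp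
      then obtain k where "k \<in> I" "(\<Sum>j\<in>I. v j * U k j) * U k i \<noteq> 0"
        by (rule sum.not_neutral_contains_not_neutral)
      then have k: "k \<in> I" "(\<Sum>j\<in>I. v j * U k j) \<noteq> 0" by auto
      then show ?thesis using pos fin by (intro sum_pos2[of _ k]) (auto simp: less_imp_le)
    qed
    finally show ?thesis .
  qed
  ultimately show "pd_on I A" by (auto simp: pd_on_def)
qed

section \<open>Determinants from the Leibniz formula\<close>

text \<open>Expanding the product of sums gives one term for every map f from \<open>I\<close> to
  \<open>I\<close>. For a map that is not injective, a transposition of two indices with the same
  image cancels the term; the other maps are permutations and contribute their sign.\<close>

lemma det_on_mult:
  fixes P Q :: "'i \<Rightarrow> 'i \<Rightarrow> real"
  assumes fin: "finite I"
  shows "det_on I (\<lambda>i j. \<Sum>k\<in>I. P i k * Q k j) = det_on I P * det_on I Q"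
proof -
  \<comment> \<open>The determinant of \<open>Q\<close> with row \<open>i\<close> replaced by row
    \<open>f i\<close>.\<close>
  define D where "D f = (\<Sum>p | p permutes I. of_int (sign p) * (\<Prod>i\<in>I. Q (f i) (p i)))" for f :: "'i \<Rightarrow> 'i"
  have finP: "finite {p. p permutes I}" using fin by (rule finite_permutations)
  have D0: "D f = 0" if f: "f \<in> I \<rightarrow>\<^sub>E I" "\<not> inj_on f I" for f
  proof -
    obtain a b where ab: "a \<in> I" "b \<in> I" "a \<noteq> b" "f a = f b" using f by (auto simp: inj_on_def)
    let ?t = "Transposition.transpose a b"
    have t: "?t permutes I" using ab by (simp add: permutes_swap_id)
    have "D f = (\<Sum>p | p permutes I. of_int (sign (p \<circ> ?t)) * (\<Prod>i\<in>I. Q (f i) ((p \<circ> ?t) i)))"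
      unfolding D_def
      by (rule sum.reindex_bij_witness[where i="\<lambda>p. p \<circ> ?t" and j="\<lambda>p. p \<circ> ?t"])
         (auto simp: o_assoc[symmetric] permutes_compose[OF t])
    also have "\<dots> = (\<Sum>p | p permutes I. - (of_int (sign p) * (\<Prod>i\<in>I. Q (f i) (p i))))"
    proof (intro sum.cong refl)
      fix p assume "p \<in> {p. p permutes I}"
      then have p: "p permutes I" by simp
      have perm: "permutation p" "permutation ?t"
        using p t fin unfolding permutation_permutes by blast+
      have "sign (p \<circ> ?t) = - sign p"
        using perm ab by (simp add: sign_compose sign_swap_id)
      moreover have "(\<Prod>i\<in>I. Q (f i) ((p \<circ> ?t) i)) = (\<Prod>i\<in>I. Q (f (?t i)) (p (?t i)))"
        using ab by (intro prod.cong refl) (auto simp: Transposition.transpose_def)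
      moreover have "\<dots> = (\<Prod>i\<in>I. Q (f i) (p i))"
        using prod.permute[OF t, of "\<lambda>i. Q (f i) (p i)"] by (simp add: o_def)
      ultimately show "of_int (sign (p \<circ> ?t)) * (\<Prod>i\<in>I. Q (f i) ((p \<circ> ?t) i)) =
          - (of_int (sign p) * (\<Prod>i\<in>I. Q (f i) (p i)))" by simp
    qed
    also have "\<dots> = - D f" by (simp add: D_def sum_negf)
    finally show ?thesis by simp
  qed
  have D1: "D r = of_int (sign r) * det_on I Q" if r: "r permutes I" for r
  proof -
    have "D r = (\<Sum>p | p permutes I. of_int (sign (p \<circ> r)) * (\<Prod>i\<in>I. Q (r i) ((p \<circ> r) i)))"
      unfolding D_def
      by (rule sum.reindex_bij_witness[where j="\<lambda>p. p \<circ> inv r" and i="\<lambda>p. p \<circ> r"])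
         (use r permutes_inv[OF r] in \<open>auto simp: o_assoc[symmetric] permutes_compose permutes_inv_o\<close>)
    also have "\<dots> = (\<Sum>p | p permutes I. of_int (sign r) * (of_int (sign p) * (\<Prod>i\<in>I. Q i (p i))))"
    proof (intro sum.cong refl)
      fix p assume "p \<in> {p. p permutes I}"
      then have p: "p permutes I" by simp
      have "sign (p \<circ> r) = sign p * sign r"
        using p r fin by (meson permutation_permutes sign_compose)
      moreover have "(\<Prod>i\<in>I. Q (r i) ((p \<circ> r) i)) = (\<Prod>i\<in>I. Q i (p i))"
        using prod.permute[OF r, of "\<lambda>i. Q i (p i)"] by (simp add: o_def)
      ultimately show "of_int (sign (p \<circ> r)) * (\<Prod>i\<in>I. Q (r i) ((p \<circ> r) i)) =
          of_int (sign r) * (of_int (sign p) * (\<Prod>i\<in>I. Q i (p i)))" by simp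
    qed
    finally show ?thesis by (simp add: det_on_def sum_distrib_left)
  qed
  have "det_on I (\<lambda>i j. \<Sum>k\<in>I. P i k * Q k j) =
     (\<Sum>p | p permutes I. \<Sum>f\<in>I \<rightarrow>\<^sub>E I. of_int (sign p) * ((\<Prod>i\<in>I. P i (f i)) * (\<Prod>i\<in>I. Q (f i) (p i))))"
    unfolding det_on_def by (simp add: prod_sum_PiE fin sum_distrib_left prod.distrib)
  also have "\<dots> = (\<Sum>f\<in>I \<rightarrow>\<^sub>E I. (\<Prod>i\<in>I. P i (f i)) * D f)"
    unfolding D_def sum_distrib_left by (subst sum.swap) (simp add: mult_ac)
  also have "\<dots> = (\<Sum>f\<in>{f \<in> I \<rightarrow>\<^sub>E I. inj_on f I}. (\<Prod>i\<in>I. P i (f i)) * D f)"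
    using D0 by (intro sum.mono_neutral_right) (auto simp: fin finite_PiE)
  \<comment> \<open>Members of \<open>PiE\<close> are \<open>undefined\<close> outside
    \<open>I\<close>, permutations are the identity there; the bijection only changes this
    padding.\<close>
  also have "\<dots> = (\<Sum>r | r permutes I. (\<Prod>i\<in>I. P i (r i)) * D r)"
  proof (rule sum.reindex_bij_witness[where j="\<lambda>f i. if i \<in> I then f i else i" and i="\<lambda>r. restrict r I"], goal_cases)
    case (1 f) then show ?case by (auto simp: fun_eq_iff PiE_iff extensional_def)
  next
    case (2 f)
    then have "inj_on f I" "f ` I \<subseteq> I" by auto
    then have "bij_betw f I I" using fin by (metis endo_inj_surj bij_betw_def)
    then have "bij_betw (\<lambda>i. if i \<in> I then f i else i) I I" by (subst bij_betw_cong[of _ _ f]) auto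
    then show ?case by (auto intro: bij_imp_permutes)
  next
    case (3 r) then show ?case by (auto simp: fun_eq_iff permutes_not_in)
  next
    case (4 r) then show ?case using permutes_in_image[of r I] permutes_inj_on[of r I I] by (auto simp: inj_on_def)
  next
    case (5 f) then show ?case by (simp add: D_def)
  qed
  also have "\<dots> = (\<Sum>r | r permutes I. of_int (sign r) * (\<Prod>i\<in>I. P i (r i)) * det_on I Q)"
    by (intro sum.cong refl) (simp add: D1)
  finally show ?thesis by (simp add: det_on_def sum_distrib_right)
qed

lemma det_on_cong:
  assumes "\<And>i j. i \<in> I \<Longrightarrow> j \<in> I \<Longrightarrow> A i j = B i j"
  shows "det_on I A = det_on I B"
  unfolding det_on_def using assms by (intro sum.cong refl) (auto intro!: prod.cong simp: permutes_in_image)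

lemma det_on_identity:
  assumes fin: "finite I"
  shows "det_on I (\<lambda>i j. if i = j then 1 else 0) = 1"
proof -
  have "det_on I (\<lambda>i j. if i = j then 1 else 0) = (\<Sum>p | p permutes I. if p = id then 1 else 0)"
    unfolding det_on_def
  proof (intro sum.cong refl)
    fix p assume "p \<in> {p. p permutes I}"
    then have p: "p permutes I" by simp
    show "of_int (sign p) * (\<Prod>i\<in>I. if i = p i then 1 else 0) = (if p = id then 1 else (0::real))"
    proof (cases "p = id")
      case False
      then obtain i where "p i \<noteq> i" by (auto simp: fun_eq_iff)
      then have "i \<in> I" "i \<noteq> p i" using p by (auto dest: permutes_not_in)
      then have "(\<Prod>i\<in>I. if i = p i then 1 else (0::real)) = 0" using fin by (intro prod_zero) auto
      then show ?thesis using False by simp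
    qed simp
  qed
  also have "\<dots> = 1" using fin by (simp add: sum.delta finite_permutations permutes_id)
  finally show ?thesis .
qed

lemma det_on_eq_prod_eigenvalues:
  assumes fin: "finite I" and a: "spectral_on I A U a"
  shows "det_on I A = (\<Prod>k\<in>I. a k)"
proof -
  have "det_on I A = det_on I (\<lambda>i j. \<Sum>k\<in>I. (U k i * a k) * U k j)"
    using a by (intro det_on_cong) (auto simp: spectral_on_def mult_ac)
  also have "\<dots> = det_on I (\<lambda>i k. U k i * a k) * det_on I U" by (rule det_on_mult[OF fin])
  also have "det_on I (\<lambda>i k. U k i * a k) = (\<Prod>k\<in>I. a k) * det_on I (\<lambda>i k. U k i)"
    unfolding det_on_def sum_distrib_left
  proof (intro sum.cong refl)
    fix p assume "p \<in> {p. p permutes I}"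
    then have "(\<Prod>i\<in>I. a (p i)) = (\<Prod>i\<in>I. a i)" using prod.permute[of p I a] by (simp add: o_def)
    then show "of_int (sign p) * (\<Prod>i\<in>I. U (p i) i * a (p i)) =
         (\<Prod>k\<in>I. a k) * (of_int (sign p) * (\<Prod>i\<in>I. U (p i) i))"
      by (simp add: prod.distrib)
  qed
  \<comment> \<open>The determinants of U and its transpose are merged again into that of the
    identity matrix, so neither has to be computed.\<close>
  also have "\<dots> * det_on I U = (\<Prod>k\<in>I. a k) * det_on I (\<lambda>i j. \<Sum>k\<in>I. U k i * U k j)"
    by (simp add: det_on_mult[OF fin])
  also have "det_on I (\<lambda>i j. \<Sum>k\<in>I. U k i * U k j) = det_on I (\<lambda>i j. if i = j then 1 else 0)"
    using orthonormal_on_complete[OF fin spectral_on_orthonormal[OF a]] by (intro det_on_cong) auto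
  finally show ?thesis by (simp add: det_on_identity fin)
qed

section \<open>Kiefer's criterion\<close>

text \<open>Eigenvectors may jump where eigenvalues collide, but orthonormal frames form a compact
  set. A limit frame of a subsequence diagonalises the limit matrix.\<close>

lemma spectral_on_convergent_subseq:
  fixes M :: "nat \<Rightarrow> 'i::countable \<Rightarrow> 'i \<Rightarrow> real"
  assumes fin: "finite I" and sp: "\<And>n. spectral_on I (M n) (U n) (a n)"
    and lim: "\<And>i j. i \<in> I \<Longrightarrow> j \<in> I \<Longrightarrow> (\<lambda>n. M n i j) \<longlonglongrightarrow> L i j"
  shows "\<exists>s V b. strict_mono (s :: nat \<Rightarrow> nat) \<and> spectral_on I L V b \<and>
    (\<forall>k\<in>I. \<forall>i\<in>I. (\<lambda>n. U (s n) k i) \<longlonglongrightarrow> V k i) \<and> (\<forall>k\<in>I. (\<lambda>n. a (s n) k) \<longlonglongrightarrow> b k)"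
proof -
  \<comment> \<open>\<open>spectral_on\<close> says nothing about \<open>U\<close> outside
    \<open>I\<close>; padding with 0 makes the family bounded everywhere.\<close>
  define w where "w n p = (if fst p \<in> I \<and> snd p \<in> I then U n (fst p) (snd p) else 0)" for n p
  have bnd: "\<bar>U n k i\<bar> \<le> 1" if "k \<in> I" "i \<in> I" for n k i
  proof -
    have "U n k i * U n k i \<le> (\<Sum>j\<in>I. U n k j * U n k j)" using that fin by (intro member_le_sum) auto
    also have "\<dots> = 1" using sp[of n] that by (simp add: spectral_on_def)
    finally show ?thesis by (simp add: power2_eq_square[symmetric] abs_square_le_1)
  qed
  have "\<bar>w n p\<bar> \<le> 1" for n p using bnd by (auto simp: w_def)
  then obtain s z where s: "strict_mono s" "\<And>p. (\<lambda>n. w (s n) p) \<longlonglongrightarrow> z p"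
    using pointwise_bounded_convergent_subseq[of w "\<lambda>_. 1"] by blast
  define V where "V k i = z (k, i)" for k i
  have V: "(\<lambda>n. U (s n) k i) \<longlonglongrightarrow> V k i" if "k \<in> I" "i \<in> I" for k i
    using s(2)[of "(k, i)"] that by (simp add: w_def V_def)
  have lims: "(\<lambda>n. M (s n) i j) \<longlonglongrightarrow> L i j" if "i \<in> I" "j \<in> I" for i j
    using LIMSEQ_subseq_LIMSEQ[OF lim[OF that] s(1)] by (simp add: o_def)
  \<comment> \<open>Eigenvalues are recovered as quadratic forms in their eigenvectors, so their
    convergence follows from that of the frames and matrices.\<close>
  define b where "b k = (\<Sum>i\<in>I. \<Sum>j\<in>I. V k i * L i j * V k j)" for k
  have b: "(\<lambda>n. a (s n) k) \<longlonglongrightarrow> b k" if k: "k \<in> I" for k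
  proof -
    have "(\<lambda>n. \<Sum>i\<in>I. \<Sum>j\<in>I. U (s n) k i * M (s n) i j * U (s n) k j) \<longlonglongrightarrow> b k"
      unfolding b_def using k by (intro tendsto_sum tendsto_mult V lims)
    then show ?thesis using quadratic_form_eigenvector[OF fin sp k] by simp
  qed
  have "(\<Sum>i\<in>I. V k i * V l i) = (if k = l then 1 else 0)" if "k \<in> I" "l \<in> I" for k l
  proof (rule LIMSEQ_unique)
    show "(\<lambda>n. \<Sum>i\<in>I. U (s n) k i * U (s n) l i) \<longlonglongrightarrow> (\<Sum>i\<in>I. V k i * V l i)"
      using that by (intro tendsto_sum tendsto_mult V)
    show "(\<lambda>n. \<Sum>i\<in>I. U (s n) k i * U (s n) l i) \<longlonglongrightarrow> (if k = l then 1 else 0)"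
      using sp that by (simp add: spectral_on_def)
  qed
  moreover have "L i j = (\<Sum>k\<in>I. b k * V k i * V k j)" if "i \<in> I" "j \<in> I" for i j
  proof (rule LIMSEQ_unique)
    have "(\<lambda>n. \<Sum>k\<in>I. a (s n) k * U (s n) k i * U (s n) k j) \<longlonglongrightarrow> (\<Sum>k\<in>I. b k * V k i * V k j)"
      using that by (intro tendsto_sum tendsto_mult V b)
    moreover have "(\<Sum>k\<in>I. a (s n) k * U (s n) k i * U (s n) k j) = M (s n) i j" for n
      using sp[of "s n"] that by (simp add: spectral_on_def)
    ultimately show "(\<lambda>n. M (s n) i j) \<longlonglongrightarrow> (\<Sum>k\<in>I. b k * V k i * V k j)" by simp
  qed (rule lims[OF that])
  ultimately have "spectral_on I L V b" by (auto simp: spectral_on_def)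
  then show ?thesis using s(1) V b by blast
qed

lemma pd_on_spectral:
  assumes "finite I" "pd_on I A"
  obtains U a where "spectral_on I A U a" "\<And>k. k \<in> I \<Longrightarrow> 0 < a k"
proof -
  obtain U a where "spectral_on I A U a" using spectral_on_exists assms by (metis pd_on_def)
  then show thesis using that pd_on_iff_eigenvalues_pos[OF assms(1)] assms(2) by blast
qed

lemma mpow_on_tendsto:
  fixes M :: "nat \<Rightarrow> 'i::countable \<Rightarrow> 'i \<Rightarrow> real"
  assumes fin: "finite I" and pd: "\<And>n. pd_on I (M n)" "pd_on I L"
    and lim: "\<And>i j. i \<in> I \<Longrightarrow> j \<in> I \<Longrightarrow> (\<lambda>n. M n i j) \<longlonglongrightarrow> L i j"
  shows "(\<lambda>n. mpow_on I (M n) r i j) \<longlonglongrightarrow> mpow_on I L r i j"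
proof (cases "i \<in> I \<and> j \<in> I")
  case True
  have "\<forall>n. \<exists>U a. spectral_on I (M n) U a"
    using pd_on_spectral[OF fin pd(1)] by metis
  then obtain U a where sp: "\<And>n. spectral_on I (M n) (U n) (a n)" by metis
  show ?thesis
  proof (rule tendsto_if_subseq_tendsto)
    fix t :: "nat \<Rightarrow> nat" assume t: "strict_mono t"
    have lim_t: "(\<lambda>n. M (t n) i j) \<longlonglongrightarrow> L i j" if "i \<in> I" "j \<in> I" for i j
      using LIMSEQ_subseq_LIMSEQ[OF lim[OF that] t] by (simp add: o_def)
    obtain s V b where s: "strict_mono (s :: nat \<Rightarrow> nat)" "spectral_on I L V b"
      "\<And>k i. k \<in> I \<Longrightarrow> i \<in> I \<Longrightarrow> (\<lambda>n. U (t (s n)) k i) \<longlonglongrightarrow> V k i"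
      "\<And>k. k \<in> I \<Longrightarrow> (\<lambda>n. a (t (s n)) k) \<longlonglongrightarrow> b k"
      using spectral_on_convergent_subseq[OF fin, of "\<lambda>n. M (t n)" "\<lambda>n. U (t n)" "\<lambda>n. a (t n)" L] sp lim_t
      by blast
    have "0 < b k" if "k \<in> I" for k using pd_on_iff_eigenvalues_pos[OF fin s(2)] pd(2) that by blast
    \<comment> \<open>Positivity of the limit eigenvalues matters here: for negative
      \<open>r\<close> the power is unbounded near 0.\<close>
    then have "(\<lambda>n. \<Sum>k\<in>I. (a (t (s n)) k) powr r * U (t (s n)) k i * U (t (s n)) k j)
       \<longlonglongrightarrow> (\<Sum>k\<in>I. (b k) powr r * V k i * V k j)"
      using True by (intro tendsto_sum tendsto_mult tendsto_powr s tendsto_const) force+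
    then show "\<exists>s. strict_mono s \<and> (\<lambda>n. mpow_on I (M (t (s n))) r i j) \<longlonglongrightarrow> mpow_on I L r i j"
      using True s(1) by (auto simp: mpow_on_def mfun_on_eq[OF fin sp] mfun_on_eq[OF fin s(2)])
  qed
next
  \<comment> \<open>Outside the index set \<open>mfun_on\<close> has the default value 0.\<close>
  case False
  have "mpow_on I A r i j = 0" if A: "pd_on I A" for A
    using pd_on_spectral[OF fin A] mfun_on_eq[OF fin] False unfolding mpow_on_def by metis
  then show ?thesis using pd by simp
qed

lemma kiefer_pd_eq:
  assumes fin: "finite I" and pd: "pd_on I A" and sp: "spectral_on I A U a"
  shows "kiefer q I A = (if q = 0 then (\<Prod>k\<in>I. a k) powr (1 / real (card I))
     else ((\<Sum>k\<in>I. a k powr q) / real (card I)) powr (1 / q))"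
  using pd by (simp add: kiefer_def det_on_eq_prod_eigenvalues[OF fin sp] mpow_on_def trace_mfun_on[OF fin sp])

text \<open>Nothing is assumed about \<open>L\<close>, so the limit may be singular; the value of
  the criterion at singular matrices is exactly the continuous extension from the positive definite
  ones.\<close>

lemma kiefer_tendsto_subseq:
  fixes M :: "nat \<Rightarrow> 'i::countable \<Rightarrow> 'i \<Rightarrow> real"
  assumes fin: "finite I" "I \<noteq> {}" and q: "q < 1" and pd: "\<And>n. pd_on I (M n)"
    and lim: "\<And>i j. i \<in> I \<Longrightarrow> j \<in> I \<Longrightarrow> (\<lambda>n. M n i j) \<longlonglongrightarrow> L i j"
  shows "\<exists>s. strict_mono (s :: nat \<Rightarrow> nat) \<and> (\<lambda>n. kiefer q I (M (s n))) \<longlonglongrightarrow> kiefer q I L"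
proof -
  define N where "N = real (card I)"
  have N: "N > 0" using fin by (simp add: N_def card_gt_0_iff)
  have "\<forall>n. \<exists>U a. spectral_on I (M n) U a \<and> (\<forall>k\<in>I. 0 < a k)"
    using pd_on_spectral[OF fin(1) pd] by metis
  then obtain U a where sp: "\<And>n. spectral_on I (M n) (U n) (a n)"
    and apos: "\<And>n k. k \<in> I \<Longrightarrow> 0 < a n k" by metis
  obtain s V b where s: "strict_mono (s :: nat \<Rightarrow> nat)" "spectral_on I L V b"
    "\<forall>k\<in>I. (\<lambda>n. a (s n) k) \<longlonglongrightarrow> b k"
    using spectral_on_convergent_subseq[OF fin(1) sp lim] by auto
  have lim_a: "(\<lambda>n. a (s n) k) \<longlonglongrightarrow> b k" if "k \<in> I" for k using s(3) that by blast
  have kM: "kiefer q I (M (s n)) = (if q = 0 then (\<Prod>k\<in>I. a (s n) k) powr (1 / N)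
     else ((\<Sum>k\<in>I. a (s n) k powr q) / N) powr (1 / q))" for n
    unfolding N_def by (rule kiefer_pd_eq[OF fin(1) pd sp])
  have bnn: "0 \<le> b k" if "k \<in> I" for k
    by (rule LIMSEQ_le_const[OF lim_a[OF that]]) (use apos[OF that] in \<open>auto intro: less_imp_le\<close>)
  have "(\<lambda>n. kiefer q I (M (s n))) \<longlonglongrightarrow> kiefer q I L"
  proof (cases "\<forall>k\<in>I. 0 < b k")
    case True
    then have pdL: "pd_on I L" using pd_on_iff_eigenvalues_pos[OF fin(1) s(2)] by blast
    have kL: "kiefer q I L = (if q = 0 then (\<Prod>k\<in>I. b k) powr (1 / N)
       else ((\<Sum>k\<in>I. b k powr q) / N) powr (1 / q))"
      unfolding N_def by (rule kiefer_pd_eq[OF fin(1) pdL s(2)])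
    have "(\<Prod>k\<in>I. b k) \<noteq> 0" using True fin by auto
    moreover have "(\<Sum>k\<in>I. b k powr q) > 0" using True fin by (intro sum_pos) auto
    ultimately show ?thesis unfolding kM kL using True N
      by (auto intro!: tendsto_powr tendsto_prod tendsto_divide tendsto_sum lim_a dest: less_imp_neq)
  next
    case False
    \<comment> \<open>Limits of positive eigenvalues are nonnegative, so in the singular case one of
      them is exactly 0.\<close>
    then obtain k0 where k0: "k0 \<in> I" "b k0 = 0" using bnn by force
    have npd: "\<not> pd_on I L" using pd_on_iff_eigenvalues_pos[OF fin(1) s(2)] False by blast
    have ak0: "(\<lambda>n. a (s n) k0) \<longlonglongrightarrow> 0" using lim_a k0 by fastforce
    consider "q = 0" | "0 < q" | "q < 0" by linarith
    then show ?thesis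
    proof cases
      case 1
      have "(\<lambda>n. (\<Prod>k\<in>I. a (s n) k)) \<longlonglongrightarrow> (\<Prod>k\<in>I. b k)" by (intro tendsto_prod lim_a)
      also have "(\<Prod>k\<in>I. b k) = 0" using k0 fin by (intro prod_zero) auto
      finally have "(\<lambda>n. (\<Prod>k\<in>I. a (s n) k) powr (1 / N)) \<longlonglongrightarrow> 0 powr (1 / N)"
        using N apos by (intro tendsto_powr2 tendsto_const) (auto intro!: always_eventually prod_pos less_imp_le)
      then show ?thesis using 1 npd kM by (simp add: kiefer_def)
    next
      case 2
      have L: "kiefer q I L = ((\<Sum>k\<in>I. b k powr q) / N) powr (1 / q)"
        using 2 q npd by (simp add: kiefer_def N_def mpow_on_def trace_mfun_on[OF fin(1) s(2)])
      \<comment> \<open>With a positive exponent the base may tend to 0, which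
        \<open>tendsto_powr2\<close> permits for nonnegative bases.\<close>
      have "(\<lambda>n. a (s n) k powr q) \<longlonglongrightarrow> b k powr q" if "k \<in> I" for k
        using 2 apos[OF that] by (intro tendsto_powr2 tendsto_const lim_a[OF that]) (auto intro!: always_eventually less_imp_le)
      then have "(\<lambda>n. (\<Sum>k\<in>I. a (s n) k powr q) / N) \<longlonglongrightarrow> (\<Sum>k\<in>I. b k powr q) / N"
        using N by (intro tendsto_divide tendsto_sum tendsto_const) auto
      then have "(\<lambda>n. ((\<Sum>k\<in>I. a (s n) k powr q) / N) powr (1 / q)) \<longlonglongrightarrow> ((\<Sum>k\<in>I. b k powr q) / N) powr (1 / q)"
        using 2 N by (intro tendsto_powr2 tendsto_const) (auto intro!: always_eventually divide_nonneg_pos sum_nonneg)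
      then show ?thesis using 2 unfolding kM L by simp
    next
      case 3
      have L: "kiefer q I L = 0" using 3 npd by (simp add: kiefer_def)
      \<comment> \<open>Keeping only the term \<open>k0\<close> decreases the sum, and the negative
        exponent 1/q turns this into an upper bound proportional to the vanishing
        eigenvalue.\<close>
      have ub: "((\<Sum>k\<in>I. a (s n) k powr q) / N) powr (1 / q) \<le> a (s n) k0 * N powr (- 1 / q)" for n
      proof -
        have "a (s n) k0 powr q \<le> (\<Sum>k\<in>I. a (s n) k powr q)"
          using k0 fin by (intro member_le_sum) auto
        then have "a (s n) k0 powr q / N \<le> (\<Sum>k\<in>I. a (s n) k powr q) / N" using N by (simp add: divide_right_mono)
        then have "((\<Sum>k\<in>I. a (s n) k powr q) / N) powr (1 / q) \<le> (a (s n) k0 powr q / N) powr (1 / q)"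
          using 3 N apos[OF k0(1), of "s n"] by (intro powr_mono2') (auto simp: field_simps)
        also have "\<dots> = a (s n) k0 * N powr (- 1 / q)"
          using 3 N apos[OF k0(1), of "s n"]
          by (simp add: powr_divide powr_powr powr_minus_divide)
        finally show ?thesis .
      qed
      have up: "(\<lambda>n. a (s n) k0 * N powr (- 1 / q)) \<longlonglongrightarrow> 0"
        using tendsto_mult[OF ak0 tendsto_const] by simp
      have "(\<lambda>n. ((\<Sum>k\<in>I. a (s n) k powr q) / N) powr (1 / q)) \<longlonglongrightarrow> 0"
        by (rule tendsto_sandwich[OF always_eventually always_eventually tendsto_const up])
           (use ub in simp_all)
      then show ?thesis using 3 unfolding kM L by simp
    qed
  qed
  then show ?thesis using s(1) by blast
qed

lemma kiefer_tendsto: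
  fixes M :: "nat \<Rightarrow> 'i::countable \<Rightarrow> 'i \<Rightarrow> real"
  assumes "finite I" "I \<noteq> {}" "q < 1" "\<And>n. pd_on I (M n)"
    and "\<And>i j. i \<in> I \<Longrightarrow> j \<in> I \<Longrightarrow> (\<lambda>n. M n i j) \<longlonglongrightarrow> L i j"
  shows "(\<lambda>n. kiefer q I (M n)) \<longlonglongrightarrow> kiefer q I L"
proof (rule tendsto_if_subseq_tendsto)
  fix t :: "nat \<Rightarrow> nat" assume t: "strict_mono t"
  have "(\<lambda>n. M (t n) i j) \<longlonglongrightarrow> L i j" if "i \<in> I" "j \<in> I" for i j
    using LIMSEQ_subseq_LIMSEQ[OF assms(5)[OF that] t] by (simp add: o_def)
  then show "\<exists>s. strict_mono s \<and> (\<lambda>n. kiefer q I (M (t (s n)))) \<longlonglongrightarrow> kiefer q I L"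
    using assms by (intro kiefer_tendsto_subseq)
qed

text \<open>A common primitive of \<open>t powr (q - 1)\<close>, so that all cases of Kiefer's criterion are treated alike.\<close>
definition kiefer_prim :: "real \<Rightarrow> real \<Rightarrow> real" where
  "kiefer_prim q t = (if q = 0 then ln t else t powr q / q)"

lemma kiefer_prim_deriv:
  assumes "t > 0"
  shows "(kiefer_prim q has_real_derivative t powr (q - 1)) (at t)"
proof (cases "q = 0")
  case True
  have "(ln has_real_derivative t powr (q - 1)) (at t)"
    using assms True by (auto intro!: derivative_eq_intros simp: powr_minus_divide)
  then show ?thesis using True by (simp add: kiefer_prim_def[abs_def])
next
  case False
  have "((\<lambda>t. t powr q / q) has_real_derivative q * t powr (q - 1) / q) (at t)"
    using assms by (intro DERIV_cdivide has_real_derivative_powr)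
  then show ?thesis using False by (simp add: kiefer_prim_def[abs_def])
qed

text \<open>Strict concavity from the mean value theorem: for q < 1 the derivative
  \<open>t powr (q - 1)\<close> is strictly decreasing, whatever the sign of q.\<close>

lemma kiefer_prim_below_tangent:
  assumes q: "q < 1" and pos: "0 < a" "0 < b" and neq: "a \<noteq> b"
  shows "kiefer_prim q b < kiefer_prim q a + a powr (q - 1) * (b - a)"
proof (cases "a < b")
  case True
  then obtain z where z: "a < z" "z < b" "kiefer_prim q b - kiefer_prim q a = (b - a) * z powr (q - 1)"
    using MVT2[of a b "kiefer_prim q" "\<lambda>t. t powr (q - 1)"] kiefer_prim_deriv pos by (meson less_le_trans)
  have "z powr (q - 1) < a powr (q - 1)" using z pos q by (intro powr_less_mono2_neg) auto
  then have "(b - a) * z powr (q - 1) < (b - a) * a powr (q - 1)" using True by simp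
  then show ?thesis using z(3) by (simp add: mult.commute)
next
  case False
  then have ba: "b < a" using neq by simp
  then obtain z where z: "b < z" "z < a" "kiefer_prim q a - kiefer_prim q b = (a - b) * z powr (q - 1)"
    using MVT2[of b a "kiefer_prim q" "\<lambda>t. t powr (q - 1)"] kiefer_prim_deriv pos by (meson less_le_trans)
  have "a powr (q - 1) < z powr (q - 1)" using z pos q by (intro powr_less_mono2_neg) auto
  then have "(a - b) * a powr (q - 1) < (a - b) * z powr (q - 1)" using ba by simp
  then show ?thesis using z(3) by (simp add: algebra_simps)
qed

text \<open>The criterion is an increasing transform of the sum of primitives over the spectrum. For
  negative q both the outer exponent 1/q and the division by q reverse the order, so the direction
  is the same in all cases.\<close>

lemma kiefer_le_imp_prim_sum_le:
  assumes fin: "finite I" "I \<noteq> {}"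
    and A: "spectral_on I A U a" "pd_on I A" and M: "spectral_on I M W b" "pd_on I M"
    and le: "kiefer q I A \<le> kiefer q I M"
  shows "(\<Sum>k\<in>I. kiefer_prim q (a k)) \<le> (\<Sum>k\<in>I. kiefer_prim q (b k))"
proof -
  have apos: "0 < a k" "0 < b k" if "k \<in> I" for k
    using pd_on_iff_eigenvalues_pos[OF fin(1) A(1)] pd_on_iff_eigenvalues_pos[OF fin(1) M(1)] A(2) M(2) that by auto
  define N where "N = real (card I)"
  have N: "N > 0" using fin by (simp add: N_def card_gt_0_iff)
  have Sa: "(\<Sum>k\<in>I. a k powr q) > 0" and Sb: "(\<Sum>k\<in>I. b k powr q) > 0"
    using fin by (intro sum_pos; simp; metis apos less_irrefl)+
  have Pa: "(\<Prod>k\<in>I. a k) > 0" and Pb: "(\<Prod>k\<in>I. b k) > 0" using apos by (auto intro!: prod_pos)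
  note eqs = kiefer_pd_eq[OF fin(1) A(2,1), of q, folded N_def] kiefer_pd_eq[OF fin(1) M(2,1), of q, folded N_def]
  consider "q = 0" | "0 < q" | "q < 0" by linarith
  then show ?thesis
  proof cases
    case 1
    have "(\<Prod>k\<in>I. a k) \<le> (\<Prod>k\<in>I. b k)"
    proof (rule ccontr)
      assume "\<not> ?thesis"
      then have "(\<Prod>k\<in>I. b k) powr (1 / N) < (\<Prod>k\<in>I. a k) powr (1 / N)"
        using Pb N by (intro powr_less_mono2) auto
      then show False using le 1 unfolding eqs by simp
    qed
    then have "ln (\<Prod>k\<in>I. a k) \<le> ln (\<Prod>k\<in>I. b k)" using Pa by simp
    also have "ln (\<Prod>k\<in>I. a k) = (\<Sum>k\<in>I. ln (a k))"
      using fin by (intro ln_prod) (metis apos(1) less_irrefl)+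
    also have "ln (\<Prod>k\<in>I. b k) = (\<Sum>k\<in>I. ln (b k))"
      using fin by (intro ln_prod) (metis apos(2) less_irrefl)+
    finally show ?thesis using 1 by (simp add: kiefer_prim_def)
  next
    case 2
    have "(\<Sum>k\<in>I. a k powr q) \<le> (\<Sum>k\<in>I. b k powr q)"
    proof (rule ccontr)
      assume "\<not> ?thesis"
      then have "((\<Sum>k\<in>I. b k powr q) / N) powr (1 / q) < ((\<Sum>k\<in>I. a k powr q) / N) powr (1 / q)"
        using Sb N 2 by (intro powr_less_mono2) (auto simp: divide_strict_right_mono)
      then show False using le 2 unfolding eqs by simp
    qed
    then show ?thesis using 2 by (simp add: kiefer_prim_def sum_divide_distrib[symmetric] divide_right_mono)
  next
    case 3
    have "(\<Sum>k\<in>I. b k powr q) \<le> (\<Sum>k\<in>I. a k powr q)"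
    proof (rule ccontr)
      assume "\<not> ?thesis"
      then have "((\<Sum>k\<in>I. b k powr q) / N) powr (1 / q) < ((\<Sum>k\<in>I. a k powr q) / N) powr (1 / q)"
        using Sa N 3 by (intro powr_less_mono2_neg) (auto simp: divide_strict_right_mono)
      then show False using le 3 unfolding eqs by simp
    qed
    then show ?thesis using 3 by (simp add: kiefer_prim_def sum_divide_distrib[symmetric] divide_right_mono_neg)
  qed
qed

text \<open>The hypothesis \<open>tangent\<close> says trace (A^(q-1) (M - A)) \<le> 0, so by
  concavity M cannot be better than A, and strictness forces equality. Averaging the scalar tangent
  inequalities at pairs of eigenvalues with the squared overlaps as weights makes this
  precise.\<close>

lemma kiefer_tangent_equality:
  assumes fin: "finite I" "I \<noteq> {}" and q: "q < 1" and pdA: "pd_on I A" and pdM: "pd_on I M"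
    and tangent: "(\<Sum>i\<in>I. \<Sum>j\<in>I. mpow_on I A (q - 1) i j * M i j) \<le> trace_on I (mpow_on I A q)"
    and le: "kiefer q I A \<le> kiefer q I M"
    and ij: "i \<in> I" "j \<in> I"
  shows "M i j = A i j"
proof -
  obtain U a where A: "spectral_on I A U a" and apos: "\<And>k. k \<in> I \<Longrightarrow> 0 < a k"
    using pd_on_spectral[OF fin(1) pdA] by blast
  obtain W b where M: "spectral_on I M W b" and bpos: "\<And>k. k \<in> I \<Longrightarrow> 0 < b k"
    using pd_on_spectral[OF fin(1) pdM] by blast
  note orthU = spectral_on_orthonormal[OF A] and orthW = spectral_on_orthonormal[OF M]
  define w where "w k l = (\<Sum>i\<in>I. U k i * W l i)" for k l
  define f where "f = kiefer_prim q"
  \<comment> \<open>Parseval in the two bases: the squared overlaps have row and column sums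
    1.\<close>
  have U1: "(\<Sum>l\<in>I. (w k l)\<^sup>2) = 1" if k: "k \<in> I" for k
  proof -
    have "(\<Sum>l\<in>I. (w k l)\<^sup>2) = (\<Sum>l\<in>I. \<Sum>i\<in>I. U k i * (w k l * W l i))"
      by (simp add: power2_eq_square w_def sum_distrib_left mult_ac)
    also have "\<dots> = (\<Sum>i\<in>I. U k i * (\<Sum>l\<in>I. w k l * W l i))"
      by (subst sum.swap) (simp add: sum_distrib_left)
    also have "\<dots> = (\<Sum>i\<in>I. U k i * U k i)"
      using orthonormal_on_expand[OF fin(1) orthW] by (intro sum.cong) (auto simp: w_def)
    finally show ?thesis using A k by (simp add: spectral_on_def)
  qed
  have W1: "(\<Sum>k\<in>I. (w k l)\<^sup>2) = 1" if l: "l \<in> I" for l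
  proof -
    have "(\<Sum>k\<in>I. (w k l)\<^sup>2) = (\<Sum>k\<in>I. \<Sum>i\<in>I. W l i * (w k l * U k i))"
      by (simp add: power2_eq_square w_def sum_distrib_left mult_ac)
    also have "\<dots> = (\<Sum>i\<in>I. W l i * (\<Sum>k\<in>I. w k l * U k i))"
      by (subst sum.swap) (simp add: sum_distrib_left)
    also have "\<dots> = (\<Sum>i\<in>I. W l i * W l i)"
      using orthonormal_on_expand[OF fin(1) orthU, of _ "W l"] by (intro sum.cong) (auto simp: w_def mult_ac)
    finally show ?thesis using M l by (simp add: spectral_on_def)
  qed
  \<comment> \<open>The trace of A^(q-1) M, expressed through eigenvalues and squared
    overlaps.\<close>
  have "(\<Sum>i\<in>I. \<Sum>j\<in>I. mpow_on I A (q - 1) i j * M i j) =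
     (\<Sum>i\<in>I. \<Sum>j\<in>I. \<Sum>k\<in>I. \<Sum>l\<in>I. a k powr (q - 1) * b l * ((U k i * W l i) * (U k j * W l j)))"
  proof (intro sum.cong refl)
    fix i j assume ij: "i \<in> I" "j \<in> I"
    have "mpow_on I A (q - 1) i j * M i j =
        (\<Sum>k\<in>I. a k powr (q - 1) * U k i * U k j) * (\<Sum>l\<in>I. b l * W l i * W l j)"
      using M ij by (simp add: mpow_on_def mfun_on_eq[OF fin(1) A] spectral_on_def)
    also have "\<dots> = (\<Sum>k\<in>I. \<Sum>l\<in>I. a k powr (q - 1) * b l * ((U k i * W l i) * (U k j * W l j)))"
      unfolding sum_product by (intro sum.cong refl) (simp only: mult_ac)
    finally show "mpow_on I A (q - 1) i j * M i j =
        (\<Sum>k\<in>I. \<Sum>l\<in>I. a k powr (q - 1) * b l * ((U k i * W l i) * (U k j * W l j)))" .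
  qed
  also have "\<dots> = (\<Sum>i\<in>I. \<Sum>k\<in>I. \<Sum>l\<in>I. \<Sum>j\<in>I. a k powr (q - 1) * b l * ((U k i * W l i) * (U k j * W l j)))"
    by (subst (2) sum.swap, subst (3) sum.swap) (rule refl)
  also have "\<dots> = (\<Sum>k\<in>I. \<Sum>l\<in>I. \<Sum>i\<in>I. \<Sum>j\<in>I. a k powr (q - 1) * b l * ((U k i * W l i) * (U k j * W l j)))"
    by (subst sum.swap, subst (2) sum.swap) (rule refl)
  also have "\<dots> = (\<Sum>k\<in>I. \<Sum>l\<in>I. a k powr (q - 1) * b l * (w k l)\<^sup>2)"
    unfolding power2_eq_square w_def sum_product by (simp only: sum_distrib_left)
  finally have G: "(\<Sum>k\<in>I. \<Sum>l\<in>I. a k powr (q - 1) * b l * (w k l)\<^sup>2) \<le> (\<Sum>k\<in>I. a k powr q)"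
    using tangent by (simp add: mpow_on_def trace_mfun_on[OF fin(1) A])
  \<comment> \<open>The weighted gap between the tangent at \<open>a k\<close> and the function at
    \<open>b l\<close>. Each gap is nonnegative and their total is at most 0, so \<open>a k\<close>
    and \<open>b l\<close> agree wherever the overlap is nonzero.\<close>
  define T where "T k l = (w k l)\<^sup>2 * (f (a k) + a k powr (q - 1) * (b l - a k) - f (b l))" for k l
  have gap: "0 < f (a k) + a k powr (q - 1) * (b l - a k) - f (b l)" if "k \<in> I" "l \<in> I" "a k \<noteq> b l" for k l
    using kiefer_prim_below_tangent[OF q apos bpos] that by (simp add: f_def)
  have Tnn: "0 \<le> T k l" if "k \<in> I" "l \<in> I" for k l
    using gap[OF that] by (cases "a k = b l") (auto simp: T_def)
  have "(\<Sum>k\<in>I. \<Sum>l\<in>I. T k l) =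
     (\<Sum>k\<in>I. \<Sum>l\<in>I. (w k l)\<^sup>2 * f (a k)) + (\<Sum>k\<in>I. \<Sum>l\<in>I. a k powr (q - 1) * b l * (w k l)\<^sup>2)
     - (\<Sum>k\<in>I. \<Sum>l\<in>I. (w k l)\<^sup>2 * (a k powr (q - 1) * a k)) - (\<Sum>k\<in>I. \<Sum>l\<in>I. (w k l)\<^sup>2 * f (b l))"
    by (simp add: T_def sum.distrib[symmetric] sum_subtractf[symmetric] algebra_simps)
  also have "(\<Sum>k\<in>I. \<Sum>l\<in>I. (w k l)\<^sup>2 * f (a k)) = (\<Sum>k\<in>I. f (a k))"
    by (simp add: sum_distrib_right[symmetric] U1)
  also have "(\<Sum>k\<in>I. \<Sum>l\<in>I. (w k l)\<^sup>2 * f (b l)) = (\<Sum>l\<in>I. f (b l))"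
    by (subst sum.swap) (simp add: sum_distrib_right[symmetric] W1)
  also have "(\<Sum>k\<in>I. \<Sum>l\<in>I. (w k l)\<^sup>2 * (a k powr (q - 1) * a k)) = (\<Sum>k\<in>I. a k powr q)"
    unfolding sum_distrib_right[symmetric]
    by (intro sum.cong refl) (simp add: U1 powr_diff abs_of_pos[OF apos] less_imp_neq[OF apos, symmetric])
  also have "(\<Sum>k\<in>I. f (a k)) + (\<Sum>k\<in>I. \<Sum>l\<in>I. a k powr (q - 1) * b l * (w k l)\<^sup>2)
     - (\<Sum>k\<in>I. a k powr q) - (\<Sum>l\<in>I. f (b l)) \<le> 0"
    using G kiefer_le_imp_prim_sum_le[OF fin A pdA M pdM le] by (simp add: f_def)
  finally have "(\<Sum>k\<in>I. \<Sum>l\<in>I. T k l) \<le> 0" .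
  moreover have rows: "0 \<le> (\<Sum>l\<in>I. T k l)" if "k \<in> I" for k using Tnn that by (intro sum_nonneg) auto
  ultimately have "(\<Sum>k\<in>I. \<Sum>l\<in>I. T k l) = 0" by (meson antisym sum_nonneg)
  then have "\<forall>k\<in>I. (\<Sum>l\<in>I. T k l) = 0" using rows fin by (subst (asm) sum_nonneg_eq_0_iff) auto
  then have T0: "T k l = 0" if "k \<in> I" "l \<in> I" for k l
    using that Tnn fin by (metis sum_nonneg_eq_0_iff)
  have eq: "a k * w k l = b l * w k l" if "k \<in> I" "l \<in> I" for k l
  proof (cases "a k = b l")
    case False
    then have "w k l = 0" using gap[OF that] T0[OF that] by (auto simp: T_def)
    then show ?thesis by simp
  qed simp
  have "A i j = (\<Sum>k\<in>I. a k * U k i * U k j)" using A ij by (simp add: spectral_on_def)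
  also have "\<dots> = (\<Sum>l\<in>I. b l * W l i * W l j)"
    using orthonormal_combination_eq[OF fin(1) orthU orthW _ ij] eq unfolding w_def by blast
  also have "\<dots> = M i j" using M ij by (simp add: spectral_on_def)
  finally show ?thesis by simp
qed

section \<open>Convex hulls in finitely many coordinates\<close>

text \<open>The point is the bound on the number of atoms independent of \<open>T\<close>: it makes
  the convex hull the image of one compact parameter set.\<close>

lemma caratheodory_finite_index:
  fixes \<phi> :: "'p \<Rightarrow> 'i \<Rightarrow> real"
  assumes finI: "finite I" and T: "finite T" "\<And>t. t \<in> T \<Longrightarrow> 0 \<le> w t" "sum w T = (1::real)"
  obtains T' w' where "finite T'" "T' \<subseteq> T" "card T' \<le> card I + 1" "\<And>t. t \<in> T' \<Longrightarrow> 0 \<le> w' t" "sum w' T' = 1"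
    "\<And>i. i \<in> I \<Longrightarrow> (\<Sum>t\<in>T'. w' t * \<phi> t i) = (\<Sum>t\<in>T. w t * \<phi> t i)"
proof -
  have "\<exists>T' w'. finite T' \<and> T' \<subseteq> T \<and> card T' \<le> card I + 1 \<and> (\<forall>t\<in>T'. 0 \<le> w' t) \<and> sum w' T' = 1 \<and>
     (\<forall>i\<in>I. (\<Sum>t\<in>T'. w' t * \<phi> t i) = (\<Sum>t\<in>T. w t * \<phi> t i))"
    using T
  proof (induction "card T" arbitrary: T w rule: less_induct)
    case less
    show ?case
    proof (cases "card T \<le> card I + 1")
      case True
      then show ?thesis using less.prems by blast
    next
      case False
      \<comment> \<open>The extra coordinate \<open>None\<close> with constant value 1 forces the
        coefficients of the dependence to sum to 0, so it is affine and not merely linear.\<close>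
      define \<psi> where "\<psi> t i = (case i of None \<Rightarrow> 1 | Some i \<Rightarrow> \<phi> t i)" for t i
      have "card (insert None (Some ` I)) < card T"
        using False finI by (simp add: card_image)
      then obtain c where c: "\<exists>t\<in>T. c t \<noteq> 0" "\<And>i. i \<in> insert None (Some ` I) \<Longrightarrow> (\<Sum>t\<in>T. c t * \<psi> t i) = 0"
        using homogeneous_system_nontrivial_solution[of "insert None (Some ` I)" T \<psi>] finI less.prems(1) by auto
      have c0: "sum c T = 0" using c(2)[of None] by (simp add: \<psi>_def)
      have c\<phi>: "(\<Sum>t\<in>T. c t * \<phi> t i) = 0" if "i \<in> I" for i using c(2)[of "Some i"] that by (simp add: \<psi>_def)
      \<comment> \<open>Subtracting the largest admissible multiple of the affine dependence \<open>c\<close> removes an atom.\<close>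
      define P where "P = {t \<in> T. 0 < c t}"
      have "P \<noteq> {}"
      proof
        assume "P = {}"
        then have "\<forall>t\<in>T. 0 \<le> - c t" by (auto simp: P_def not_less)
        moreover have "(\<Sum>t\<in>T. - c t) = 0" using c0 by (simp add: sum_negf)
        ultimately have "\<forall>t\<in>T. - c t = 0" using less.prems(1) by (simp add: sum_nonneg_eq_0_iff)
        with c(1) show False by simp
      qed
      moreover have "finite P" using less.prems(1) by (simp add: P_def)
      ultimately have fP: "finite ((\<lambda>t. w t / c t) ` P)" "(\<lambda>t. w t / c t) ` P \<noteq> {}" by auto
      define \<tau> where "\<tau> = Min ((\<lambda>t. w t / c t) ` P)"
      obtain t0 where t0: "t0 \<in> P" "\<tau> = w t0 / c t0" using Min_in[OF fP] by (auto simp: \<tau>_def)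
      have \<tau>: "\<tau> \<le> w t / c t" if "t \<in> P" for t using Min_le[OF fP(1)] that by (auto simp: \<tau>_def)
      have t0T: "t0 \<in> T" "0 < c t0" using t0 by (auto simp: P_def)
      then have \<tau>0: "0 \<le> \<tau>" using t0(2) less.prems(2)[of t0] by simp
      define v where "v t = w t - \<tau> * c t" for t
      have v0: "0 \<le> v t" if "t \<in> T" for t
      proof (cases "0 < c t")
        case True
        then have "\<tau> \<le> w t / c t" using \<tau> that by (simp add: P_def)
        then show ?thesis using True by (simp add: v_def field_simps)
      next
        case False
        then have "\<tau> * c t \<le> 0" using \<tau>0 by (simp add: mult_nonneg_nonpos)
        then show ?thesis using less.prems(2)[OF that] by (simp add: v_def)
      qed
      have vt0: "v t0 = 0" using t0T t0(2) by (simp add: v_def)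
      have sum_v: "(\<Sum>t\<in>T - {t0}. v t * x t) = (\<Sum>t\<in>T. w t * x t) - \<tau> * (\<Sum>t\<in>T. c t * x t)" for x
      proof -
        have "(\<Sum>t\<in>T - {t0}. v t * x t) = (\<Sum>t\<in>T. v t * x t)"
          using vt0 less.prems(1) t0T by (simp add: sum.remove[of T t0])
        then show ?thesis by (simp add: v_def algebra_simps sum_subtractf sum_distrib_left)
      qed
      have "card (T - {t0}) < card T" using less.prems(1) t0T by (intro psubset_card_mono) auto
      moreover have "sum v (T - {t0}) = 1" using sum_v[of "\<lambda>_. 1"] c0 less.prems(3) by simp
      ultimately obtain T' w' where "finite T'" "T' \<subseteq> T - {t0}" "card T' \<le> card I + 1" "\<forall>t\<in>T'. 0 \<le> w' t" "sum w' T' = 1"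
         and eq: "\<forall>i\<in>I. (\<Sum>t\<in>T'. w' t * \<phi> t i) = (\<Sum>t\<in>T - {t0}. v t * \<phi> t i)"
        using less.hyps[of "T - {t0}" v] less.prems(1) v0 by auto
      moreover have "(\<Sum>t\<in>T - {t0}. v t * \<phi> t i) = (\<Sum>t\<in>T. w t * \<phi> t i)" if "i \<in> I" for i
        using sum_v[of "\<lambda>t. \<phi> t i"] c\<phi>[OF that] by simp
      ultimately show ?thesis by (intro exI[of _ T'] exI[of _ w']) auto
    qed
  qed
  then show thesis using that by blast
qed

text \<open>Separation by the nearest point. If \<open>u\<close> is the point of the hull closest to
  \<open>z\<close> and p = u - z, minimality says that p attains its least value over the hull at
  \<open>u\<close>; the hypothesis transfers the inequality to \<open>z\<close>, which gives |p|^2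
  \<le> 0.\<close>

lemma in_convex_hull_if_affine_inequalities:
  fixes \<phi> :: "'p::metric_space \<Rightarrow> 'i \<Rightarrow> real"
  assumes finI: "finite I" and X: "compact X" and cont: "\<And>i. i \<in> I \<Longrightarrow> continuous_on X (\<lambda>x. \<phi> x i)"
    and ineq: "\<And>p c. (\<And>x. x \<in> X \<Longrightarrow> c \<le> (\<Sum>i\<in>I. p i * \<phi> x i)) \<Longrightarrow> c \<le> (\<Sum>i\<in>I. p i * z i)"
  obtains x :: "nat \<Rightarrow> 'p" and w :: "nat \<Rightarrow> real" and N :: nat
    where "\<And>k. x k \<in> X" "\<And>k. 0 \<le> w k" "(\<Sum>k<N. w k) = 1" "\<And>i. i \<in> I \<Longrightarrow> (\<Sum>k<N. w k * \<phi> (x k) i) = z i"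
proof -
  \<comment> \<open>For empty \<open>X\<close> the hypothesis with p = 0 and c = 1 would read 1
    \<le> 0.\<close>
  obtain x0 where x0: "x0 \<in> X" using ineq[of 1 "\<lambda>_. 0"] by fastforce
  define N where "N = card I + 1"
  define comb where "comb y i = (\<Sum>k<N. snd y k * \<phi> (fst y k) i)" for y :: "(nat \<Rightarrow> 'p) \<times> (nat \<Rightarrow> real)" and i
  \<comment> \<open>Only the first \<open>N\<close> atoms enter \<open>comb\<close> and the
    normalisation; the remaining ones are padding inside compact sets.\<close>
  define S where "S = PiE UNIV (\<lambda>_::nat. {0..1::real}) \<inter> {w. (\<Sum>k<N. w k) = 1}"
  define K where "K = PiE UNIV (\<lambda>_::nat. X) \<times> S"
  define F where "F y = (\<Sum>i\<in>I. (comb y i - z i)\<^sup>2)" for y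
  have "compact K" unfolding K_def S_def
    by (intro compact_Times compact_Int_closed compact_Pi_UNIV X compact_Icc closed_Collect_eq continuous_intros)
       auto
  have "((\<lambda>_. x0), (\<lambda>k. if k = 0 then 1 else 0)) \<in> K"
    using x0 by (auto simp: K_def S_def N_def sum.delta lessThan_Suc)
  then have "K \<noteq> {}" by blast
  have "continuous_on K F"
  proof -
    have "continuous_on K (\<lambda>y. \<phi> (fst y k) i)" if "i \<in> I" for i k
    proof (rule continuous_on_compose2[OF cont[OF that]])
      have "continuous_on K (\<lambda>y. (fst y) k)"
        by (rule continuous_on_compose2[OF continuous_on_product_coordinates continuous_on_fst[OF continuous_on_id]]) auto
      then show "continuous_on K (\<lambda>y. fst y k)" .
    qed (auto simp: K_def)
    moreover have "continuous_on K (\<lambda>y. snd y k)" for k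
      by (rule continuous_on_compose2[OF continuous_on_product_coordinates continuous_on_snd[OF continuous_on_id]]) auto
    ultimately show ?thesis unfolding F_def comb_def by (intro continuous_intros) auto
  qed
  with \<open>compact K\<close> \<open>K \<noteq> {}\<close> obtain y where y: "y \<in> K" "\<And>y'. y' \<in> K \<Longrightarrow> F y \<le> F y'"
    using continuous_attains_inf[of K F] by blast
  have in_K: "\<exists>y'\<in>K. \<forall>i\<in>I. comb y' i = (\<Sum>t\<in>T. v t * \<phi> t i)"
    if T: "finite T" "T \<subseteq> X" "\<And>t. t \<in> T \<Longrightarrow> 0 \<le> v t" "sum v T = 1" for T v
  proof -
    obtain T' v' where T': "finite T'" "T' \<subseteq> T" "card T' \<le> N" "\<And>t. t \<in> T' \<Longrightarrow> 0 \<le> v' t" "sum v' T' = 1"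
      "\<And>i. i \<in> I \<Longrightarrow> (\<Sum>t\<in>T'. v' t * \<phi> t i) = (\<Sum>t\<in>T. v t * \<phi> t i)"
      using caratheodory_finite_index[OF finI T(1,3,4), of \<phi> thesis] unfolding N_def by blast
    obtain h where h: "bij_betw h {..<card T'} T'"
      using ex_bij_betw_nat_finite[OF T'(1)] by (auto simp: atLeast0LessThan)
    define xs where "xs k = (if k < card T' then h k else x0)" for k
    define ws where "ws k = (if k < card T' then v' (h k) else 0)" for k
    have sum: "(\<Sum>k<N. ws k * g (xs k)) = (\<Sum>t\<in>T'. v' t * g t)" for g
    proof -
      have "(\<Sum>k<N. ws k * g (xs k)) = (\<Sum>k<card T'. ws k * g (xs k))"
        using T'(3) by (intro sum.mono_neutral_right) (auto simp: ws_def)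
      also have "\<dots> = (\<Sum>k<card T'. v' (h k) * g (h k))"
        by (intro sum.cong) (auto simp: ws_def xs_def)
      also have "\<dots> = (\<Sum>t\<in>T'. v' t * g t)" by (rule sum.reindex_bij_betw[OF h])
      finally show ?thesis .
    qed
    have hT: "h k \<in> T'" if "k < card T'" for k using h that by (auto simp: bij_betw_def)
    have "xs k \<in> X" for k using hT T'(2) T(2) x0 by (auto simp: xs_def)
    moreover have "0 \<le> ws k \<and> ws k \<le> 1" for k
    proof (cases "k < card T'")
      case True
      then have "v' (h k) \<le> sum v' T'" using hT T'(1,4) by (intro member_le_sum) auto
      then show ?thesis using True hT T'(4,5) by (simp add: ws_def)
    qed (simp add: ws_def)
    moreover have "(\<Sum>k<N. ws k) = 1" using sum[of "\<lambda>_. 1"] T'(5) by simp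
    ultimately have "(xs, ws) \<in> K" by (auto simp: K_def S_def)
    moreover have "comb (xs, ws) i = (\<Sum>t\<in>T. v t * \<phi> t i)" if "i \<in> I" for i
      using sum[of "\<lambda>t. \<phi> t i"] T'(6)[OF that] by (simp add: comb_def)
    ultimately show ?thesis by blast
  qed
  define u where "u i = comb y i" for i
  define p where "p i = u i - z i" for i
  have yK: "\<And>k. fst y k \<in> X" "\<And>k. 0 \<le> snd y k" "(\<Sum>k<N. snd y k) = 1"
    using y(1) by (auto simp: K_def S_def PiE_iff mem_Times_iff)
  have var: "(\<Sum>i\<in>I. p i * u i) \<le> (\<Sum>i\<in>I. p i * \<phi> x i)" if x: "x \<in> X" for x
  proof -
    define b where "b = (\<Sum>i\<in>I. p i * (\<phi> x i - u i))"
    define C where "C = (\<Sum>i\<in>I. (\<phi> x i - u i)\<^sup>2)"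
    have step: "0 \<le> 2 * t * b + t\<^sup>2 * C" if t: "0 < t" "t \<le> 1" for t
    proof -
      define T where "T = insert x (fst y ` {..<N})"
      \<comment> \<open>The mixture of the minimiser, with weight 1 - t, and a unit mass at
        \<open>x\<close>, with weight t. Atoms may coincide, so weights are collected over
        fibres.\<close>
      define v where "v s = (1 - t) * (\<Sum>k | k < N \<and> fst y k = s. snd y k) + (if s = x then t else 0)" for s
      have vsum: "(\<Sum>s\<in>T. v s * g s) = (1 - t) * (\<Sum>k<N. snd y k * g (fst y k)) + t * g x" for g
      proof -
        have "(\<Sum>s\<in>T. (\<Sum>k | k < N \<and> fst y k = s. snd y k) * g s) =
            (\<Sum>s\<in>T. \<Sum>k | k \<in> {..<N} \<and> fst y k = s. snd y k * g (fst y k))"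
          by (intro sum.cong) (auto simp: sum_distrib_right)
        also have "\<dots> = (\<Sum>k<N. snd y k * g (fst y k))"
          by (rule sum.group) (auto simp: T_def)
        finally have 1: "(\<Sum>s\<in>T. (\<Sum>k | k < N \<and> fst y k = s. snd y k) * g s) = (\<Sum>k<N. snd y k * g (fst y k))" .
        have "(\<Sum>s\<in>T. (if s = x then t else 0) * g s) = (\<Sum>s\<in>T. if s = x then t * g s else 0)"
          by (intro sum.cong) auto
        also have "\<dots> = t * g x" by (simp add: T_def)
        finally have 2: "(\<Sum>s\<in>T. (if s = x then t else 0) * g s) = t * g x" .
        have "(\<Sum>s\<in>T. v s * g s) = (1 - t) * (\<Sum>s\<in>T. (\<Sum>k | k < N \<and> fst y k = s. snd y k) * g s)
            + (\<Sum>s\<in>T. (if s = x then t else 0) * g s)"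
        proof -
          have "v s * g s = (1 - t) * ((\<Sum>k | k < N \<and> fst y k = s. snd y k) * g s)
              + (if s = x then t else 0) * g s" for s
            by (simp only: v_def distrib_right mult.assoc)
          then show ?thesis by (simp only: sum.distrib sum_distrib_left[symmetric])
        qed
        then show ?thesis using 1 2 by simp
      qed
      have "finite T" "T \<subseteq> X" using x yK by (auto simp: T_def)
      moreover have "0 \<le> v s" for s using t yK by (auto simp: v_def intro!: add_nonneg_nonneg mult_nonneg_nonneg sum_nonneg)
      moreover have "sum v T = 1" using vsum[of "\<lambda>_. 1"] yK by simp
      ultimately obtain y' where y': "y' \<in> K" "\<forall>i\<in>I. comb y' i = (\<Sum>s\<in>T. v s * \<phi> s i)"
        using in_K[of T v] by blast
      have "comb y' i - z i = p i + t * (\<phi> x i - u i)" if "i \<in> I" for i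
        using y'(2) that vsum[of "\<lambda>s. \<phi> s i"] by (simp add: p_def u_def comb_def algebra_simps)
      then have "F y' = (\<Sum>i\<in>I. (p i + t * (\<phi> x i - u i))\<^sup>2)"
        unfolding F_def by (intro sum.cong) simp_all
      also have "\<dots> = (\<Sum>i\<in>I. (p i)\<^sup>2 + 2 * t * (p i * (\<phi> x i - u i)) + t\<^sup>2 * (\<phi> x i - u i)\<^sup>2)"
        by (intro sum.cong) (auto simp: power2_eq_square algebra_simps)
      also have "\<dots> = F y + 2 * t * b + t\<^sup>2 * C"
        by (simp add: sum.distrib sum_distrib_left b_def C_def F_def p_def u_def)
      finally show ?thesis using y(2)[OF y'(1)] by simp
    qed
    have "0 \<le> b"
    proof (rule ccontr)
      assume "\<not> 0 \<le> b"
      then have b: "b < 0" by simp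
      have C: "0 \<le> C" by (auto simp: C_def intro: sum_nonneg)
      \<comment> \<open>Chosen so that t C \<le> - b; then 2 b + t C \<le> b < 0 contradicts
        \<open>step\<close>.\<close>
      define t where "t = min 1 (- b / (C + 1))"
      have t: "0 < t" "t \<le> 1" using b C by (auto simp: t_def divide_neg_pos)
      have "t \<le> - b / (C + 1)" by (simp add: t_def)
      then have "t * (C + 1) \<le> - b" using C by (simp add: pos_le_minus_divide_eq)
      then have "t * C \<le> - b" using t by (simp add: algebra_simps)
      then have "2 * b + t * C < 0" using b by linarith
      then have "t * (2 * b + t * C) < 0" using t by (simp add: mult_pos_neg)
      then show False using step[OF t] by (simp add: algebra_simps power2_eq_square)
    qed
    then show ?thesis by (simp add: b_def algebra_simps sum_subtractf)
  qed
  have le: "(\<Sum>i\<in>I. p i * u i) \<le> (\<Sum>i\<in>I. p i * z i)" using ineq[of _ p] var by blast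
  have "(\<Sum>i\<in>I. (p i)\<^sup>2) \<le> 0"
  proof -
    have "(p i)\<^sup>2 = p i * u i - p i * z i" for i by (simp add: p_def power2_eq_square algebra_simps)
    then show ?thesis using le by (simp add: sum_subtractf)
  qed
  then have "\<forall>i\<in>I. (p i)\<^sup>2 = 0" using finI sum_nonneg_eq_0_iff[of I "\<lambda>i. (p i)\<^sup>2"]
    by (metis antisym sum_nonneg zero_le_power2)
  then have "comb y i = z i" if "i \<in> I" for i using that by (simp add: p_def u_def)
  then show thesis using that[of "fst y" "snd y" N] yK by (simp add: comb_def)
qed

section \<open>Putinar's theorem for functionals\<close>

lemma madd_comm: "madd \<alpha> \<beta> = madd \<beta> \<alpha>"
  by (simp add: madd_def add.commute)

lemma madd_assoc: "madd (madd \<alpha> \<beta>) \<gamma> = madd \<alpha> (madd \<beta> \<gamma>)"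
  by (simp add: madd_def add.assoc)

lemma madd_left_comm: "madd \<alpha> (madd \<beta> \<gamma>) = madd \<beta> (madd \<alpha> \<gamma>)"
  by (simp add: madd_def add.left_commute)

lemmas madd_ac = madd_assoc madd_comm madd_left_comm

lemma madd_mzero [simp]: "madd mzero \<alpha> = \<alpha>" "madd \<alpha> mzero = \<alpha>"
  by (simp_all add: madd_def mzero_def)

lemma mdeg_madd [simp]: "mdeg (madd \<alpha> \<beta>) = mdeg \<alpha> + mdeg \<beta>"
  by (simp add: mdeg_def madd_def sum.distrib)

lemma mdeg_mzero [simp]: "mdeg mzero = 0"
  by (simp add: mdeg_def mzero_def)

lemma mdeg_eq_0_iff: "mdeg \<alpha> = 0 \<longleftrightarrow> \<alpha> = mzero"
  by (auto simp: mdeg_def mzero_def)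

lemma finite_Mon [simp]: "finite (Mon k :: 'n::finite mexp set)"
proof (rule finite_subset)
  show "(Mon k :: 'n mexp set) \<subseteq> (PiE UNIV (\<lambda>_. {..k}))"
  proof
    fix \<alpha> :: "'n mexp" assume "\<alpha> \<in> Mon k"
    moreover have "\<alpha> i \<le> mdeg \<alpha>" for i unfolding mdeg_def by (intro member_le_sum) auto
    ultimately show "\<alpha> \<in> PiE UNIV (\<lambda>_. {..k})" by (auto simp: Mon_def intro: order_trans)
  qed
qed (simp add: finite_PiE)

lemma mzero_in_Mon [simp]: "mzero \<in> Mon k"
  by (simp add: Mon_def)

lemma Mon_nonempty [simp]: "Mon k \<noteq> {}"
  using mzero_in_Mon by blast

definition munit :: "'n \<Rightarrow> 'n mexp" where
  "munit i = (\<lambda>k. if k = i then 1 else 0)"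

lemma mdeg_munit [simp]: "mdeg (munit i) = 1"
  by (simp add: mdeg_def munit_def)

lemma munit_split:
  assumes "\<alpha> \<noteq> mzero"
  obtains i \<beta> where "\<alpha> = madd (munit i) \<beta>" "mdeg \<alpha> = Suc (mdeg \<beta>)"
proof -
  obtain i where i: "\<alpha> i > 0" using assms by (auto simp: mzero_def fun_eq_iff)
  define \<beta> where "\<beta> = (\<lambda>k. if k = i then \<alpha> k - 1 else \<alpha> k)"
  have "\<alpha> = madd (munit i) \<beta>" using i by (auto simp: madd_def munit_def \<beta>_def)
  then show thesis using that by (metis mdeg_madd mdeg_munit plus_1_eq_Suc)
qed

text \<open>With a = b = d this shows that the moment matrix of order d determines every moment up
  to degree 2 d.\<close>

lemma mexp_split:
  fixes \<gamma> :: "'n::finite mexp"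
  assumes "mdeg \<gamma> \<le> a + b"
  shows "\<exists>\<alpha> \<beta>. madd \<alpha> \<beta> = \<gamma> \<and> mdeg \<alpha> \<le> a \<and> mdeg \<beta> \<le> b"
  using assms
proof (induction a arbitrary: \<gamma>)
  case 0
  then show ?case by (intro exI[of _ mzero] exI[of _ \<gamma>]) simp
next
  case (Suc a)
  show ?case
  proof (cases "\<gamma> = mzero")
    case True
    then show ?thesis by (intro exI[of _ mzero]) simp
  next
    case False
    then obtain i \<delta> where \<delta>: "\<gamma> = madd (munit i) \<delta>" "mdeg \<gamma> = Suc (mdeg \<delta>)" by (rule munit_split)
    then obtain \<alpha> \<beta> where "madd \<alpha> \<beta> = \<delta>" "mdeg \<alpha> \<le> a" "mdeg \<beta> \<le> b" using Suc by force
    then show ?thesis using \<delta> by (intro exI[of _ "madd (munit i) \<alpha>"] exI[of _ \<beta>]) (auto simp: madd_assoc)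
  qed
qed

lemma monom_madd: "monom (madd \<alpha> \<beta>) x = monom \<alpha> x * monom \<beta> x"
  by (simp add: monom_def madd_def power_add prod.distrib)

lemma monom_mzero [simp]: "monom mzero x = 1"
  by (simp add: monom_def mzero_def)

lemma monom_munit: "monom (munit i) x = x $ i"
proof -
  have "monom (munit i) x = (\<Prod>k\<in>UNIV. if k = i then x $ k else 1)"
    unfolding monom_def munit_def by (intro prod.cong) auto
  then show ?thesis by simp
qed

text \<open>Polynomials act on moment sequences by shifts; this is the transpose of multiplication.\<close>

definition act :: "'n mpoly \<Rightarrow> 'n mpoly \<Rightarrow> 'n mpoly" where
  "act p y = (\<lambda>\<gamma>. \<Sum>\<beta>\<in>{\<beta>. p \<beta> \<noteq> 0}. p \<beta> * y (madd \<beta> \<gamma>))"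

lemma act_superset:
  assumes "finite A" "{\<beta>. p \<beta> \<noteq> 0} \<subseteq> A"
  shows "act p y \<gamma> = (\<Sum>\<beta>\<in>A. p \<beta> * y (madd \<beta> \<gamma>))"
  unfolding act_def using assms by (intro sum.mono_neutral_left) auto

lemma loc_mat_eq_act: "loc_mat k f y = mom_mat k (act f y)"
  by (simp add: loc_mat_def mom_mat_def act_def)

text \<open>Polynomials, encoded as operators on sequences: composition is multiplication, and
  \<open>T y mzero\<close> is the value of the functional \<open>y\<close> at the polynomial
  \<open>T\<close>. Products, squares and perturbations thereby need no coefficient
  arithmetic.\<close>

inductive_set shift_ops :: "('n mpoly \<Rightarrow> 'n mpoly) set" where
  shift: "(\<lambda>y \<gamma>. y (madd \<alpha> \<gamma>)) \<in> shift_ops"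
| scale: "T \<in> shift_ops \<Longrightarrow> (\<lambda>y \<gamma>. c * T y \<gamma>) \<in> shift_ops"
| add: "S \<in> shift_ops \<Longrightarrow> T \<in> shift_ops \<Longrightarrow> (\<lambda>y \<gamma>. S y \<gamma> + T y \<gamma>) \<in> shift_ops"

lemma shift_ops_id: "(\<lambda>y. y) \<in> shift_ops"
  using shift_ops.shift[of mzero] by simp

lemma shift_ops_comp_shift: "T \<in> shift_ops \<Longrightarrow> (\<lambda>y \<gamma>. T y (madd \<alpha> \<gamma>)) \<in> shift_ops"
proof (induction rule: shift_ops.induct)
  case (shift \<beta>)
  then show ?case using shift_ops.shift[of "madd \<beta> \<alpha>"] by (simp add: madd_assoc)
qed (auto intro: shift_ops.intros)

lemma shift_ops_comp: "S \<in> shift_ops \<Longrightarrow> T \<in> shift_ops \<Longrightarrow> (\<lambda>y. S (T y)) \<in> shift_ops"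
  by (induction rule: shift_ops.induct) (auto intro: shift_ops.intros shift_ops_comp_shift)

lemma shift_ops_linear:
  assumes "T \<in> shift_ops"
  shows "T (\<lambda>\<gamma>. u \<gamma> + v \<gamma>) = (\<lambda>\<gamma>. T u \<gamma> + T v \<gamma>)" "T (\<lambda>\<gamma>. c * u \<gamma>) = (\<lambda>\<gamma>. c * T u \<gamma>)"
    "T (\<lambda>\<gamma>. u (madd \<alpha> \<gamma>)) = (\<lambda>\<gamma>. T u (madd \<alpha> \<gamma>))"
  using assms by (induction rule: shift_ops.induct) (auto simp: algebra_simps madd_left_comm)

lemma shift_ops_commute: "S \<in> shift_ops \<Longrightarrow> T \<in> shift_ops \<Longrightarrow> S (T y) = T (S y)"
  by (induction rule: shift_ops.induct) (simp_all add: shift_ops_linear)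

lemma shift_ops_tendsto:
  assumes "T \<in> shift_ops" "\<And>\<gamma>. (\<lambda>n. ys n \<gamma>) \<longlonglongrightarrow> y \<gamma>"
  shows "(\<lambda>n. T (ys n) \<gamma>) \<longlonglongrightarrow> T y \<gamma>"
  using assms(1) by (induction arbitrary: \<gamma> rule: shift_ops.induct) (auto intro: assms(2) tendsto_intros)

lemma shift_ops_sum:
  assumes "finite A"
  shows "(\<lambda>y \<gamma>. \<Sum>\<alpha>\<in>A. c \<alpha> * y (madd \<alpha> \<gamma>)) \<in> shift_ops"
  using assms
proof (induction A rule: finite_induct)
  case empty
  show ?case using shift_ops.scale[OF shift_ops_id, of 0] by simp
next
  case (insert a A)
  then show ?case using shift_ops.add[OF shift_ops.scale[OF shift_ops.shift]] by simp
qed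

lemma act_in_shift_ops: "is_poly p \<Longrightarrow> act p \<in> shift_ops"
  unfolding act_def[abs_def] is_poly_def by (rule shift_ops_sum)

lemma shift_ops_repr:
  fixes T :: "'n::finite mpoly \<Rightarrow> 'n mpoly"
  assumes "T \<in> shift_ops"
  shows "\<exists>k c. \<forall>y \<gamma>. T y \<gamma> = (\<Sum>\<alpha>\<in>Mon k. c \<alpha> * y (madd \<alpha> \<gamma>))"
  using assms
proof (induction rule: shift_ops.induct)
  case (shift \<alpha>)
  have "y (madd \<alpha> \<gamma>) = (\<Sum>\<beta>\<in>Mon (mdeg \<alpha>). (if \<beta> = \<alpha> then 1 else 0) * y (madd \<beta> \<gamma>))" for y :: "'n mpoly" and \<gamma>
  proof -
    have "(\<Sum>\<beta>\<in>Mon (mdeg \<alpha>). (if \<beta> = \<alpha> then 1 else 0) * y (madd \<beta> \<gamma>)) =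
       (\<Sum>\<beta>\<in>Mon (mdeg \<alpha>). if \<beta> = \<alpha> then y (madd \<beta> \<gamma>) else 0)"
      by (intro sum.cong) auto
    moreover have "\<alpha> \<in> Mon (mdeg \<alpha>)" by (simp add: Mon_def)
    ultimately show ?thesis by simp
  qed
  then show ?case
    by (intro exI[of _ "mdeg \<alpha>"] exI[of _ "\<lambda>\<beta>. if \<beta> = \<alpha> then 1 else 0"]) auto
next
  case (scale T c)
  then obtain k d where "\<forall>y \<gamma>. T y \<gamma> = (\<Sum>\<alpha>\<in>Mon k. d \<alpha> * y (madd \<alpha> \<gamma>))" by blast
  then show ?case by (intro exI[of _ k] exI[of _ "\<lambda>\<alpha>. c * d \<alpha>"]) (simp add: sum_distrib_left mult.assoc)
next
  case (add S T)
  from add.IH(1) obtain k c where S: "\<forall>y \<gamma>. S y \<gamma> = (\<Sum>\<alpha>\<in>Mon k. c \<alpha> * y (madd \<alpha> \<gamma>))"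
    by (elim exE) (rule that)
  from add.IH(2) obtain l d where T: "\<forall>y \<gamma>. T y \<gamma> = (\<Sum>\<alpha>\<in>Mon l. d \<alpha> * y (madd \<alpha> \<gamma>))"
    by (elim exE) (rule that)
  \<comment> \<open>The two representations are padded with zero coefficients to a common degree
    bound before they are added.\<close>
  have ext: "(\<Sum>\<alpha>\<in>Mon k. c \<alpha> * y (madd \<alpha> \<gamma>)) =
      (\<Sum>\<alpha>\<in>Mon (k + l). (if \<alpha> \<in> Mon k then c \<alpha> else 0) * y (madd \<alpha> \<gamma>))"
    if "k \<le> k + l" for k l and c :: "'n mexp \<Rightarrow> real" and y :: "'n mpoly" and \<gamma>
  proof (rule sum.mono_neutral_cong_left)
    show "Mon k \<subseteq> Mon (k + l)" by (auto simp: Mon_def)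
  qed simp_all
  have "S y \<gamma> + T y \<gamma> = (\<Sum>\<alpha>\<in>Mon (k + l).
     ((if \<alpha> \<in> Mon k then c \<alpha> else 0) + (if \<alpha> \<in> Mon l then d \<alpha> else 0)) * y (madd \<alpha> \<gamma>))" for y \<gamma>
    unfolding S[rule_format] T[rule_format] ext[of k l, OF le_add1] ext[of l k, OF le_add1] add.commute[of l k]
    by (simp only: distrib_right sum.distrib)
  then show ?case
    by (intro exI[of _ "k + l"] exI[of _ "\<lambda>\<alpha>. (if \<alpha> \<in> Mon k then c \<alpha> else 0) + (if \<alpha> \<in> Mon l then d \<alpha> else 0)"] allI)
qed

section \<open>States and their faces\<close>

definition psd_seq :: "'n::finite mpoly \<Rightarrow> bool" where
  "psd_seq y \<longleftrightarrow> (\<forall>k. psd_on (Mon k) (mom_mat k y))"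

lemma sym_on_mom_mat [simp]: "sym_on I (mom_mat k y)"
  by (simp add: sym_on_def mom_mat_def madd_comm)

text \<open>\<open>T (T y) mzero\<close> is the functional at the square of a polynomial, that is,
  the quadratic form of a moment matrix at its coefficient vector.\<close>

lemma psd_seq_iff: "psd_seq y \<longleftrightarrow> (\<forall>T\<in>shift_ops. 0 \<le> T (T y) mzero)"
proof
  assume psd: "psd_seq y"
  show "\<forall>T\<in>shift_ops. 0 \<le> T (T y) mzero"
  proof
    fix T :: "'a mpoly \<Rightarrow> 'a mpoly" assume "T \<in> shift_ops"
    then obtain k c where T: "\<And>y \<gamma>. T y \<gamma> = (\<Sum>\<alpha>\<in>Mon k. c \<alpha> * y (madd \<alpha> \<gamma>))"
      using shift_ops_repr by blast
    have "T (T y) mzero = (\<Sum>\<alpha>\<in>Mon k. \<Sum>\<beta>\<in>Mon k. c \<alpha> * mom_mat k y \<alpha> \<beta> * c \<beta>)"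
      by (simp add: T[of "T y"] T[of y] mom_mat_def sum_distrib_left mult_ac madd_comm)
    then show "0 \<le> T (T y) mzero" using psd by (simp add: psd_seq_def psd_on_def)
  qed
next
  assume pos: "\<forall>T\<in>shift_ops. 0 \<le> T (T y) mzero"
  have "0 \<le> (\<Sum>\<alpha>\<in>Mon k. \<Sum>\<beta>\<in>Mon k. v \<alpha> * mom_mat k y \<alpha> \<beta> * v \<beta>)" for k v
  proof -
    have "0 \<le> (\<Sum>\<alpha>\<in>Mon k. v \<alpha> * (\<Sum>\<beta>\<in>Mon k. v \<beta> * y (madd \<beta> (madd \<alpha> mzero))))"
      using bspec[OF pos shift_ops_sum[OF finite_Mon[of k], of v]] .
    then show ?thesis by (simp add: mom_mat_def sum_distrib_left mult_ac madd_comm)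
  qed
  then show "psd_seq y" by (simp add: psd_seq_def psd_on_def)
qed

text \<open>The normalised linear functionals that are nonnegative on the quadratic module generated
  by the \<open>g j\<close>.\<close>

definition states :: "nat \<Rightarrow> (nat \<Rightarrow> 'n::finite mpoly) \<Rightarrow> 'n mpoly set" where
  "states m g = {y. y mzero = 1 \<and> psd_seq y \<and> (\<forall>j<m. psd_seq (act (g j) y))}"

definition localized :: "('n mpoly \<Rightarrow> 'n mpoly) \<Rightarrow> 'n mpoly \<Rightarrow> 'n mpoly" where
  "localized h y = (\<lambda>\<gamma>. (1 / h (h y) mzero) * h (h y) \<gamma>)"

text \<open>Localization is multiplication by a normalised square; closure under it is what allows a minimiser
  to be perturbed by squares without leaving the face.\<close>

definition state_face :: "nat \<Rightarrow> (nat \<Rightarrow> 'n::finite mpoly) \<Rightarrow> 'n mpoly set \<Rightarrow> bool" where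
  "state_face m g F \<longleftrightarrow> F \<subseteq> states m g \<and> F \<noteq> {} \<and>
     (\<forall>ys y. (\<forall>n. ys n \<in> F) \<longrightarrow> (\<forall>\<gamma>. (\<lambda>n. ys n \<gamma>) \<longlonglongrightarrow> y \<gamma>) \<longrightarrow> y \<in> F) \<and>
     (\<forall>y\<in>F. \<forall>h\<in>shift_ops. 0 < h (h y) mzero \<longrightarrow> localized h y \<in> F)"

lemma state_faceD:
  assumes "state_face m g F"
  shows "F \<subseteq> states m g" "\<exists>z. z \<in> F"
    "\<And>y h. y \<in> F \<Longrightarrow> h \<in> shift_ops \<Longrightarrow> 0 < h (h y) mzero \<Longrightarrow> localized h y \<in> F"
  using assms unfolding state_face_def by blast+

lemma psd_seq_tendsto:
  assumes "\<And>n. psd_seq (ys n)" "\<And>\<gamma>. (\<lambda>n. ys n \<gamma>) \<longlonglongrightarrow> y \<gamma>"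
  shows "psd_seq y"
  unfolding psd_seq_iff
proof
  fix T :: "'a mpoly \<Rightarrow> 'a mpoly" assume T: "T \<in> shift_ops"
  have "(\<lambda>n. T (T (ys n)) mzero) \<longlonglongrightarrow> T (T y) mzero"
    by (rule shift_ops_tendsto[OF shift_ops_comp[OF T T] assms(2)])
  then show "0 \<le> T (T y) mzero"
    by (rule LIMSEQ_le_const) (use assms(1) T in \<open>auto simp: psd_seq_iff\<close>)
qed

text \<open>By commutativity T^2 h^2 = (T h)^2, so a square times a square is again a
  square.\<close>

lemma psd_seq_localized:
  assumes y: "psd_seq y" and h: "h \<in> shift_ops" and c: "0 \<le> c"
  shows "psd_seq (\<lambda>\<gamma>. c * h (h y) \<gamma>)"
  unfolding psd_seq_iff
proof
  fix T :: "'a mpoly \<Rightarrow> 'a mpoly" assume T: "T \<in> shift_ops"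
  have "T (h (T (h y))) = T (T (h (h y)))"
    using shift_ops_commute[OF h T, of "h y"] by simp
  moreover have "0 \<le> T (h (T (h y))) mzero"
    using bspec[OF y[unfolded psd_seq_iff] shift_ops_comp[OF T h]] .
  ultimately show "0 \<le> T (T (\<lambda>\<gamma>. c * h (h y) \<gamma>)) mzero"
    using c by (simp add: shift_ops_linear[OF T])
qed

lemma state_face_states:
  assumes g: "\<And>j. j < m \<Longrightarrow> is_poly (g j)" and ne: "states m g \<noteq> {}"
  shows "state_face m g (states m g)"
  unfolding state_face_def
proof (intro conjI allI impI ballI)
  fix ys :: "nat \<Rightarrow> 'a mpoly" and y assume ys: "\<forall>n. ys n \<in> states m g" and lim: "\<forall>\<gamma>. (\<lambda>n. ys n \<gamma>) \<longlonglongrightarrow> y \<gamma>"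
  have ysD: "ys n mzero = 1" "psd_seq (ys n)" "j < m \<Longrightarrow> psd_seq (act (g j) (ys n))" for n j
    using ys by (simp_all add: states_def)
  have "(\<lambda>n. ys n mzero) \<longlonglongrightarrow> y mzero" using lim by blast
  then have "y mzero = 1" by (simp add: ysD(1) LIMSEQ_const_iff)
  moreover have "psd_seq y" by (rule psd_seq_tendsto[OF ysD(2) lim[rule_format]])
  moreover have "psd_seq (act (g j) y)" if "j < m" for j
    by (rule psd_seq_tendsto[OF ysD(3)[OF that] shift_ops_tendsto[OF act_in_shift_ops[OF g[OF that]] lim[rule_format]]])
  ultimately show "y \<in> states m g" by (simp add: states_def)
next
  fix y h assume y: "y \<in> states m g" and h: "h \<in> shift_ops" "0 < h (h y) mzero"
  have "psd_seq (act (g j) (localized h y))" if j: "j < m" for j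
  proof -
    have gj: "act (g j) \<in> shift_ops" by (rule act_in_shift_ops[OF g[OF j]])
    have "act (g j) (localized h y) = (\<lambda>\<gamma>. (1 / h (h y) mzero) * h (h (act (g j) y)) \<gamma>)"
      unfolding localized_def shift_ops_linear(2)[OF gj] shift_ops_commute[OF gj h(1)] ..
    moreover have "psd_seq (act (g j) y)" using y j by (simp add: states_def)
    ultimately show ?thesis using psd_seq_localized[OF _ h(1), of "act (g j) y" "1 / h (h y) mzero"] h(2) by simp
  qed
  then show "localized h y \<in> states m g"
    using y h(2) psd_seq_localized[OF _ h(1), of y "1 / h (h y) mzero"] by (simp add: states_def localized_def)
qed (use ne in auto)

text \<open>\<open>F'\<close> consists of the minimisers of \<open>a\<close> on \<open>F\<close>.
  Closure under localization extends the minimality of \<open>c\<close> to all squares, c h^2 \<le>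
  a h^2. At a minimiser this is an equality for h = 1, so its first variation along h = 1 + t v
  vanishes: \<open>a\<close> acts as the scalar \<open>c\<close>. This in turn makes
  \<open>F'\<close> a face, so the minimisation can be repeated.\<close>

lemma state_face_minimise:
  fixes g :: "nat \<Rightarrow> 'n::finite mpoly"
  assumes F: "state_face m g F" and bnd: "\<forall>y\<in>F. \<forall>\<gamma>. \<bar>y \<gamma>\<bar> \<le> C \<gamma>" and a: "a \<in> shift_ops"
  shows "\<exists>F' c. state_face m g F' \<and> F' \<subseteq> F \<and> (\<forall>y\<in>F. c \<le> a y mzero) \<and>
    (\<forall>y\<in>F'. \<forall>v\<in>shift_ops. v (a y) mzero = c * v y mzero)"
proof -
  obtain k d where d: "\<And>y \<gamma>. a y \<gamma> = (\<Sum>\<alpha>\<in>Mon k. d \<alpha> * y (madd \<alpha> \<gamma>))"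
    using shift_ops_repr[OF a] by blast
  have "- (\<Sum>\<alpha>\<in>Mon k. \<bar>d \<alpha>\<bar> * C \<alpha>) \<le> a y mzero" if "y \<in> F" for y
  proof -
    have "- (\<bar>d \<alpha>\<bar> * C \<alpha>) \<le> d \<alpha> * y \<alpha>" for \<alpha>
    proof -
      have "\<bar>d \<alpha> * y \<alpha>\<bar> \<le> \<bar>d \<alpha>\<bar> * C \<alpha>" using bnd that by (simp add: abs_mult mult_left_mono)
      then show ?thesis by linarith
    qed
    then show ?thesis unfolding d sum_negf[symmetric] by (simp add: sum_mono)
  qed
  then have bdd: "bdd_below ((\<lambda>y. a y mzero) ` F)" by (auto intro!: bdd_belowI)
  define c where "c = (INF y\<in>F. a y mzero)"
  have ne: "F \<noteq> {}" using F by (simp add: state_face_def)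
  have c: "c \<le> a y mzero" if "y \<in> F" for y unfolding c_def by (rule cINF_lower[OF bdd that])
  have "\<exists>y\<in>F. a y mzero < c + 1 / real (Suc n)" for n
  proof (rule ccontr)
    assume "\<not> ?thesis"
    then have "c + 1 / real (Suc n) \<le> c"
      unfolding c_def by (intro cINF_greatest ne) (auto simp: not_less)
    moreover have "0 < 1 / real (Suc n)" by simp
    ultimately show False by linarith
  qed
  then obtain ys where ys: "\<And>n. ys n \<in> F" "\<And>n. a (ys n) mzero < c + 1 / real (Suc n)" by metis
  obtain r z where r: "strict_mono (r :: nat \<Rightarrow> nat)" "\<And>\<gamma>. (\<lambda>n. ys (r n) \<gamma>) \<longlonglongrightarrow> z \<gamma>"
    using pointwise_bounded_convergent_subseq[of ys C] bnd ys(1) by blast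
  have F_closed: "y \<in> F" if "\<And>n. ys n \<in> F" "\<And>\<gamma>. (\<lambda>n. ys n \<gamma>) \<longlonglongrightarrow> y \<gamma>" for ys y
    using F that unfolding state_face_def by blast
  have z: "z \<in> F" by (rule F_closed[of "\<lambda>n. ys (r n)"]) (use ys(1) r(2) in auto)
  have "(\<lambda>n. a (ys (r n)) mzero) \<longlonglongrightarrow> a z mzero" by (rule shift_ops_tendsto[OF a r(2)])
  moreover have "(\<lambda>n. a (ys (r n)) mzero) \<longlonglongrightarrow> c"
  proof (rule tendsto_sandwich[OF always_eventually always_eventually tendsto_const])
    show "(\<lambda>n. c + 1 / real (Suc (r n))) \<longlonglongrightarrow> c"
      using LIMSEQ_subseq_LIMSEQ[OF LIMSEQ_inverse_real_of_nat r(1)]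
        tendsto_add[OF tendsto_const, of _ 0 sequentially c] by (simp add: o_def inverse_eq_divide)
  qed (use ys c in \<open>auto intro: less_imp_le\<close>)
  ultimately have az: "a z mzero = c" by (rule LIMSEQ_unique)
  define F' where "F' = {y \<in> F. a y mzero = c}"
  have min: "c * h (h y) mzero \<le> a (h (h y)) mzero" if y: "y \<in> F" and h: "h \<in> shift_ops" for y h
  proof (cases "0 < h (h y) mzero")
    case True
    then have "localized h y \<in> F" by (rule state_faceD(3)[OF F y h])
    then have "c \<le> a (localized h y) mzero" by (rule c)
    then show ?thesis using True unfolding localized_def shift_ops_linear(2)[OF a] by (simp add: field_simps)
  next
    case False
    have psd: "psd_seq y" using subsetD[OF state_faceD(1)[OF F] y] by (simp add: states_def)
    then have "0 \<le> h (h y) mzero" using h by (simp add: psd_seq_iff)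
    then have h0: "h (h y) mzero = 0" using False by simp
    \<comment> \<open>A square of mass 0 cannot be normalised. Instead, positivity of (h + t a h)^2
      for all t shows that a h^2 has mass 0 as well.\<close>
    have "0 \<le> 2 * t * a (h (h y)) mzero + t\<^sup>2 * a (h (a (h y))) mzero" for t
    proof -
      have ah: "(\<lambda>y. a (h y)) \<in> shift_ops" by (rule shift_ops_comp[OF a h])
      have T: "(\<lambda>y \<gamma>. h y \<gamma> + t * a (h y) \<gamma>) \<in> shift_ops"
        by (rule shift_ops.add[OF h shift_ops.scale[OF ah]])
      show ?thesis
        using psd[unfolded psd_seq_iff, rule_format, OF T] h0 shift_ops_commute[OF h a, of "h y"]
        by (simp add: shift_ops_linear(1,2)[OF h] shift_ops_linear(1,2)[OF a] algebra_simps power2_eq_square)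
    qed
    then have "a (h (h y)) mzero = 0" by (rule quadratic_nonneg_imp_linear_zero)
    then show ?thesis using h0 by simp
  qed
  have key: "v (a y) mzero = c * v y mzero" if y: "y \<in> F'" and v: "v \<in> shift_ops" for y v
  proof -
    have yF: "y \<in> F" "a y mzero = c" using y by (auto simp: F'_def)
    have y0: "y mzero = 1" using subsetD[OF state_faceD(1)[OF F] yF(1)] by (simp add: states_def)
    \<comment> \<open>The inequality \<open>min\<close> for the square of 1 + t v; its constant term
      is 0 because \<open>y\<close> is a minimiser.\<close>
    have "0 \<le> 2 * t * (a (v y) mzero - c * v y mzero) + t\<^sup>2 * (a (v (v y)) mzero - c * v (v y) mzero)" for t
    proof -
      have T: "(\<lambda>y \<gamma>. y \<gamma> + t * v y \<gamma>) \<in> shift_ops"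
        by (rule shift_ops.add[OF shift_ops_id shift_ops.scale[OF v]])
      show ?thesis
        using min[OF yF(1) T] yF(2) y0
        by (simp add: shift_ops_linear(1,2)[OF v] shift_ops_linear(1,2)[OF a] algebra_simps power2_eq_square)
    qed
    then have "a (v y) mzero - c * v y mzero = 0" by (rule quadratic_nonneg_imp_linear_zero)
    then show ?thesis using shift_ops_commute[OF v a] by simp
  qed
  have "state_face m g F'"
    unfolding state_face_def
  proof (intro conjI allI impI ballI)
    show "F' \<subseteq> states m g" using state_faceD(1)[OF F] by (auto simp: F'_def)
    show "F' \<noteq> {}" using z az by (auto simp: F'_def)
    fix ys :: "nat \<Rightarrow> 'n mpoly" and y assume ys: "\<forall>n. ys n \<in> F'" and lim: "\<forall>\<gamma>. (\<lambda>n. ys n \<gamma>) \<longlonglongrightarrow> y \<gamma>"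
    have "y \<in> F" by (rule F_closed[of ys]) (use ys lim in \<open>auto simp: F'_def\<close>)
    moreover have "(\<lambda>n. a (ys n) mzero) \<longlonglongrightarrow> a y mzero" using lim by (intro shift_ops_tendsto[OF a]) auto
    then have "a y mzero = c" using ys by (simp add: F'_def LIMSEQ_const_iff)
    ultimately show "y \<in> F'" by (simp add: F'_def)
  next
    fix y h assume y: "y \<in> F'" and h: "h \<in> shift_ops" "0 < h (h y) mzero"
    have "localized h y \<in> F" by (rule state_faceD(3)[OF F]) (use y h in \<open>auto simp: F'_def\<close>)
    \<comment> \<open>As \<open>a\<close> acts on \<open>y\<close> by the scalar \<open>c\<close>,
      reweighting by a square does not change its value.\<close>
    moreover have "a (h (h y)) mzero = c * h (h y) mzero"
      using key[OF y shift_ops_comp[OF h(1) h(1)]] shift_ops_commute[OF a h(1)] by simp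
    then have "a (localized h y) mzero = c"
      using h(2) unfolding localized_def shift_ops_linear(2)[OF a] by simp
    ultimately show "localized h y \<in> F'" by (simp add: F'_def)
  qed
  show ?thesis
  proof (intro exI[of _ F'] exI[of _ c] conjI ballI)
    show "F' \<subseteq> F" by (auto simp: F'_def)
  qed (fact c key \<open>state_face m g F'\<close>)+
qed

text \<open>The functional form of Putinar's theorem: successively minimising \<open>p\<close> and the coordinates
  over the states ends in a multiplicative functional, that is, in evaluation at a point of the set.\<close>

theorem states_nonneg_on_semialg:
  fixes g :: "nat \<Rightarrow> 'n::finite mpoly"
  assumes g: "\<And>j. j < m \<Longrightarrow> is_poly (g j)" and bnd: "\<forall>y\<in>states m g. \<forall>\<gamma>. \<bar>y \<gamma>\<bar> \<le> C \<gamma>"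
    and p: "is_poly p" and lower: "\<And>x. x \<in> semialg m g \<Longrightarrow> c \<le> peval p x" and y: "y \<in> states m g"
  shows "c \<le> act p y mzero"
proof -
  have "state_face m g (states m g)" by (rule state_face_states) (use g y in auto)
  from state_face_minimise[OF this bnd act_in_shift_ops[OF p]]
  obtain F c0 where F: "state_face m g F" "F \<subseteq> states m g" "\<forall>y\<in>states m g. c0 \<le> act p y mzero"
     "\<forall>y\<in>F. \<forall>v\<in>shift_ops. v (act p y) mzero = c0 * v y mzero"
    by (elim exE conjE) (rule that)
  \<comment> \<open>Scalars fixed earlier survive later minimisations because the faces only shrink;
    in particular \<open>p\<close> keeps its minimal value \<open>c0\<close>.\<close>
  have "\<exists>F' \<xi>. state_face m g F' \<and> F' \<subseteq> F \<and>
    (\<forall>i\<in>A. \<forall>y\<in>F'. \<forall>v\<in>shift_ops. v (\<lambda>\<gamma>. y (madd (munit i) \<gamma>)) mzero = \<xi> i * v y mzero)"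
    if "finite A" for A :: "'n set"
    using that
  proof (induction A rule: finite_induct)
    case empty
    show ?case using F(1) by (intro exI[of _ F]) simp
  next
    case (insert i A)
    from insert.IH obtain F' \<xi> where F': "state_face m g F'" "F' \<subseteq> F"
      and \<xi>: "\<forall>i\<in>A. \<forall>y\<in>F'. \<forall>v\<in>shift_ops. v (\<lambda>\<gamma>. y (madd (munit i) \<gamma>)) mzero = \<xi> i * v y mzero"
      by (elim exE conjE) (rule that)
    have bnd': "\<forall>y\<in>F'. \<forall>\<gamma>. \<bar>y \<gamma>\<bar> \<le> C \<gamma>"
      by (rule ballI, rule bspec[OF bnd], rule subsetD[OF state_faceD(1)[OF F'(1)]])
    from state_face_minimise[OF F'(1) bnd' shift_ops.shift[of "munit i"]]
    obtain F'' c where F'': "state_face m g F''" "F'' \<subseteq> F'" "\<forall>y\<in>F'. c \<le> y (madd (munit i) mzero)"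
      and c: "\<forall>y\<in>F''. \<forall>v\<in>shift_ops. v (\<lambda>\<gamma>. y (madd (munit i) \<gamma>)) mzero = c * v y mzero"
      by (elim exE conjE) (rule that)
    have "v (\<lambda>\<gamma>. y (madd (munit l) \<gamma>)) mzero = (\<xi>(i := c)) l * v y mzero"
      if "l \<in> insert i A" "y \<in> F''" "v \<in> shift_ops" for l y v
    proof (cases "l = i")
      case True
      then show ?thesis using c that by simp
    next
      case False
      then have "l \<in> A" "y \<in> F'" using that F''(2) by auto
      then show ?thesis using \<xi> that(3) False by simp
    qed
    moreover have "F'' \<subseteq> F" using F'(2) F''(2) by blast
    ultimately show ?case using F''(1) by (intro exI[of _ F''] exI[of _ "\<xi>(i := c)"] conjI ballI)
  qed
  from this[OF finite[of UNIV]] obtain F' \<xi> where F': "state_face m g F'" "F' \<subseteq> F" and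
    \<xi>: "\<forall>i\<in>UNIV. \<forall>y\<in>F'. \<forall>v\<in>shift_ops. v (\<lambda>\<gamma>. y (madd (munit i) \<gamma>)) mzero = \<xi> i * v y mzero"
    by (elim exE conjE) (rule that)
  obtain z where z: "z \<in> F'" using state_faceD(2)[OF F'(1)] by (rule exE)
  have zs: "z \<in> states m g" by (rule subsetD[OF state_faceD(1)[OF F'(1)] z])
  define x where "x = (\<chi> i. \<xi> i)"
  \<comment> \<open>All coordinates now act as scalars, so the functional is multiplicative and its
    scalars are the coordinates of a point.\<close>
  have z_eq: "z \<alpha> = monom \<alpha> x" for \<alpha>
  proof (induction "mdeg \<alpha>" arbitrary: \<alpha>)
    case 0
    then show ?case using zs by (simp add: mdeg_eq_0_iff states_def)
  next
    case (Suc n)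
    then have "\<alpha> \<noteq> mzero" by auto
    then obtain i \<beta> where \<alpha>: "\<alpha> = madd (munit i) \<beta>" "mdeg \<alpha> = Suc (mdeg \<beta>)" by (rule munit_split)
    have "z \<alpha> = \<xi> i * z \<beta>"
      using bspec[OF bspec[OF bspec[OF \<xi> UNIV_I[of i]] z] shift_ops.shift[of \<beta>]] \<alpha>(1) by simp
    then show ?case using Suc \<alpha> by (simp add: monom_madd monom_munit x_def)
  qed
  have act_z: "act f z mzero = peval f x" for f
    by (simp add: act_def peval_def z_eq)
  \<comment> \<open>Positivity of the localized sequence at the square of the constant 1 places the
    point in the set.\<close>
  have "0 \<le> peval (g j) x" if "j < m" for j
  proof -
    have "psd_seq (act (g j) z)" using zs that by (simp add: states_def)
    from this[unfolded psd_seq_iff, rule_format, OF shift_ops_id] show ?thesis by (simp add: act_z)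
  qed
  then have "c \<le> peval p x" using lower by (simp add: semialg_def)
  also have "\<dots> = c0"
    using bspec[OF bspec[OF F(4) subsetD[OF F'(2) z]] shift_ops_id] zs act_z[of p] by (simp add: states_def)
  also have "\<dots> \<le> act p y mzero" using F(3) y by simp
  finally show ?thesis .
qed

section \<open>Moment sequences, relaxations and sums of squares\<close>

lemma psd_on_subset:
  assumes "finite J" "I \<subseteq> J" "psd_on J A"
  shows "psd_on I A"
  unfolding psd_on_def
proof (intro conjI allI)
  show "sym_on I A" using assms by (auto simp: psd_on_def sym_on_def)
  fix v :: "'a \<Rightarrow> real"
  define u where "u i = (if i \<in> I then v i else 0)" for i
  have "0 \<le> (\<Sum>i\<in>J. \<Sum>j\<in>J. u i * A i j * u j)" using assms(3) by (simp add: psd_on_def)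
  also have "\<dots> = (\<Sum>i\<in>I. \<Sum>j\<in>J. u i * A i j * u j)"
    using assms(1,2) by (intro sum.mono_neutral_right) (auto simp: u_def)
  also have "\<dots> = (\<Sum>i\<in>I. \<Sum>j\<in>I. u i * A i j * u j)"
    using assms(1,2) by (intro sum.cong refl sum.mono_neutral_right) (auto simp: u_def)
  also have "\<dots> = (\<Sum>i\<in>I. \<Sum>j\<in>I. v i * A i j * v j)" by (simp add: u_def)
  finally show "0 \<le> (\<Sum>i\<in>I. \<Sum>j\<in>I. v i * A i j * v j)" .
qed

lemma psd_on_minor:
  assumes psd: "psd_on I A" and fin: "finite I" and ij: "i \<in> I" "j \<in> I"
  shows "0 \<le> A i i" "(A i j)\<^sup>2 \<le> A i i * A j j"
proof -
  have sym: "A j i = A i j" using psd ij by (simp add: psd_on_def sym_on_def)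
  have quad: "0 \<le> s * s * A i i + 2 * s * t * A i j + t * t * A j j" for s t
  proof -
    \<comment> \<open>The sum of two indicators rather than a case distinction, so that i = j is
      allowed.\<close>
    define v where "v k = (if k = i then s else 0) + (if k = j then t else 0)" for k
    have v: "(\<Sum>k\<in>I. v k * f k) = s * f i + t * f j" for f
    proof -
      have "v k * f k = (if k = i then s * f k else 0) + (if k = j then t * f k else 0)" for k
        by (simp add: v_def algebra_simps)
      then show ?thesis using fin ij by (simp add: sum.distrib)
    qed
    have "0 \<le> (\<Sum>k\<in>I. \<Sum>l\<in>I. v k * A k l * v l)" using psd by (simp add: psd_on_def)
    also have "\<dots> = (\<Sum>k\<in>I. v k * (\<Sum>l\<in>I. v l * A k l))" by (simp add: sum_distrib_left mult_ac)
    finally show ?thesis unfolding v by (simp add: sym algebra_simps)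
  qed
  show Aii: "0 \<le> A i i" using quad[of 1 0] by simp
  show "(A i j)\<^sup>2 \<le> A i i * A j j"
  proof (cases "A j j = 0")
    case True
    have "0 \<le> 2 * s * A i j + s\<^sup>2 * A i i" for s
      using quad[of s 1] True by (simp add: power2_eq_square)
    then have "A i j = 0" by (rule quadratic_nonneg_imp_linear_zero)
    then show ?thesis using True by simp
  next
    case False
    have "0 \<le> A j j" using quad[of 0 1] by simp
    then have pos: "0 < A j j" using False by simp
    have "0 \<le> A j j * (A i i * A j j - (A i j)\<^sup>2)"
      using quad[of "A j j" "- A i j"] by (simp add: power2_eq_square algebra_simps)
    then show ?thesis using pos by (simp add: zero_le_mult_iff)
  qed
qed

lemma munit_inj: "madd (munit i) (munit i) = madd (munit k) (munit k) \<Longrightarrow> i = k"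
  by (drule fun_cong[where x = i]) (simp add: madd_def munit_def split: if_splits)

lemma double_munit: "madd (munit i) (munit i) = (\<lambda>k. if k = i then 2 else 0)"
  by (rule ext) (simp add: madd_def munit_def)

lemma double_munit_neq_mzero: "madd (munit i) (munit i) \<noteq> mzero"
proof
  assume "madd (munit i) (munit i) = mzero"
  from fun_cong[OF this, of i] show False by (simp add: madd_def munit_def mzero_def)
qed

lemma ball_poly_double_munit: "ball_poly R (madd (munit i) (munit i)) = -1"
proof -
  have "\<exists>l. madd (munit i) (munit i) = (\<lambda>k. if k = l then 2 else 0)"
    by (rule exI[of _ i], rule double_munit)
  then show ?thesis unfolding ball_poly_def by (simp only: double_munit_neq_mzero if_False if_True)
qed

lemma ball_poly_support: "{\<gamma>. ball_poly R \<gamma> \<noteq> 0} \<subseteq> insert mzero (range (\<lambda>i. madd (munit i) (munit i)))"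
proof
  fix \<gamma> :: "'a mexp" assume "\<gamma> \<in> {\<gamma>. ball_poly R \<gamma> \<noteq> 0}"
  then have "\<gamma> = mzero \<or> (\<exists>i. \<gamma> = (\<lambda>k. if k = i then 2 else 0))"
    unfolding ball_poly_def mem_Collect_eq by presburger
  then show "\<gamma> \<in> insert mzero (range (\<lambda>i. madd (munit i) (munit i)))"
    unfolding double_munit by blast
qed

lemma act_ball_poly:
  fixes y :: "'n::finite mpoly"
  shows "act (ball_poly R) y \<gamma> = R\<^sup>2 * y \<gamma> - (\<Sum>i\<in>UNIV. y (madd (madd (munit i) (munit i)) \<gamma>))"
proof -
  let ?e = "\<lambda>i::'n. madd (munit i) (munit i)"
  have nin: "mzero \<notin> range ?e" 
    by (rule notI, erule rangeE) (simp add: double_munit_neq_mzero[symmetric])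
  \<comment> \<open>The sum runs over a superset of the support, because the constant coefficient
    \<open>R\<^sup>2\<close> may be 0.\<close>
  have "act (ball_poly R) y \<gamma> = (\<Sum>\<beta>\<in>insert mzero (range ?e). ball_poly R \<beta> * y (madd \<beta> \<gamma>))"
    by (rule act_superset[OF _ ball_poly_support]) simp
  also have "\<dots> = ball_poly R (mzero :: 'n mexp) * y \<gamma> + (\<Sum>\<beta>\<in>range ?e. ball_poly R \<beta> * y (madd \<beta> \<gamma>))"
    using nin by simp
  also have "(\<Sum>\<beta>\<in>range ?e. ball_poly R \<beta> * y (madd \<beta> \<gamma>)) = (\<Sum>i\<in>UNIV. ball_poly R (?e i) * y (madd (?e i) \<gamma>))"
    by (subst sum.reindex) (auto intro!: inj_onI munit_inj)
  also have "\<dots> = - (\<Sum>i\<in>UNIV. y (madd (?e i) \<gamma>))"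
    by (simp add: ball_poly_double_munit sum_negf)
  finally show ?thesis by (simp add: ball_poly_def)
qed

lemma poly_deg_ball_poly: "poly_deg (ball_poly R :: 'n::finite mpoly) = 2"
proof -
  let ?S = "{mdeg \<alpha> | \<alpha>. (ball_poly R :: 'n mpoly) \<alpha> \<noteq> 0} \<union> {0}"
  have sub: "?S \<subseteq> {0, 2}" using ball_poly_support[of R] by fastforce
  have "(ball_poly R :: 'n mpoly) (madd (munit undefined) (munit undefined)) \<noteq> 0"
    by (simp add: ball_poly_double_munit)
  then have "mdeg (madd (munit undefined) (munit undefined) :: 'n mexp) \<in> ?S" by blast
  then have "2 \<in> ?S" by (simp only: mdeg_madd mdeg_munit one_add_one)
  moreover have "finite ?S" by (rule finite_subset[OF sub]) simp
  moreover have "k \<le> 2" if "k \<in> ?S" for k using subsetD[OF sub that] by auto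
  ultimately show ?thesis unfolding poly_deg_def by (intro Max_eqI)
qed

lemma vj_ball_poly [simp]: "vj (ball_poly R) = 1"
  by (simp add: vj_def poly_deg_ball_poly)

text \<open>A diagonal entry of the localizing matrix bounds the sum of all y_(2\<gamma>+2e_l) by
  R^2 y_(2\<gamma>). The summands are diagonal moments and hence nonnegative, so even moments are
  bounded by induction on the degree; the minor with the constant row then bounds y_\<alpha> by the
  root of y_(2\<alpha>). Passing through 2\<alpha> is why the bound stops at degree
  \<open>K\<close>.\<close>

lemma ball_moment_bound:
  fixes y :: "'n::finite mpoly"
  assumes y0: "y mzero = 1" and M: "psd_on (Mon K) (mom_mat K y)"
    and L: "0 < K \<Longrightarrow> psd_on (Mon (K - 1)) (loc_mat (K - 1) (ball_poly R) y)"
    and \<alpha>: "mdeg \<alpha> \<le> K"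
  shows "\<bar>y \<alpha>\<bar> \<le> \<bar>R\<bar> ^ mdeg \<alpha>"
proof -
  have diag: "0 \<le> y (madd \<beta> \<beta>)" if "mdeg \<beta> \<le> K" for \<beta>
    using psd_on_minor(1)[OF M finite_Mon, of \<beta> \<beta>] that by (simp add: Mon_def mom_mat_def)
  have sq: "y (madd \<beta> \<beta>) \<le> (R\<^sup>2) ^ mdeg \<beta>" if "mdeg \<beta> \<le> K" for \<beta>
    using that
  proof (induction "mdeg \<beta>" arbitrary: \<beta>)
    case 0
    then show ?case using y0 by (simp add: mdeg_eq_0_iff)
  next
    case (Suc k)
    then have "\<beta> \<noteq> mzero" by auto
    then obtain i \<gamma> where \<gamma>: "\<beta> = madd (munit i) \<gamma>" "mdeg \<beta> = Suc (mdeg \<gamma>)" by (rule munit_split)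
    have \<gamma>K: "mdeg \<gamma> < K" using \<gamma> Suc by simp
    have "0 \<le> loc_mat (K - 1) (ball_poly R) y \<gamma> \<gamma>"
      using psd_on_minor(1)[OF L finite_Mon, of \<gamma> \<gamma>] \<gamma>K by (simp add: Mon_def)
    then have "(\<Sum>l\<in>UNIV. y (madd (madd (munit l) (munit l)) (madd \<gamma> \<gamma>))) \<le> R\<^sup>2 * y (madd \<gamma> \<gamma>)"
      by (simp add: loc_mat_eq_act mom_mat_def act_ball_poly)
    moreover have "y (madd (madd (munit i) (munit i)) (madd \<gamma> \<gamma>)) \<le>
        (\<Sum>l\<in>UNIV. y (madd (madd (munit l) (munit l)) (madd \<gamma> \<gamma>)))"
    proof (rule member_le_sum)
      fix l :: 'n
      have "madd (madd (munit l) (munit l)) (madd \<gamma> \<gamma>) = madd (madd (munit l) \<gamma>) (madd (munit l) \<gamma>)"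
        by (simp add: madd_ac)
      then show "0 \<le> y (madd (madd (munit l) (munit l)) (madd \<gamma> \<gamma>))"
        using diag[of "madd (munit l) \<gamma>"] \<gamma>K by simp
    qed auto
    moreover have "madd (madd (munit i) (munit i)) (madd \<gamma> \<gamma>) = madd \<beta> \<beta>"
      by (simp add: \<gamma>(1) madd_ac)
    ultimately have "y (madd \<beta> \<beta>) \<le> R\<^sup>2 * y (madd \<gamma> \<gamma>)" by simp
    also have "\<dots> \<le> R\<^sup>2 * (R\<^sup>2) ^ mdeg \<gamma>"
      using Suc \<gamma> \<gamma>K by (intro mult_left_mono) auto
    finally show ?case using \<gamma>(2) by simp
  qed
  have "(y \<alpha>)\<^sup>2 \<le> y (madd mzero mzero) * y (madd \<alpha> \<alpha>)"
    using psd_on_minor(2)[OF M finite_Mon, of mzero \<alpha>] \<alpha> by (simp add: Mon_def mom_mat_def)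
  also have "\<dots> \<le> (R\<^sup>2) ^ mdeg \<alpha>" using sq[OF \<alpha>] y0 by simp
  also have "\<dots> = (\<bar>R\<bar>\<^sup>2) ^ mdeg \<alpha>" by simp
  also have "\<dots> = (\<bar>R\<bar> ^ mdeg \<alpha>)\<^sup>2" by (simp only: power_mult[symmetric] mult.commute[of 2])
  finally show ?thesis using abs_le_square_iff[of "y \<alpha>" "\<bar>R\<bar> ^ mdeg \<alpha>"] by simp
qed

lemma states_bounded:
  assumes "\<exists>j<m. g j = ball_poly R" "y \<in> states m g"
  shows "\<bar>y \<alpha>\<bar> \<le> \<bar>R\<bar> ^ mdeg \<alpha>"
proof (rule ball_moment_bound)
  show "psd_on (Mon (mdeg \<alpha>)) (mom_mat (mdeg \<alpha>) y)" using assms(2) by (simp add: states_def psd_seq_def)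
  show "psd_on (Mon (mdeg \<alpha> - 1)) (loc_mat (mdeg \<alpha> - 1) (ball_poly R) y)"
    using assms by (auto simp: states_def psd_seq_def loc_mat_eq_act)
qed (use assms in \<open>auto simp: states_def\<close>)

lemma poly_deg_ge:
  assumes "is_poly p" "p \<alpha> \<noteq> 0"
  shows "mdeg \<alpha> \<le> poly_deg p"
proof -
  have "finite {mdeg \<alpha> | \<alpha>. p \<alpha> \<noteq> 0}" using assms(1) by (simp add: is_poly_def)
  then show ?thesis unfolding poly_deg_def using assms(2) by (intro Max_ge) auto
qed

lemma poly_deg_le_two_vj: "poly_deg p \<le> 2 * vj p"
  by (simp add: vj_def)

lemma act_pconst: "act (pconst c) y \<gamma> = c * y \<gamma>"
proof -
  have "act (pconst c) y \<gamma> = (\<Sum>\<beta>\<in>{mzero}. pconst c \<beta> * y (madd \<beta> \<gamma>))"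
    by (rule act_superset) (auto simp: pconst_def)
  then show ?thesis by (simp add: pconst_def)
qed

lemma is_poly_pconst [simp]: "is_poly (pconst c)"
  unfolding is_poly_def by (rule finite_subset[of _ "{mzero}"]) (auto simp: pconst_def)

lemma poly_deg_pconst [simp]: "poly_deg (pconst c :: 'n::finite mpoly) = 0"
proof -
  have "{mdeg \<alpha> | \<alpha>. (pconst c :: 'n mpoly) \<alpha> \<noteq> 0} \<union> {0} = {0}" by (auto simp: pconst_def split: if_splits)
  then show ?thesis unfolding poly_deg_def by (simp only: Max_singleton)
qed

lemma loc_mat_one: "loc_mat k (pconst 1) y = mom_mat k y"
  by (simp add: loc_mat_eq_act mom_mat_def act_pconst)

section \<open>Evaluation of polynomials and moments of measures\<close>

lemma peval_superset:
  assumes "finite A" "{\<beta>. p \<beta> \<noteq> 0} \<subseteq> A"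
  shows "peval p x = (\<Sum>\<beta>\<in>A. p \<beta> * monom \<beta> x)"
  unfolding peval_def using assms by (intro sum.mono_neutral_left) auto

lemma peval_pconst [simp]: "peval (pconst c) x = c"
  by (subst peval_superset[of "{mzero}"]) (auto simp: pconst_def)

lemma continuous_on_monom: "continuous_on S (monom \<alpha>)"
  unfolding monom_def[abs_def] by (intro continuous_intros)

lemma borel_measurable_monom [measurable]: "monom \<alpha> \<in> borel_measurable borel"
  by (rule borel_measurable_continuous_onI[OF continuous_on_monom])

lemma continuous_on_peval: "continuous_on S (peval p)"
  unfolding peval_def[abs_def] by (intro continuous_intros continuous_on_monom)

lemma closed_semialg: "closed (semialg m g)"
proof -
  have "semialg m g = (\<Inter>j\<in>{..<m}. {x. 0 \<le> peval (g j) x})" by (auto simp: semialg_def)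
  then show ?thesis by (auto intro!: closed_INT closed_Collect_le continuous_on_peval)
qed

text \<open>Integrability of the constant monomial expresses finiteness of the measure; on the
  compact set carrying it, a continuous function is bounded.\<close>

lemma compactly_supported_integrable:
  fixes f :: "real^'n::finite \<Rightarrow> real"
  assumes X: "compact X" and \<mu>: "sets \<mu> = sets borel" "emeasure \<mu> (UNIV - X) = 0"
    and fin: "integrable \<mu> (monom mzero)" and f: "continuous_on UNIV f"
  shows "integrable \<mu> f"
proof -
  have "bounded (f ` X)" using X f by (meson compact_continuous_image compact_imp_bounded continuous_on_subset subset_UNIV)
  then obtain B where B: "\<And>x. x \<in> X \<Longrightarrow> norm (f x) \<le> B" unfolding bounded_iff by blast
  have "integrable \<mu> (\<lambda>x. \<bar>B\<bar> * monom mzero x)" using fin by (rule integrable_mult_right)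
  moreover have "f \<in> borel_measurable \<mu>"
    using borel_measurable_continuous_onI[OF f] measurable_cong_sets[OF \<mu>(1) refl] by blast
  moreover have "AE x in \<mu>. x \<in> X"
  proof (rule AE_I)
    show "UNIV - X \<in> sets \<mu>" using X \<mu>(1) by (simp add: compact_imp_closed open_Diff borel_open)
  qed (use \<mu>(2) in auto)
  then have "AE x in \<mu>. norm (f x) \<le> norm (\<bar>B\<bar> * monom mzero x)"
  proof (rule AE_mp, intro AE_I2 impI)
    fix x assume "x \<in> X"
    then show "norm (f x) \<le> norm (\<bar>B\<bar> * monom mzero x)" using B[of x] by simp
  qed
  ultimately show ?thesis by (rule Bochner_Integration.integrable_bound)
qed

text \<open>The extension required by the relaxation consists of the higher moments of the same
  measure, which exist by compactness. Hence every relaxed optimum is at least the ideal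
  one.\<close>

lemma moments_on_subset_sdp:
  fixes g :: "nat \<Rightarrow> 'n::finite mpoly"
  assumes g: "\<And>j. j < m \<Longrightarrow> is_poly (g j)" and X: "compact (semialg m g)"
    and y: "y \<in> moments_on (2 * d) (semialg m g)"
  shows "y \<in> moments_sdp d \<delta> m g"
proof -
  let ?X = "semialg m g"
  from y obtain \<mu> :: "(real^'n) measure" where tr: "trunc_seq (2 * d) y"
    and \<mu>: "sets \<mu> = sets borel" "emeasure \<mu> (UNIV - ?X) = 0"
    and mom: "\<And>\<alpha>. mdeg \<alpha> \<le> 2 * d \<Longrightarrow> integrable \<mu> (monom \<alpha>)"
      "\<And>\<alpha>. mdeg \<alpha> \<le> 2 * d \<Longrightarrow> y \<alpha> = integral\<^sup>L \<mu> (monom \<alpha>)"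
    unfolding moments_on_def by blast
  have "integrable \<mu> (monom mzero)" by (rule mom(1)) simp
  note int = compactly_supported_integrable[OF X \<mu> this]
  have AEX: "AE x in \<mu>. x \<in> ?X"
  proof (rule AE_I)
    show "UNIV - ?X \<in> sets \<mu>" using X \<mu>(1) by (simp add: compact_imp_closed open_Diff borel_open)
  qed (use \<mu>(2) in auto)
  define z where "z \<alpha> = (if mdeg \<alpha> \<le> 2 * (d + \<delta>) then integral\<^sup>L \<mu> (monom \<alpha>) else 0)" for \<alpha>
  \<comment> \<open>The quadratic form is the integral of \<open>f\<close> times a square. Taking
    the constant 1 for \<open>f\<close> covers the moment matrix too.\<close>
  have loc: "psd_on (Mon k) (loc_mat k f z)"
    if f: "is_poly f" and nn: "\<And>x. x \<in> ?X \<Longrightarrow> 0 \<le> peval f x" and deg: "poly_deg f + 2 * k \<le> 2 * (d + \<delta>)" for f k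
    unfolding psd_on_def
  proof (intro conjI allI)
    show "sym_on (Mon k) (loc_mat k f z)" by (simp add: loc_mat_eq_act)
    fix v :: "'n mexp \<Rightarrow> real"
    have entry: "loc_mat k f z \<alpha> \<beta> = (\<integral>x. peval f x * monom \<alpha> x * monom \<beta> x \<partial>\<mu>)"
      if "\<alpha> \<in> Mon k" "\<beta> \<in> Mon k" for \<alpha> \<beta>
    proof -
      have "loc_mat k f z \<alpha> \<beta> = (\<Sum>\<gamma>\<in>{\<gamma>. f \<gamma> \<noteq> 0}. \<integral>x. f \<gamma> * monom (madd \<gamma> (madd \<alpha> \<beta>)) x \<partial>\<mu>)"
        unfolding loc_mat_def
      proof (intro sum.cong refl)
        fix \<gamma> assume "\<gamma> \<in> {\<gamma>. f \<gamma> \<noteq> 0}"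
        then have "mdeg \<gamma> \<le> poly_deg f" using poly_deg_ge[OF f] by simp
        then have "mdeg (madd \<gamma> (madd \<alpha> \<beta>)) \<le> 2 * (d + \<delta>)" using that deg by (simp add: Mon_def)
        then show "f \<gamma> * z (madd \<gamma> (madd \<alpha> \<beta>)) = (\<integral>x. f \<gamma> * monom (madd \<gamma> (madd \<alpha> \<beta>)) x \<partial>\<mu>)"
          by (simp add: z_def)
      qed
      also have "\<dots> = (\<integral>x. (\<Sum>\<gamma>\<in>{\<gamma>. f \<gamma> \<noteq> 0}. f \<gamma> * monom (madd \<gamma> (madd \<alpha> \<beta>)) x) \<partial>\<mu>)"
        by (rule Bochner_Integration.integral_sum[symmetric]) (intro int continuous_intros continuous_on_monom)
      also have "\<dots> = (\<integral>x. peval f x * monom \<alpha> x * monom \<beta> x \<partial>\<mu>)"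
        by (intro Bochner_Integration.integral_cong refl) (simp add: peval_def monom_madd sum_distrib_right mult.assoc)
      finally show ?thesis .
    qed
    have "(\<Sum>\<alpha>\<in>Mon k. \<Sum>\<beta>\<in>Mon k. v \<alpha> * loc_mat k f z \<alpha> \<beta> * v \<beta>) =
        (\<Sum>\<alpha>\<in>Mon k. \<Sum>\<beta>\<in>Mon k. \<integral>x. peval f x * ((v \<alpha> * monom \<alpha> x) * (v \<beta> * monom \<beta> x)) \<partial>\<mu>)"
    proof (intro sum.cong refl)
      fix \<alpha> \<beta> :: "'n mexp" assume ab: "\<alpha> \<in> Mon k" "\<beta> \<in> Mon k"
      have "v \<alpha> * loc_mat k f z \<alpha> \<beta> * v \<beta> = (v \<alpha> * v \<beta>) * (\<integral>x. peval f x * monom \<alpha> x * monom \<beta> x \<partial>\<mu>)"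
        by (simp add: entry[OF ab] mult_ac)
      also have "\<dots> = (\<integral>x. (v \<alpha> * v \<beta>) * (peval f x * monom \<alpha> x * monom \<beta> x) \<partial>\<mu>)"
        by (rule integral_mult_right_zero[symmetric])
      also have "\<dots> = (\<integral>x. peval f x * ((v \<alpha> * monom \<alpha> x) * (v \<beta> * monom \<beta> x)) \<partial>\<mu>)"
        by (intro Bochner_Integration.integral_cong refl) (simp only: mult_ac)
      finally show "v \<alpha> * loc_mat k f z \<alpha> \<beta> * v \<beta> =
          (\<integral>x. peval f x * ((v \<alpha> * monom \<alpha> x) * (v \<beta> * monom \<beta> x)) \<partial>\<mu>)" .
    qed
    also have "\<dots> = (\<Sum>\<alpha>\<in>Mon k. \<integral>x. (\<Sum>\<beta>\<in>Mon k. peval f x * ((v \<alpha> * monom \<alpha> x) * (v \<beta> * monom \<beta> x))) \<partial>\<mu>)"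
      by (intro sum.cong refl Bochner_Integration.integral_sum[symmetric] int continuous_intros continuous_on_monom continuous_on_peval)
    also have "\<dots> = (\<integral>x. (\<Sum>\<alpha>\<in>Mon k. \<Sum>\<beta>\<in>Mon k. peval f x * ((v \<alpha> * monom \<alpha> x) * (v \<beta> * monom \<beta> x))) \<partial>\<mu>)"
      by (intro Bochner_Integration.integral_sum[symmetric] int continuous_intros continuous_on_monom continuous_on_peval)
    also have "\<dots> = (\<integral>x. peval f x * (\<Sum>\<alpha>\<in>Mon k. v \<alpha> * monom \<alpha> x)\<^sup>2 \<partial>\<mu>)"
      unfolding power2_eq_square sum_product by (simp only: sum_distrib_left)
    also have "\<dots> \<ge> 0"
    proof (rule integral_nonneg_AE, rule AE_mp[OF AEX], intro AE_I2 impI)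
      fix x assume "x \<in> ?X"
      then show "0 \<le> peval f x * (\<Sum>\<alpha>\<in>Mon k. v \<alpha> * monom \<alpha> x)\<^sup>2" using nn by simp
    qed
    finally show "0 \<le> (\<Sum>\<alpha>\<in>Mon k. \<Sum>\<beta>\<in>Mon k. v \<alpha> * loc_mat k f z \<alpha> \<beta> * v \<beta>)" .
  qed
  have "trunc_seq (2 * (d + \<delta>)) z" by (simp add: trunc_seq_def z_def)
  moreover have "\<forall>\<alpha>. mdeg \<alpha> \<le> 2 * d \<longrightarrow> z \<alpha> = y \<alpha>" using mom(2) by (simp add: z_def)
  moreover have "psd_on (Mon (d + \<delta>)) (mom_mat (d + \<delta>) z)"
    using loc[of "pconst 1" "d + \<delta>"] by (simp add: loc_mat_one)
  moreover have "psd_on (Mon (d + \<delta> - vj (g j))) (loc_mat (d + \<delta> - vj (g j)) (g j) z)"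
    if "j < m" "vj (g j) \<le> d + \<delta>" for j
  proof (rule loc[OF g[OF that(1)]])
    show "poly_deg (g j) + 2 * (d + \<delta> - vj (g j)) \<le> 2 * (d + \<delta>)"
      using poly_deg_le_two_vj[of "g j"] that(2) by simp
  qed (use that in \<open>simp add: semialg_def\<close>)
  ultimately show ?thesis unfolding moments_sdp_def using tr by blast
qed

text \<open>The points \<open>x k\<close> may repeat, so the weights are put on the indices and
  pushed forward.\<close>

lemma atomic_in_moments_on:
  fixes x :: "nat \<Rightarrow> real^'n::finite"
  assumes X: "closed X" "\<And>k. x k \<in> X" and w: "\<And>k. 0 \<le> w k" and tr: "trunc_seq D z"
    and z: "\<And>\<alpha>. \<alpha> \<in> Mon D \<Longrightarrow> (\<Sum>k<N. w k * monom \<alpha> (x k)) = z \<alpha>"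
  shows "z \<in> moments_on D X"
proof -
  define P where "P = point_measure {..<N} (\<lambda>k. ennreal (w k))"
  define \<mu> where "\<mu> = distr P borel x"
  have x_meas: "x \<in> measurable P borel" by (simp add: P_def measurable_point_measure_eq1)
  have "UNIV - X \<in> sets borel" using X(1) by (simp add: open_Diff borel_open)
  then have "emeasure \<mu> (UNIV - X) = emeasure P (x -` (UNIV - X) \<inter> space P)"
    unfolding \<mu>_def by (rule emeasure_distr[OF x_meas])
  also have "x -` (UNIV - X) \<inter> space P = {}" using X(2) by auto
  finally have "emeasure \<mu> (UNIV - X) = 0" by simp
  moreover have "integrable \<mu> (monom \<alpha>)" for \<alpha>
    unfolding \<mu>_def integrable_distr_eq[OF x_meas borel_measurable_monom]
    by (simp add: P_def integrable_point_measure_finite)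
  moreover have "z \<alpha> = integral\<^sup>L \<mu> (monom \<alpha>)" if "mdeg \<alpha> \<le> D" for \<alpha>
    unfolding \<mu>_def integral_distr[OF x_meas borel_measurable_monom]
    using z[of \<alpha>] that w by (simp add: P_def lebesgue_integral_point_measure_finite Mon_def)
  ultimately show ?thesis using tr unfolding moments_on_def
    by (intro CollectI conjI exI[of _ \<mu>]) (auto simp: \<mu>_def)
qed

section \<open>Duality between sums of squares and pseudo-moments\<close>

text \<open>\<open>pmult\<close> sums over the exponents below \<beta>; rewriting it over pairs from
  the finite supports yields finiteness and prepares the regrouping in
  \<open>act_pmult\<close>.\<close>

lemma is_poly_pmult:
  assumes "is_poly p" "is_poly r"
  shows "is_poly (pmult p r)"
    and "pmult p r \<beta> = (\<Sum>(a,b) | (a,b) \<in> {a. p a \<noteq> 0} \<times> {b. r b \<noteq> 0} \<and> madd a b = \<beta>. p a * r b)"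
proof -
  let ?P = "{a. p a \<noteq> 0} \<times> {b. r b \<noteq> 0}"
  have eq: "pmult p r \<beta> = (\<Sum>(a,b) | (a,b) \<in> ?P \<and> madd a b = \<beta>. p a * r b)" for \<beta>
  proof -
    let ?D = "{\<alpha>. \<forall>i. \<alpha> i \<le> \<beta> i}"
    let ?h = "\<lambda>\<alpha>. (\<lambda>i. \<beta> i - \<alpha> i)"
    have "finite ?D"
      by (rule finite_subset[of _ "PiE UNIV (\<lambda>i. {..\<beta> i})"]) (auto simp: finite_PiE)
    then have "pmult p r \<beta> = (\<Sum>\<alpha>\<in>{\<alpha>\<in>?D. p \<alpha> \<noteq> 0 \<and> r (?h \<alpha>) \<noteq> 0}. p \<alpha> * r (?h \<alpha>))"
      unfolding pmult_def by (intro sum.mono_neutral_right) auto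
    also have "\<dots> = (\<Sum>(a,b) | (a,b) \<in> ?P \<and> madd a b = \<beta>. p a * r b)"
    proof (rule sum.reindex_bij_witness[where i="fst" and j="\<lambda>\<alpha>. (\<alpha>, ?h \<alpha>)"], goal_cases)
      case (1 \<alpha>) then show ?case by simp
    next
      case (2 \<alpha>) then show ?case by (auto simp: madd_def)
    next
      case (3 ab) then show ?case by (auto simp: madd_def)
    next
      case (4 ab) then show ?case by (auto simp: madd_def)
    next
      case (5 \<alpha>) then show ?case by simp
    qed
    finally show ?thesis .
  qed
  then show "pmult p r \<beta> = (\<Sum>(a,b) | (a,b) \<in> ?P \<and> madd a b = \<beta>. p a * r b)" .
  have "{\<beta>. pmult p r \<beta> \<noteq> 0} \<subseteq> (\<lambda>(a,b). madd a b) ` ?P"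
  proof
    fix \<beta> assume "\<beta> \<in> {\<beta>. pmult p r \<beta> \<noteq> 0}"
    then have "(\<Sum>(a,b) | (a,b) \<in> ?P \<and> madd a b = \<beta>. p a * r b) \<noteq> 0" using eq[of \<beta>] by simp
    then obtain ab where "ab \<in> {(a,b). (a,b) \<in> ?P \<and> madd a b = \<beta>}"
      by (rule sum.not_neutral_contains_not_neutral)
    then show "\<beta> \<in> (\<lambda>(a,b). madd a b) ` ?P" by force
  qed
  moreover have "finite ((\<lambda>(a,b). madd a b) ` ?P)" using assms by (simp add: is_poly_def)
  ultimately show "is_poly (pmult p r)" unfolding is_poly_def by (rule finite_subset)
qed

text \<open>Links coefficient multiplication, in which certificates are stated, with composition of
  operators. Pairs of exponents are grouped by their sum.\<close>

lemma act_pmult: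
  assumes p: "is_poly p" and r: "is_poly r"
  shows "act (pmult p r) y = act p (act r y)"
proof
  fix \<gamma>
  let ?P = "{a. p a \<noteq> 0} \<times> {b. r b \<noteq> 0}"
  let ?B = "(\<lambda>(a,b). madd a b) ` ?P"
  have fP: "finite ?P" using p r by (simp add: is_poly_def)
  have sub: "{\<beta>. pmult p r \<beta> \<noteq> 0} \<subseteq> ?B"
  proof
    fix \<beta> assume "\<beta> \<in> {\<beta>. pmult p r \<beta> \<noteq> 0}"
    then have "(\<Sum>(a,b) | (a,b) \<in> ?P \<and> madd a b = \<beta>. p a * r b) \<noteq> 0"
      using is_poly_pmult(2)[OF p r, of \<beta>] by simp
    then obtain ab where "ab \<in> {(a,b). (a,b) \<in> ?P \<and> madd a b = \<beta>}"
      by (rule sum.not_neutral_contains_not_neutral)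
    then show "\<beta> \<in> ?B" by force
  qed
  have "act (pmult p r) y \<gamma> = (\<Sum>\<beta>\<in>?B. pmult p r \<beta> * y (madd \<beta> \<gamma>))"
    by (rule act_superset[OF _ sub]) (use fP in simp)
  also have "\<dots> = (\<Sum>\<beta>\<in>?B. \<Sum>ab | ab \<in> ?P \<and> (\<lambda>(a,b). madd a b) ab = \<beta>. (\<lambda>(a,b). p a * (r b * y (madd b (madd a \<gamma>)))) ab)"
  proof (intro sum.cong refl)
    fix \<beta>
    have "pmult p r \<beta> * y (madd \<beta> \<gamma>) =
        (\<Sum>ab | ab \<in> ?P \<and> (\<lambda>(a,b). madd a b) ab = \<beta>. (\<lambda>(a,b). p a * r b) ab * y (madd \<beta> \<gamma>))"
      unfolding is_poly_pmult(2)[OF p r, of \<beta>] sum_distrib_right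
      by (intro sum.cong) (auto simp: case_prod_beta)
    also have "\<dots> = (\<Sum>ab | ab \<in> ?P \<and> (\<lambda>(a,b). madd a b) ab = \<beta>. (\<lambda>(a,b). p a * (r b * y (madd b (madd a \<gamma>)))) ab)"
    proof (intro sum.cong refl)
      fix ab assume "ab \<in> {ab. ab \<in> ?P \<and> (\<lambda>(a,b). madd a b) ab = \<beta>}"
      then have "\<beta> = madd (fst ab) (snd ab)" by (simp add: case_prod_beta)
      then have "madd \<beta> \<gamma> = madd (snd ab) (madd (fst ab) \<gamma>)" by (simp add: madd_ac)
      then show "(\<lambda>(a,b). p a * r b) ab * y (madd \<beta> \<gamma>) = (\<lambda>(a,b). p a * (r b * y (madd b (madd a \<gamma>)))) ab"
        by (simp add: case_prod_beta mult.assoc)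
    qed
    finally show "pmult p r \<beta> * y (madd \<beta> \<gamma>) = \<dots>" .
  qed
  also have "\<dots> = (\<Sum>(a,b)\<in>?P. p a * (r b * y (madd b (madd a \<gamma>))))"
    by (rule sum.group[OF fP]) (use fP in auto)
  also have "\<dots> = act p (act r y) \<gamma>"
    by (simp add: act_def sum.cartesian_product[symmetric] sum_distrib_left)
  finally show "act (pmult p r) y \<gamma> = act p (act r y) \<gamma>" .
qed

lemma is_poly_sum:
  assumes "finite L" "\<And>l. l \<in> L \<Longrightarrow> is_poly (p l)"
  shows "is_poly (\<lambda>\<gamma>. \<Sum>l\<in>L. p l \<gamma>)"
proof -
  have "{\<gamma>. (\<Sum>l\<in>L. p l \<gamma>) \<noteq> 0} \<subseteq> (\<Union>l\<in>L. {\<gamma>. p l \<gamma> \<noteq> 0})"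
    by (auto elim: sum.not_neutral_contains_not_neutral)
  moreover have "finite (\<Union>l\<in>L. {\<gamma>. p l \<gamma> \<noteq> 0})" using assms by (auto simp: is_poly_def)
  ultimately show ?thesis unfolding is_poly_def by (rule finite_subset)
qed

lemma act_sum:
  assumes "finite L" "\<And>l. l \<in> L \<Longrightarrow> is_poly (p l)"
  shows "act (\<lambda>\<gamma>. \<Sum>l\<in>L. p l \<gamma>) y \<gamma> = (\<Sum>l\<in>L. act (p l) y \<gamma>)"
proof -
  let ?A = "\<Union>l\<in>L. {\<gamma>. p l \<gamma> \<noteq> 0}"
  have fA: "finite ?A" using assms by (auto simp: is_poly_def)
  have "act (\<lambda>\<gamma>. \<Sum>l\<in>L. p l \<gamma>) y \<gamma> = (\<Sum>\<beta>\<in>?A. (\<Sum>l\<in>L. p l \<beta>) * y (madd \<beta> \<gamma>))"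
    by (rule act_superset[OF fA]) (auto elim: sum.not_neutral_contains_not_neutral)
  also have "\<dots> = (\<Sum>l\<in>L. \<Sum>\<beta>\<in>?A. p l \<beta> * y (madd \<beta> \<gamma>))"
    unfolding sum_distrib_right by (rule sum.swap)
  also have "\<dots> = (\<Sum>l\<in>L. act (p l) y \<gamma>)"
    by (intro sum.cong refl act_superset[OF fA, symmetric]) auto
  finally show ?thesis .
qed

lemma act_square_nonneg:
  assumes h: "is_poly h" "poly_deg h \<le> k" and y: "psd_on (Mon k) (mom_mat k y)"
  shows "0 \<le> act h (act h y) mzero"
proof -
  have sub: "{\<beta>. h \<beta> \<noteq> 0} \<subseteq> Mon k" using poly_deg_ge[OF h(1)] h(2) by (force simp: Mon_def)
  have "act h (act h y) mzero = (\<Sum>\<alpha>\<in>Mon k. \<Sum>\<beta>\<in>Mon k. h \<alpha> * mom_mat k y \<alpha> \<beta> * h \<beta>)"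
    by (simp add: act_superset[OF finite_Mon sub] mom_mat_def sum_distrib_left mult_ac madd_comm)
  then show ?thesis using y by (simp add: psd_on_def)
qed

lemma is_poly_sos:
  assumes "sos_deg k \<sigma>"
  shows "is_poly \<sigma>"
proof -
  from assms obtain L :: "nat set" and h where L: "finite L" "\<forall>l\<in>L. is_poly (h l) \<and> poly_deg (h l) \<le> k"
    and \<sigma>: "\<sigma> = (\<lambda>\<gamma>. \<Sum>l\<in>L. pmult (h l) (h l) \<gamma>)"
    unfolding sos_deg_def by (elim exE conjE) (rule that)
  show ?thesis unfolding \<sigma> using L(2) by (intro is_poly_sum is_poly_pmult(1) L(1)) simp_all
qed

lemma act_sos_nonneg:
  assumes \<sigma>: "sos_deg k \<sigma>" and y: "psd_on (Mon k) (mom_mat k y)"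
  shows "0 \<le> act \<sigma> y mzero"
proof -
  from \<sigma> obtain L :: "nat set" and h where fL: "finite L"
    and hL: "\<forall>l\<in>L. is_poly (h l) \<and> poly_deg (h l) \<le> k"
    and eq: "\<sigma> = (\<lambda>\<gamma>. \<Sum>l\<in>L. pmult (h l) (h l) \<gamma>)"
    unfolding sos_deg_def by (elim exE conjE) (rule that)
  have L: "finite L" "l \<in> L \<Longrightarrow> is_poly (h l)" "l \<in> L \<Longrightarrow> poly_deg (h l) \<le> k" for l
    using fL hL by auto
  have "act \<sigma> y mzero = (\<Sum>l\<in>L. act (pmult (h l) (h l)) y mzero)"
    unfolding eq by (intro act_sum L(1) is_poly_pmult(1) L(2))
  also have "\<dots> = (\<Sum>l\<in>L. act (h l) (act (h l) y) mzero)"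
    by (intro sum.cong refl) (simp add: act_pmult L(2))
  also have "\<dots> \<ge> 0" by (intro sum_nonneg act_square_nonneg[OF L(2,3) y])
  finally show ?thesis .
qed

text \<open>Weak duality: \<sigma>0 is tested against the moment matrix and each \<sigma>_j against
  the localizing matrix of g_j, in matching degrees.\<close>

lemma act_sos_cone_nonneg:
  assumes h: "h \<in> sos_cone d \<delta> m g" and g: "\<And>j. j < m \<Longrightarrow> is_poly (g j)"
    and y: "psd_on (Mon (d + \<delta>)) (mom_mat (d + \<delta>) y)"
    and loc: "\<And>j. j < m \<Longrightarrow> vj (g j) \<le> d + \<delta> \<Longrightarrow> psd_on (Mon (d + \<delta> - vj (g j))) (loc_mat (d + \<delta> - vj (g j)) (g j) y)"
  shows "0 \<le> act h y mzero"
proof -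
  from h obtain \<sigma>0 \<sigma> where \<sigma>0: "sos_deg (d + \<delta>) \<sigma>0"
    and \<sigma>: "\<forall>j<m. if vj (g j) \<le> d + \<delta> then sos_deg (d + \<delta> - vj (g j)) (\<sigma> j) else \<sigma> j = (\<lambda>_. 0)"
    and heq: "h = (\<lambda>\<gamma>. \<sigma>0 \<gamma> + (\<Sum>j<m. pmult (g j) (\<sigma> j) \<gamma>))"
    unfolding sos_cone_def by blast
  have \<sigma>_poly: "is_poly (\<sigma> j)" if "j < m" for j
  proof (cases "vj (g j) \<le> d + \<delta>")
    case True
    then show ?thesis using \<sigma> that is_poly_sos by metis
  next
    case False
    then have "\<sigma> j = (\<lambda>_. 0)" using \<sigma> that by auto
    then show ?thesis by (simp add: is_poly_def)
  qed
  \<comment> \<open>The index \<open>None\<close> stands for \<sigma>0, so the certificate becomes a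
    single finite sum.\<close>
  define q where "q j = (case j of None \<Rightarrow> \<sigma>0 | Some j \<Rightarrow> pmult (g j) (\<sigma> j))" for j
  have "h = (\<lambda>\<gamma>. \<Sum>j\<in>insert None (Some ` {..<m}). q j \<gamma>)"
    by (simp add: heq q_def sum.reindex)
  moreover have "is_poly (q j)" if "j \<in> insert None (Some ` {..<m})" for j
    using that is_poly_sos[OF \<sigma>0] g \<sigma>_poly by (auto simp: q_def intro!: is_poly_pmult(1))
  ultimately have "act h y mzero = (\<Sum>j\<in>insert None (Some ` {..<m}). act (q j) y mzero)"
    using act_sum[of "insert None (Some ` {..<m})" q y mzero] by simp
  also have "\<dots> \<ge> 0"
  proof (rule sum_nonneg)
    fix j assume "j \<in> insert None (Some ` {..<m})"
    then consider "j = None" | i where "j = Some i" "i < m" by blast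
    then show "0 \<le> act (q j) y mzero"
    proof cases
      case 1
      then show ?thesis using act_sos_nonneg[OF \<sigma>0 y] by (simp add: q_def)
    next
      case 2
      have eq: "act (q j) y mzero = act (\<sigma> i) (act (g i) y) mzero"
        using 2 g \<sigma>_poly by (simp add: q_def act_pmult shift_ops_commute[OF act_in_shift_ops act_in_shift_ops])
      show ?thesis
      proof (cases "vj (g i) \<le> d + \<delta>")
        case True
        then have "sos_deg (d + \<delta> - vj (g i)) (\<sigma> i)" using \<sigma> 2 by auto
        then show ?thesis unfolding eq
          by (rule act_sos_nonneg) (use loc[OF 2(2) True] in \<open>simp add: loc_mat_eq_act\<close>)
      next
        case False
        then have "\<sigma> i = (\<lambda>_. 0)" using \<sigma> 2 by auto
        then show ?thesis unfolding eq by (simp add: act_def)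
      qed
    qed
  qed
  finally show ?thesis .
qed

text \<open>Pairing the polynomial v_d^T A v_d with moments gives the matrix inner product of A and
  M_d(y), which connects certificates with the first-order condition.\<close>

lemma act_quad_poly:
  fixes A :: "'n::finite mexp \<Rightarrow> 'n mexp \<Rightarrow> real"
  shows "(\<Sum>\<gamma>\<in>Mon (2 * d). quad_poly d A \<gamma> * y \<gamma>) = (\<Sum>\<alpha>\<in>Mon d. \<Sum>\<beta>\<in>Mon d. A \<alpha> \<beta> * mom_mat d y \<alpha> \<beta>)"
proof -
  let ?P = "Mon d \<times> Mon d :: ('n mexp \<times> 'n mexp) set"
  have "(\<Sum>\<gamma>\<in>Mon (2 * d). quad_poly d A \<gamma> * y \<gamma>) =
     (\<Sum>\<gamma>\<in>Mon (2 * d). \<Sum>ab | ab \<in> ?P \<and> (\<lambda>(a,b). madd a b) ab = \<gamma>. (\<lambda>(a,b). A a b * y (madd a b)) ab)"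
  proof (intro sum.cong refl)
    fix \<gamma> :: "'n mexp"
    have "{(\<alpha>, \<beta>). \<alpha> \<in> Mon d \<and> \<beta> \<in> Mon d \<and> madd \<alpha> \<beta> = \<gamma>} = {ab. ab \<in> ?P \<and> (\<lambda>(a,b). madd a b) ab = \<gamma>}"
      by auto
    then show "quad_poly d A \<gamma> * y \<gamma> =
        (\<Sum>ab | ab \<in> ?P \<and> (\<lambda>(a,b). madd a b) ab = \<gamma>. (\<lambda>(a,b). A a b * y (madd a b)) ab)"
      unfolding quad_poly_def sum_distrib_right by (intro sum.cong) auto
  qed
  also have "\<dots> = (\<Sum>(a,b)\<in>?P. A a b * y (madd a b))"
    by (rule sum.group, simp, simp, auto simp: Mon_def)
  finally show ?thesis by (simp add: sum.cartesian_product mom_mat_def)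
qed

lemma quad_poly_eq_0: "\<gamma> \<notin> Mon (2 * d) \<Longrightarrow> quad_poly d A \<gamma> = 0"
  unfolding quad_poly_def by (intro sum.neutral) (auto simp: Mon_def)

lemma act_const_minus_quad_poly:
  assumes "y mzero = 1"
  shows "act (\<lambda>\<gamma>. pconst c \<gamma> - quad_poly d A \<gamma>) y mzero =
    c - (\<Sum>\<alpha>\<in>Mon d. \<Sum>\<beta>\<in>Mon d. A \<alpha> \<beta> * mom_mat d y \<alpha> \<beta>)"
proof -
  have "act (\<lambda>\<gamma>. pconst c \<gamma> - quad_poly d A \<gamma>) y mzero =
     (\<Sum>\<gamma>\<in>Mon (2 * d). (pconst c \<gamma> - quad_poly d A \<gamma>) * y (madd \<gamma> mzero))"
  proof (rule act_superset[OF finite_Mon], rule subsetI, rule ccontr)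
    fix \<gamma> :: "'a mexp" assume "\<gamma> \<in> {\<gamma>. pconst c \<gamma> - quad_poly d A \<gamma> \<noteq> 0}" "\<gamma> \<notin> Mon (2 * d)"
    moreover from this(2) have "\<gamma> \<noteq> mzero" by auto
    ultimately show False by (simp add: quad_poly_eq_0 pconst_def)
  qed
  also have "\<dots> = (\<Sum>\<gamma>\<in>Mon (2 * d). pconst c \<gamma> * y \<gamma>) - (\<Sum>\<gamma>\<in>Mon (2 * d). quad_poly d A \<gamma> * y \<gamma>)"
    by (simp add: sum_subtractf left_diff_distrib)
  also have "(\<Sum>\<gamma>\<in>Mon (2 * d). pconst c \<gamma> * y \<gamma>) = (\<Sum>\<gamma>\<in>Mon (2 * d). if \<gamma> = mzero then c * y \<gamma> else 0)"
    by (intro sum.cong) (auto simp: pconst_def)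
  also have "\<dots> = c" using assms by simp
  finally show ?thesis by (simp add: act_quad_poly)
qed

section \<open>Convergence of the hierarchy\<close>

lemma loc_mat_indep: "loc_mat k f y = loc_mat l f y"
  by (simp add: loc_mat_def)

text \<open>The diagonal argument works because the n-th selected level is at least n: every fixed
  entry, and every matrix of fixed size, is eventually within the range controlled by the
  relaxation.\<close>

lemma relaxation_limit_state:
  fixes g :: "nat \<Rightarrow> 'n::finite mpoly"
  assumes ball: "j0 < m" "g j0 = ball_poly R"
    and ys: "\<And>\<delta>. ys \<delta> \<in> moments_sdp d \<delta> m g" "\<And>\<delta>. ys \<delta> mzero = 1" and r: "strict_mono (r :: nat \<Rightarrow> nat)"
  shows "\<exists>s z. strict_mono (s :: nat \<Rightarrow> nat) \<and> z \<in> states m g \<and>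
    (\<forall>\<alpha>. mdeg \<alpha> \<le> 2 * d \<longrightarrow> (\<lambda>n. ys (r (s n)) \<alpha>) \<longlonglongrightarrow> z \<alpha>)"
proof -
  define P where "P \<delta> w \<longleftrightarrow> (\<forall>\<alpha>. mdeg \<alpha> \<le> 2 * d \<longrightarrow> w \<alpha> = ys \<delta> \<alpha>) \<and>
     psd_on (Mon (d + \<delta>)) (mom_mat (d + \<delta>) w) \<and>
     (\<forall>j<m. vj (g j) \<le> d + \<delta> \<longrightarrow> psd_on (Mon (d + \<delta> - vj (g j))) (loc_mat (d + \<delta> - vj (g j)) (g j) w))" for \<delta> w
  have "\<forall>\<delta>. \<exists>w. P \<delta> w" using ys(1) unfolding moments_sdp_def P_def by blast
  then obtain e where "\<forall>\<delta>. P \<delta> (e \<delta>)" by (elim exE[OF choice]) (rule that)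
  then have e: "\<And>\<delta> \<alpha>. mdeg \<alpha> \<le> 2 * d \<Longrightarrow> e \<delta> \<alpha> = ys \<delta> \<alpha>"
    "\<And>\<delta>. psd_on (Mon (d + \<delta>)) (mom_mat (d + \<delta>) (e \<delta>))"
    "\<And>\<delta> j. j < m \<Longrightarrow> vj (g j) \<le> d + \<delta> \<Longrightarrow> psd_on (Mon (d + \<delta> - vj (g j))) (loc_mat (d + \<delta> - vj (g j)) (g j) (e \<delta>))"
    unfolding P_def by simp_all
  have e0: "e \<delta> mzero = 1" for \<delta> using e(1)[of mzero] ys(2) by simp
  have bnd: "\<bar>e \<delta> \<alpha>\<bar> \<le> \<bar>R\<bar> ^ mdeg \<alpha>" if "mdeg \<alpha> \<le> d + \<delta>" for \<delta> \<alpha>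
  proof (rule ball_moment_bound[OF e0 e(2) _ that])
    assume "0 < d + \<delta>"
    then show "psd_on (Mon (d + \<delta> - 1)) (loc_mat (d + \<delta> - 1) (ball_poly R) (e \<delta>))"
      using e(3)[OF ball(1), of \<delta>] ball(2) by (simp add: Suc_le_eq)
  qed
  \<comment> \<open>The bound holds up to degree d + \<delta> only, so higher entries are cut off to
    obtain a bounded sequence; for fixed \<alpha> the cut eventually disappears.\<close>
  define w where "w \<delta> \<alpha> = (if mdeg \<alpha> \<le> d + \<delta> then e \<delta> \<alpha> else 0)" for \<delta> \<alpha>
  have "\<bar>w (r n) \<alpha>\<bar> \<le> \<bar>R\<bar> ^ mdeg \<alpha>" for n \<alpha> using bnd by (simp add: w_def)
  then obtain s z where s: "strict_mono (s :: nat \<Rightarrow> nat)" and wz: "\<And>\<alpha>. (\<lambda>n. w (r (s n)) \<alpha>) \<longlonglongrightarrow> z \<alpha>"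
    using pointwise_bounded_convergent_subseq[of "\<lambda>n. w (r n)" "\<lambda>\<alpha>. \<bar>R\<bar> ^ mdeg \<alpha>"] by blast
  define t where "t n = r (s n)" for n
  have t: "n \<le> t n" for n
    unfolding t_def using seq_suble[OF s, of n] seq_suble[OF r, of "s n"] by simp
  have ez: "(\<lambda>n. e (t n) \<alpha>) \<longlonglongrightarrow> z \<alpha>" for \<alpha>
  proof (rule Lim_transform_eventually[OF wz[folded t_def]])
    show "\<forall>\<^sub>F n in sequentially. w (t n) \<alpha> = e (t n) \<alpha>"
      unfolding eventually_sequentially
    proof (intro exI[of _ "mdeg \<alpha>"] allI impI)
      fix n assume "mdeg \<alpha> \<le> n"
      then show "w (t n) \<alpha> = e (t n) \<alpha>" using t[of n] by (simp add: w_def)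
    qed
  qed
  have limit: "psd_on (Mon k) (loc_mat k f z)"
    if "\<And>n. N \<le> n \<Longrightarrow> psd_on (Mon k) (loc_mat k f (e (t n)))" for N k f
    unfolding psd_on_def
  proof (intro conjI allI)
    show "sym_on (Mon k) (loc_mat k f z)" by (simp add: loc_mat_eq_act)
    fix v
    have "(\<lambda>n. \<Sum>i\<in>Mon k. \<Sum>j\<in>Mon k. v i * loc_mat k f (e (t n)) i j * v j)
       \<longlonglongrightarrow> (\<Sum>i\<in>Mon k. \<Sum>j\<in>Mon k. v i * loc_mat k f z i j * v j)"
      unfolding loc_mat_def by (intro tendsto_intros ez)
    then show "0 \<le> (\<Sum>i\<in>Mon k. \<Sum>j\<in>Mon k. v i * loc_mat k f z i j * v j)"
      by (rule LIMSEQ_le_const) (use that in \<open>auto simp: psd_on_def\<close>)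
  qed
  have "z mzero = 1" using ez[of mzero] by (simp add: e0 LIMSEQ_const_iff)
  moreover have "psd_seq z"
    unfolding psd_seq_def
  proof
    fix k
    have "psd_on (Mon k) (loc_mat k (pconst 1) (e (t n)))" if "k \<le> n" for n
    proof (rule psd_on_subset[OF finite_Mon])
      show "psd_on (Mon (d + t n)) (loc_mat k (pconst 1) (e (t n)))"
        using e(2)[of "t n"] by (simp add: loc_mat_one mom_mat_def)
      show "Mon k \<subseteq> Mon (d + t n)" using t[of n] that by (auto simp: Mon_def)
    qed
    then show "psd_on (Mon k) (mom_mat k z)" using limit[of k k "pconst 1"] by (simp add: loc_mat_one)
  qed
  moreover have "psd_seq (act (g j) z)" if j: "j < m" for j
    unfolding psd_seq_def
  proof
    fix k
    \<comment> \<open>From this threshold on, the subtraction d + t n - \<open>vj (g j)\<close>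
      leaves at least \<open>k\<close>.\<close>
    have "psd_on (Mon k) (loc_mat k (g j) (e (t n)))" if n: "vj (g j) + k \<le> n" for n
    proof (rule psd_on_subset[OF finite_Mon])
      have "vj (g j) \<le> d + t n" using t[of n] n by simp
      from e(3)[OF j this] show "psd_on (Mon (d + t n - vj (g j))) (loc_mat k (g j) (e (t n)))"
        unfolding loc_mat_indep[of k _ _ "d + t n - vj (g j)"] .
      show "Mon k \<subseteq> Mon (d + t n - vj (g j))" using t[of n] n by (auto simp: Mon_def)
    qed
    then show "psd_on (Mon k) (mom_mat k (act (g j) z))"
      using limit[of "vj (g j) + k" k "g j"] by (simp add: loc_mat_eq_act)
  qed
  ultimately have "z \<in> states m g" by (simp add: states_def)
  moreover have "(\<lambda>n. ys (r (s n)) \<alpha>) \<longlonglongrightarrow> z \<alpha>" if "mdeg \<alpha> \<le> 2 * d" for \<alpha>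
    using ez[of \<alpha>] e(1)[OF that] by (simp add: t_def)
  ultimately show ?thesis using s by blast
qed

text \<open>Only finitely many moments have to be represented, so it suffices to place them in the
  convex hull of the monomial vectors of points of the set. The required affine inequalities are
  nonnegativity of states on polynomials.\<close>

lemma truncated_state_in_moments_on:
  fixes g :: "nat \<Rightarrow> 'n::finite mpoly"
  assumes g: "\<And>j. j < m \<Longrightarrow> is_poly (g j)" and ball: "j0 < m" "g j0 = ball_poly R"
    and X: "compact (semialg m g)" and z: "z \<in> states m g"
  shows "(\<lambda>\<alpha>. if mdeg \<alpha> \<le> D then z \<alpha> else 0) \<in> moments_on D (semialg m g)"
proof -
  have bnd: "\<forall>y\<in>states m g. \<forall>\<gamma>. \<bar>y \<gamma>\<bar> \<le> \<bar>R\<bar> ^ mdeg \<gamma>"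
  proof (intro ballI allI)
    fix y \<gamma> assume "y \<in> states m g"
    with ball show "\<bar>y \<gamma>\<bar> \<le> \<bar>R\<bar> ^ mdeg \<gamma>" by (intro states_bounded[of m g]) blast+
  qed
  have ineq: "c \<le> (\<Sum>\<alpha>\<in>Mon D. p \<alpha> * z \<alpha>)"
    if lower: "\<And>x. x \<in> semialg m g \<Longrightarrow> c \<le> (\<Sum>\<alpha>\<in>Mon D. p \<alpha> * monom \<alpha> x)" for p c
  proof -
    \<comment> \<open>The coefficients are arbitrary outside \<open>Mon D\<close>; cutting them off
      yields a polynomial.\<close>
    define P where "P \<alpha> = (if \<alpha> \<in> Mon D then p \<alpha> else 0)" for \<alpha>
    have sub: "{\<beta>. P \<beta> \<noteq> 0} \<subseteq> Mon D" by (auto simp: P_def)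
    have "is_poly P" unfolding is_poly_def by (rule finite_subset[OF sub finite_Mon])
    moreover have "c \<le> peval P x" if "x \<in> semialg m g" for x
      using lower[OF that] by (simp add: peval_superset[OF finite_Mon sub] P_def)
    ultimately have "c \<le> act P z mzero"
      by (intro states_nonneg_on_semialg[OF g bnd _ _ z])
    then show ?thesis by (simp add: act_superset[OF finite_Mon sub] P_def)
  qed
  obtain x :: "nat \<Rightarrow> real^'n" and w :: "nat \<Rightarrow> real" and N :: nat
    where "\<And>k. x k \<in> semialg m g" "\<And>k. 0 \<le> w k" "(\<Sum>k<N. w k) = 1"
      "\<And>\<alpha>. \<alpha> \<in> Mon D \<Longrightarrow> (\<Sum>k<N. w k * monom \<alpha> (x k)) = z \<alpha>"
    using in_convex_hull_if_affine_inequalities[of "Mon D" "semialg m g" "\<lambda>x \<alpha>. monom \<alpha> x" z,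
        OF finite_Mon X continuous_on_monom ineq] by auto
  then show ?thesis
    by (intro atomic_in_moments_on[of _ x w _ _ N]) (auto simp: closed_semialg trunc_seq_def Mon_def)
qed

theorem theorem3:
  fixes d m :: nat and q :: real
    and g :: "nat \<Rightarrow> 'n::finite mpoly"
    and ystar :: "'n mpoly"
    and ys :: "nat \<Rightarrow> 'n mpoly"
  assumes q: "q < 1"
    and g_poly: "\<forall>j<m. is_poly (g j)"
    and X_compact: "compact (semialg m g)"
    and X_int: "interior (semialg m g) \<noteq> {}"
    and ball: "\<exists>j<m. \<exists>R. g j = ball_poly R"
    and ystar_feas: "ystar \<in> moments_on (2*d) (semialg m g)" "ystar mzero = 1"
    and ystar_opt: "\<forall>y\<in>moments_on (2*d) (semialg m g). y mzero = 1 \<longrightarrow> obj q d y \<le> obj q d ystar"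
    and ystar_unique: "\<forall>y\<in>moments_on (2*d) (semialg m g). y mzero = 1 \<longrightarrow>
                         obj q d y = obj q d ystar \<longrightarrow> y = ystar"
    and ys_feas: "\<forall>\<delta>. ys \<delta> \<in> moments_sdp d \<delta> m g \<and> ys \<delta> mzero = 1"
    and ys_opt: "\<forall>\<delta>. \<forall>y\<in>moments_sdp d \<delta> m g. y mzero = 1 \<longrightarrow> obj q d y \<le> obj q d (ys \<delta>)"
    and pd_star: "pd_on (Mon d) (mom_mat d ystar)"
    and pd_ys: "\<forall>\<delta>. pd_on (Mon d) (mom_mat d (ys \<delta>))"
  shows "((\<lambda>\<delta>. obj q d (ys \<delta>)) \<longlonglongrightarrow> obj q d ystar)
    \<and> (\<forall>\<alpha>. mdeg \<alpha> \<le> 2*d \<longrightarrow> (\<lambda>\<delta>. ys \<delta> \<alpha>) \<longlonglongrightarrow> ystar \<alpha>)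
    \<and> (\<forall>\<gamma>. (\<lambda>\<delta>. pd_poly q d (ys \<delta>) \<gamma>) \<longlonglongrightarrow> pd_poly q d ystar \<gamma>)
    \<and> (\<forall>\<delta>. (\<lambda>\<gamma>. pconst (trace_on (Mon d) (mpow_on (Mon d) (mom_mat d ystar) q)) \<gamma>
                    - pd_poly q d ystar \<gamma>) \<in> sos_cone d \<delta> m g
          \<longrightarrow> ys \<delta> = ystar \<and> ys \<delta> \<in> moments_on (2*d) (semialg m g))"
proof -
  obtain j0 R where j0: "j0 < m" "g j0 = ball_poly R" using ball by blast
  have gp: "is_poly (g j)" if "j < m" for j using g_poly that by blast
  have feas: "ys \<delta> \<in> moments_sdp d \<delta> m g" "ys \<delta> mzero = 1" and pd: "pd_on (Mon d) (mom_mat d (ys \<delta>))" for \<delta>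
    using ys_feas pd_ys by blast+
  have ge: "obj q d ystar \<le> obj q d (ys \<delta>)" for \<delta>
    using ys_opt moments_on_subset_sdp[OF gp X_compact ystar_feas(1)] ystar_feas(2) by blast
  have trunc_ys: "ys \<delta> \<alpha> = 0" and trunc_star: "ystar \<alpha> = 0" if "2 * d < mdeg \<alpha>" for \<delta> \<alpha>
    using feas(1)[of \<delta>] ystar_feas(1) that by (auto simp: moments_sdp_def moments_on_def trunc_seq_def)
  have entry: "(\<lambda>n. mom_mat d (u n) \<alpha> \<beta>) \<longlonglongrightarrow> mom_mat d v \<alpha> \<beta>"
    if "\<alpha> \<in> Mon d" "\<beta> \<in> Mon d" "\<And>\<gamma>. mdeg \<gamma> \<le> 2 * d \<Longrightarrow> (\<lambda>n. u n \<gamma>) \<longlonglongrightarrow> v \<gamma>" for u v \<alpha> \<beta>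
    unfolding mom_mat_def by (rule that(3)) (use that(1,2) in \<open>simp add: Mon_def\<close>)
  have lim: "(\<lambda>\<delta>. ys \<delta> \<alpha>) \<longlonglongrightarrow> ystar \<alpha>" if \<alpha>: "mdeg \<alpha> \<le> 2 * d" for \<alpha>
  proof (rule tendsto_if_subseq_tendsto)
    fix r :: "nat \<Rightarrow> nat" assume r: "strict_mono r"
    obtain s z where s: "strict_mono (s :: nat \<Rightarrow> nat)" and z: "z \<in> states m g"
      and lim_z: "\<forall>\<alpha>. mdeg \<alpha> \<le> 2 * d \<longrightarrow> (\<lambda>n. ys (r (s n)) \<alpha>) \<longlonglongrightarrow> z \<alpha>"
      using relaxation_limit_state[OF j0 feas r] by (elim exE conjE) (rule that)
    define z' where "z' \<alpha> = (if mdeg \<alpha> \<le> 2 * d then z \<alpha> else 0)" for \<alpha>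
    have z': "z' \<in> moments_on (2 * d) (semialg m g)"
      unfolding z'_def[abs_def] by (rule truncated_state_in_moments_on[OF gp j0 X_compact z])
    have z'0: "z' mzero = 1" using z by (simp add: z'_def states_def)
    have lim_z': "(\<lambda>n. ys (r (s n)) \<gamma>) \<longlonglongrightarrow> z' \<gamma>" if "mdeg \<gamma> \<le> 2 * d" for \<gamma>
      using lim_z that by (simp add: z'_def)
    \<comment> \<open>Positive definiteness of the limit is not known at this point. The limit value
      is at least the ideal optimum by \<open>ge\<close>, so uniqueness identifies the
      limit.\<close>
    have "(\<lambda>n. obj q d (ys (r (s n)))) \<longlonglongrightarrow> obj q d z'"
      unfolding obj_def by (intro kiefer_tendsto finite_Mon Mon_nonempty q pd entry lim_z')
    then have "obj q d ystar \<le> obj q d z'" by (rule LIMSEQ_le_const) (use ge in blast)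
    then have "obj q d z' = obj q d ystar" using ystar_opt z' z'0 by (meson antisym)
    then have "z' = ystar" using ystar_unique z' z'0 by blast
    then show "\<exists>s. strict_mono s \<and> (\<lambda>n. ys (r (s n)) \<alpha>) \<longlonglongrightarrow> ystar \<alpha>"
      using s lim_z'[OF \<alpha>] by blast
  qed
  have "(\<lambda>\<delta>. obj q d (ys \<delta>)) \<longlonglongrightarrow> obj q d ystar"
    unfolding obj_def by (intro kiefer_tendsto finite_Mon Mon_nonempty q pd entry lim)
  moreover have "(\<lambda>\<delta>. pd_poly q d (ys \<delta>) \<gamma>) \<longlonglongrightarrow> pd_poly q d ystar \<gamma>" for \<gamma>
  proof -
    have mpow: "(\<lambda>\<delta>. mpow_on (Mon d) (mom_mat d (ys \<delta>)) (q - 1) \<alpha> \<beta>)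
        \<longlonglongrightarrow> mpow_on (Mon d) (mom_mat d ystar) (q - 1) \<alpha> \<beta>" for \<alpha> \<beta>
      by (intro mpow_on_tendsto finite_Mon pd pd_star entry lim)
    show ?thesis unfolding pd_poly_def quad_poly_def case_prod_beta by (intro tendsto_sum mpow)
  qed
  moreover have "ys \<delta> = ystar"
    if sos: "(\<lambda>\<gamma>. pconst (trace_on (Mon d) (mpow_on (Mon d) (mom_mat d ystar) q)) \<gamma>
                    - pd_poly q d ystar \<gamma>) \<in> sos_cone d \<delta> m g" for \<delta>
  proof -
    let ?A = "mom_mat d ystar"
    \<comment> \<open>The certificate may involve degrees up to 2 (d + \<delta>) and is tested on
      the extension \<open>w\<close>, whereas the certified polynomial only sees moments up to 2 d,
      where \<open>w\<close> and \<open>ys \<delta>\<close> agree.\<close>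
    from feas(1)[of \<delta>] obtain w where w: "\<forall>\<alpha>. mdeg \<alpha> \<le> 2 * d \<longrightarrow> w \<alpha> = ys \<delta> \<alpha>"
      "psd_on (Mon (d + \<delta>)) (mom_mat (d + \<delta>) w)"
      "\<forall>j<m. vj (g j) \<le> d + \<delta> \<longrightarrow> psd_on (Mon (d + \<delta> - vj (g j))) (loc_mat (d + \<delta> - vj (g j)) (g j) w)"
      unfolding moments_sdp_def by blast
    have w0: "w mzero = 1" using w(1) feas(2)[of \<delta>] by simp
    have "0 \<le> trace_on (Mon d) (mpow_on (Mon d) ?A q) -
        (\<Sum>\<alpha>\<in>Mon d. \<Sum>\<beta>\<in>Mon d. mpow_on (Mon d) ?A (q - 1) \<alpha> \<beta> * mom_mat d w \<alpha> \<beta>)"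
      using act_sos_cone_nonneg[OF sos gp w(2)] w(3)
      unfolding pd_poly_def act_const_minus_quad_poly[where y = w, OF w0] by blast
    moreover have "mom_mat d w \<alpha> \<beta> = mom_mat d (ys \<delta>) \<alpha> \<beta>" if "\<alpha> \<in> Mon d" "\<beta> \<in> Mon d" for \<alpha> \<beta>
      using w(1) that by (simp add: mom_mat_def Mon_def)
    ultimately have tangent: "(\<Sum>\<alpha>\<in>Mon d. \<Sum>\<beta>\<in>Mon d. mpow_on (Mon d) ?A (q - 1) \<alpha> \<beta> * mom_mat d (ys \<delta>) \<alpha> \<beta>)
        \<le> trace_on (Mon d) (mpow_on (Mon d) ?A q)" by simp
    show ?thesis
    proof
      fix \<gamma>
      \<comment> \<open>Up to degree 2 d equality is read off the moment matrices; beyond it both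
        sequences are 0 by the truncation convention.\<close>
      show "ys \<delta> \<gamma> = ystar \<gamma>"
      proof (cases "mdeg \<gamma> \<le> 2 * d")
        case True
        then obtain \<alpha> \<beta> where \<gamma>: "madd \<alpha> \<beta> = \<gamma>" "mdeg \<alpha> \<le> d" "mdeg \<beta> \<le> d"
          using mexp_split[of \<gamma> d d] by auto
        have "mom_mat d (ys \<delta>) \<alpha> \<beta> = ?A \<alpha> \<beta>"
          by (rule kiefer_tangent_equality[OF finite_Mon Mon_nonempty q pd_star pd tangent])
             (use ge \<gamma> in \<open>simp_all add: obj_def Mon_def\<close>)
        then show ?thesis using \<gamma>(1) by (simp add: mom_mat_def)
      qed (simp add: trunc_ys trunc_star)
    qed
  qed
  ultimately show ?thesis using lim ystar_feas(1) by auto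
qed

end
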